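(* Let $\boldsymbol s=(s_1,\dots,s_{m+n})\in S_{m|n}$, let $i\in\{1,\dots,m+n-1\}$ with $s_i\ne s_{i+1}$, and let $\tilde{\boldsymbol s}\in S_{m|n}$ be obtained from $\boldsymbol s$ by switching $s_i$ and $s_{i+1}$. Let $\boldsymbol\zeta^{\boldsymbol s}=(\zeta_j^{\boldsymbol s}(u))_{1\le j\le m+n}$ be an $\ell^{\boldsymbol s}$-weight and $L(\boldsymbol\zeta^{\boldsymbol s})$ the corresponding irreducible highest $\ell^{\boldsymbol s}$-weight module over $\mathrm Y(\mathfrak{gl}_{m|n}^{\boldsymbol s})$ with highest $\ell^{\boldsymbol s}$-weight vector $v^{\boldsymbol s}$. Suppose that $\zeta_i^{\boldsymbol s}(u)/\zeta_{i+1}^{\boldsymbol s}(u)$ is the expansion at $u=\infty$ of a rational function, and write $$\frac{\zeta_i^{\boldsymbol s}(u)}{\zeta_{i+1}^{\boldsymbol s}(u)}=\frac{\varphi_i^{\boldsymbol s}(u)}{\psi_i^{\boldsymbol s}(u)},$$ where $\varphi_i^{\boldsymbol s}(u),\psi_i^{\boldsymbol s}(u)$ are relatively prime monic polynomials of degree $k\in\mathbb Z_{\ge0}$. Then the vector $v^{\tilde{\boldsymbol s}}:=f_{i,1}^{\boldsymbol s}\cdots f_{i,k}^{\boldsymbol s}v^{\boldsymbol s}\in L(\boldsymbol\zeta^{\boldsymbol s})$ is a highest $\ell^{\tilde{\boldsymbol s}}$-weight vector of $\ell^{\tilde{\boldsymbol s}}$-weight $\boldsymbol\zeta^{\tilde{\boldsymbol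 s}}=(\zeta_j^{\tilde{\boldsymbol s}}(u))_{1\le j\le m+n}$, where $\zeta_j^{\tilde{\boldsymbol s}}(u)=\zeta_j^{\boldsymbol s}(u)$ for $j\ne i,i+1$ and $$\zeta_i^{\tilde{\boldsymbol s}}(u)=\zeta_{i+1}^{\boldsymbol s}(u)\frac{\psi_i^{\boldsymbol s}(u-s_i)}{\psi_i^{\boldsymbol s}(u)},\qquad \zeta_{i+1}^{\tilde{\boldsymbol s}}(u)=\zeta_i^{\boldsymbol s}(u)\frac{\varphi_i^{\boldsymbol s}(u-s_i)}{\varphi_i^{\boldsymbol s}(u)}.$$
   Context: Everything is over $\mathbb C$ and superalgebras/modules are $\mathbb Z_2$-graded (modules differing only by a parity shift are not distinguished). $m,n\in\mathbb Z_{\ge0}$. $S_{m|n}$ is the set of sequences $(s_1,\dots,s_{m+n})$ with $s_i\in\{\pm1\}$ in which $1$ occurs exactly $m$ times (parity sequences). For $\boldsymbol s\in S_{m|n}$ define $|i|\in\mathbb Z_2$ by $s_i=(-1)^{|i|}$. The super Yangian $\mathrm Y(\mathfrak{gl}_{m|n}^{\boldsymbol s})$ is the unital associative superalgebra with generators $t_{ij}^{(r)}$ ($1\le i,j\le m+n$, $r\ge1$) of parity $|i|+|j|$ and, with $t_{ij}(u)=\delta_{ij}+\sum_{r\ge1}t_{ij}^{(r)}u^{-r}$, defining relations $$(u_1-u_2)[t_{ij}(u_1),t_{kl}(u_2)]=(-1)^{|i||j|+|i||k|+|j||k|}\big(t_{kj}(u_1)t_{il}(u_2)-t_{kj}(u_2)t_{il}(u_1)\big)$$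 ($[\cdot,\cdot]$ is the supercommutator). When the dependence on $\boldsymbol s$ matters, write $t_{ij}^{\boldsymbol s}(u)$, and similarly for the series below. Gauss decomposition: there are unique series $d_k(u)\in1+u^{-1}\mathrm Y[[u^{-1}]]$ ($1\le k\le m+n$) and $e_{ij}(u),f_{ji}(u)\in u^{-1}\mathrm Y[[u^{-1}]]$ ($1\le i<j\le m+n$) with $t_{ii}(u)=d_i(u)+\sum_{k<i}f_{ik}(u)d_k(u)e_{ki}(u)$, $t_{ij}(u)=d_i(u)e_{ij}(u)+\sum_{k<i}f_{ik}(u)d_k(u)e_{kj}(u)$, $t_{ji}(u)=f_{ji}(u)d_i(u)+\sum_{k<i}f_{jk}(u)d_k(u)e_{ki}(u)$ for $i<j$. Write $f_{i+1,i}(u)=f_i(u)=\sum_{r\ge1}f_{i,r}u^{-r}$. An $\ell^{\boldsymbol s}$-weight is a tuple $(\zeta_j(u))_{1\le j\le m+n}$ with $\zeta_j(u)\in1+u^{-1}\mathbb C[[u^{-1}]]$. A nonzero $\mathbb Z_2$-homogeneous vector $v$ is a highest $\ell^{\boldsymbol s}$-weight vector of $\ell^{\boldsymbol s}$-weight $(\zeta_j(u))_j$ if $e_{ij}^{\boldsymbol s}(u)v=0$ for all $i<j$ and $d_j^{\boldsymbol s}(u)v=\zeta_j(u)v$ for all $j$. For every $\ell^{\boldsymbol s}$-weight there is a unique irreducible module $L(\boldsymbol\zeta^{\boldsymbol s})$ generated by such a vector. For $\tilde{\boldsymbol s}$ obtained from $\boldsymbol s$ by switching $s_i\neq s_{i+1}$,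 let $\sigma=(i,i+1)$. The super Yangians for $\boldsymbol s$ and $\tilde{\boldsymbol s}$ are identified via the isomorphism $t_{ab}^{\boldsymbol s}(u)\mapsto t_{\sigma(a)\sigma(b)}^{\tilde{\boldsymbol s}}(u)$; in this way $L(\boldsymbol\zeta^{\boldsymbol s})$ is also a module over $\mathrm Y(\mathfrak{gl}_{m|n}^{\tilde{\boldsymbol s}})$, and highest $\ell^{\tilde{\boldsymbol s}}$-weight vectors are taken with respect to the series $d_j^{\tilde{\boldsymbol s}}(u),e_{ab}^{\tilde{\boldsymbol s}}(u)$. Rational functions of $u$ are expanded at $u=\infty$. *)

theory Defs
  imports
    "HOL-Library.Poly_Mapping"
    "HOL-Library.Z2"
    "HOL-Algebra.QuotRing"
    "HOL-Combinatorics.Transposition"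
    "HOL-Computational_Algebra.Computational_Algebra"
begin

section \<open>Free associative algebras\<close>

text \<open>
  Words form a monoid under concatenation (written additively, as \<^theory>\<open>HOL-Library.Poly_Mapping\<close>
  expects for exponents), so that \<open>'g list \<Rightarrow>\<^sub>0 complex\<close> with the convolution product of that
  theory is the free unital associative complex algebra on the letters \<open>'g\<close>.
\<close>

instantiation list :: (type) monoid_add
begin
definition zero_list :: "'a list" where "0 = []"
definition plus_list :: "'a list \<Rightarrow> 'a list \<Rightarrow> 'a list" where "xs + ys = xs @ ys"
instance by standard (simp_all add: zero_list_def plus_list_def)
end

definition free_algebra :: "'g set \<Rightarrow> ('g list \<Rightarrow>\<^sub>0 complex) ring" where
  "free_algebra X = \<lparr>carrier = {p. \<forall>w \<in> Poly_Mapping.keys p. set w \<subseteq> X},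
     monoid.mult = (*), one = 1, zero = 0, add = (+)\<rparr>"

definition free_scalar :: "complex \<Rightarrow> ('g list \<Rightarrow>\<^sub>0 complex)" where
  "free_scalar c = Poly_Mapping.single 0 c"


section \<open>Parity sequences\<close>

text \<open>Only the values at \<open>1, \<dots>, m + n\<close> of a parity sequence are meaningful.\<close>

definition parity_sequence :: "nat \<Rightarrow> nat \<Rightarrow> (nat \<Rightarrow> int) \<Rightarrow> bool" where
  "parity_sequence m n s \<longleftrightarrow>
     (\<forall>i \<in> {1..m+n}. s i \<in> {1, -1}) \<and> card {i \<in> {1..m+n}. s i = 1} = m"

definition parity :: "(nat \<Rightarrow> int) \<Rightarrow> nat \<Rightarrow> bit" where
  "parity s i = (if s i = 1 then 0 else 1)"

definition koszul_sign :: "bit \<Rightarrow> complex" where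
  "koszul_sign a = (if a = 0 then 1 else -1)"

definition switch :: "nat \<Rightarrow> (nat \<Rightarrow> int) \<Rightarrow> nat \<Rightarrow> int" where
  "switch i s = s \<circ> transpose i (i + 1)"


section \<open>The super Yangian\<close>

text \<open>The letter \<open>(i, j, r)\<close> stands for $t_{ij}^{(r)}$; below $t_{ij}^{(0)} = \delta_{ij}$.\<close>

definition yangian_letters :: "nat \<Rightarrow> (nat \<times> nat \<times> nat) set" where
  "yangian_letters N = {1..N} \<times> {1..N} \<times> {1..}"

definition free_t :: "nat \<Rightarrow> nat \<Rightarrow> nat \<Rightarrow> ((nat \<times> nat \<times> nat) list \<Rightarrow>\<^sub>0 complex)" where
  "free_t i j r =
     (if r = 0 then (if i = j then 1 else 0) else Poly_Mapping.single [(i, j, r)] 1)"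

definition free_supercomm ::
  "(nat \<Rightarrow> int) \<Rightarrow> nat \<times> nat \<times> nat \<Rightarrow> nat \<times> nat \<times> nat
     \<Rightarrow> ((nat \<times> nat \<times> nat) list \<Rightarrow>\<^sub>0 complex)" where
  "free_supercomm s = (\<lambda>(i, j, p) (k, l, q).
     free_t i j p * free_t k l q
     - free_scalar (koszul_sign ((parity s i + parity s j) * (parity s k + parity s l)))
         * (free_t k l q * free_t i j p))"

text \<open>
  Difference of the two sides of the defining relation at $u_1^{-p} u_2^{-q}$, $p, q \ge 0$.
  The remaining coefficients, those containing a positive power of $u_1$ or $u_2$, only involve
  supercommutators with $\delta_{ij}$ or $\delta_{kl}$ and vanish identically.
\<close>

definition yangian_relator ::
  "(nat \<Rightarrow> int) \<Rightarrow> nat \<Rightarrow> nat \<Rightarrow> nat \<Rightarrow> nat \<Rightarrow> nat \<Rightarrow> nat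
     \<Rightarrow> ((nat \<times> nat \<times> nat) list \<Rightarrow>\<^sub>0 complex)" where
  "yangian_relator s i j k l p q =
     free_supercomm s (i, j, p + 1) (k, l, q) - free_supercomm s (i, j, p) (k, l, q + 1)
     - free_scalar (koszul_sign (parity s i * parity s j + parity s i * parity s k
                                  + parity s j * parity s k))
         * (free_t k j p * free_t i l q - free_t k j q * free_t i l p)"

definition yangian_ideal ::
  "nat \<Rightarrow> (nat \<Rightarrow> int) \<Rightarrow> ((nat \<times> nat \<times> nat) list \<Rightarrow>\<^sub>0 complex) set" where
  "yangian_ideal N s = Idl\<^bsub>free_algebra (yangian_letters N)\<^esub>
     {yangian_relator s i j k l p q | i j k l p q.
        i \<in> {1..N} \<and> j \<in> {1..N} \<and> k \<in> {1..N} \<and> l \<in> {1..N}}"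

type_synonym yangian_elt = "((nat \<times> nat \<times> nat) list \<Rightarrow>\<^sub>0 complex) set"

definition yangian :: "nat \<Rightarrow> (nat \<Rightarrow> int) \<Rightarrow> yangian_elt ring" where
  "yangian N s = free_algebra (yangian_letters N) Quot yangian_ideal N s"

definition yangian_class ::
  "nat \<Rightarrow> (nat \<Rightarrow> int) \<Rightarrow> ((nat \<times> nat \<times> nat) list \<Rightarrow>\<^sub>0 complex) \<Rightarrow> yangian_elt" where
  "yangian_class N s p = yangian_ideal N s +>\<^bsub>free_algebra (yangian_letters N)\<^esub> p"

definition yangian_scalar :: "nat \<Rightarrow> (nat \<Rightarrow> int) \<Rightarrow> complex \<Rightarrow> yangian_elt" where
  "yangian_scalar N s c = yangian_class N s (free_scalar c)"

definition yangian_t :: "nat \<Rightarrow> (nat \<Rightarrow> int) \<Rightarrow> nat \<Rightarrow> nat \<Rightarrow> nat \<Rightarrow> yangian_elt" where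
  "yangian_t N s i j r = yangian_class N s (free_t i j r)"

definition word_parity :: "(nat \<Rightarrow> int) \<Rightarrow> (nat \<times> nat \<times> nat) list \<Rightarrow> bit" where
  "word_parity s w = (\<Sum>(i, j, r) \<leftarrow> w. parity s i + parity s j)"

definition yangian_part :: "nat \<Rightarrow> (nat \<Rightarrow> int) \<Rightarrow> bit \<Rightarrow> yangian_elt set" where
  "yangian_part N s a = yangian_class N s `
     {p \<in> carrier (free_algebra (yangian_letters N)).
        \<forall>w \<in> Poly_Mapping.keys p. word_parity s w = a}"


section \<open>Gauss decomposition\<close>

text \<open>A function \<open>a :: nat \<Rightarrow> 'a\<close> stands for the series $\sum_{r \ge 0} a_r u^{-r}$.\<close>

definition is_series :: "('a, 'b) ring_scheme \<Rightarrow> (nat \<Rightarrow> 'a) \<Rightarrow> bool" where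
  "is_series R a \<longleftrightarrow> (\<forall>r. a r \<in> carrier R)"

definition series_mult ::
  "('a, 'b) ring_scheme \<Rightarrow> (nat \<Rightarrow> 'a) \<Rightarrow> (nat \<Rightarrow> 'a) \<Rightarrow> nat \<Rightarrow> 'a" where
  "series_mult R a b = (\<lambda>r. \<Oplus>\<^bsub>R\<^esub>p \<in> {..r}. a p \<otimes>\<^bsub>R\<^esub> b (r - p))"

definition gauss_decomposition ::
  "('a, 'b) ring_scheme \<Rightarrow> nat \<Rightarrow> (nat \<Rightarrow> nat \<Rightarrow> nat \<Rightarrow> 'a) \<Rightarrow>
   (nat \<Rightarrow> nat \<Rightarrow> 'a) \<Rightarrow> (nat \<Rightarrow> nat \<Rightarrow> nat \<Rightarrow> 'a) \<Rightarrow> (nat \<Rightarrow> nat \<Rightarrow> nat \<Rightarrow> 'a) \<Rightarrow> bool" where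
  "gauss_decomposition R N t d e f \<longleftrightarrow>
     (\<forall>i \<in> {1..N}. is_series R (d i) \<and> d i 0 = \<one>\<^bsub>R\<^esub>) \<and>
     (\<forall>j \<in> {1..N}. \<forall>i \<in> {1..<j}.
        is_series R (e i j) \<and> e i j 0 = \<zero>\<^bsub>R\<^esub> \<and> is_series R (f j i) \<and> f j i 0 = \<zero>\<^bsub>R\<^esub>) \<and>
     (\<forall>i \<in> {1..N}. \<forall>r.
        t i i r = d i r
          \<oplus>\<^bsub>R\<^esub> (\<Oplus>\<^bsub>R\<^esub>k \<in> {1..<i}. series_mult R (f i k) (series_mult R (d k) (e k i)) r)) \<and>
     (\<forall>j \<in> {1..N}. \<forall>i \<in> {1..<j}. \<forall>r.
        t i j r = series_mult R (d i) (e i j) r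
          \<oplus>\<^bsub>R\<^esub> (\<Oplus>\<^bsub>R\<^esub>k \<in> {1..<i}. series_mult R (f i k) (series_mult R (d k) (e k j)) r) \<and>
        t j i r = series_mult R (f j i) (d i) r
          \<oplus>\<^bsub>R\<^esub> (\<Oplus>\<^bsub>R\<^esub>k \<in> {1..<i}. series_mult R (f j k) (series_mult R (d k) (e k i)) r))"

definition yangian_gauss :: "nat \<Rightarrow> (nat \<Rightarrow> int) \<Rightarrow>
   (nat \<Rightarrow> nat \<Rightarrow> yangian_elt) \<times> (nat \<Rightarrow> nat \<Rightarrow> nat \<Rightarrow> yangian_elt) \<times>
   (nat \<Rightarrow> nat \<Rightarrow> nat \<Rightarrow> yangian_elt)" where
  "yangian_gauss N s =
     (SOME (d, e, f). gauss_decomposition (yangian N s) N (yangian_t N s) d e f)"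

definition yangian_d :: "nat \<Rightarrow> (nat \<Rightarrow> int) \<Rightarrow> nat \<Rightarrow> nat \<Rightarrow> yangian_elt" where
  "yangian_d N s = fst (yangian_gauss N s)"

definition yangian_e :: "nat \<Rightarrow> (nat \<Rightarrow> int) \<Rightarrow> nat \<Rightarrow> nat \<Rightarrow> nat \<Rightarrow> yangian_elt" where
  "yangian_e N s = fst (snd (yangian_gauss N s))"

definition yangian_f :: "nat \<Rightarrow> (nat \<Rightarrow> int) \<Rightarrow> nat \<Rightarrow> nat \<Rightarrow> nat \<Rightarrow> yangian_elt" where
  "yangian_f N s = snd (snd (yangian_gauss N s))"


section \<open>Modules\<close>

text \<open>
  A \<open>\<int>\<^sub>2\<close>-graded module on the complex vector space \<open>'v\<close> with homogeneous components \<open>V 0\<close>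
  and \<open>V 1\<close>; the values of \<open>act\<close> outside the carrier of the Yangian are irrelevant.
\<close>

definition yangian_module ::
  "nat \<Rightarrow> (nat \<Rightarrow> int) \<Rightarrow> (complex \<Rightarrow> 'v::ab_group_add \<Rightarrow> 'v) \<Rightarrow> (bit \<Rightarrow> 'v set) \<Rightarrow>
   (yangian_elt \<Rightarrow> 'v \<Rightarrow> 'v) \<Rightarrow> bool" where
  "yangian_module N s scale V act \<longleftrightarrow>
     vector_space scale \<and>
     (\<forall>a. module.subspace scale (V a)) \<and>
     (\<forall>v. \<exists>!(v0, v1). v0 \<in> V 0 \<and> v1 \<in> V 1 \<and> v = v0 + v1) \<and>
     (\<forall>y \<in> carrier (yangian N s). \<forall>v w. act y (v + w) = act y v + act y w) \<and>
     (\<forall>x \<in> carrier (yangian N s). \<forall>y \<in> carrier (yangian N s). \<forall>v.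
        act (x \<oplus>\<^bsub>yangian N s\<^esub> y) v = act x v + act y v \<and>
        act (x \<otimes>\<^bsub>yangian N s\<^esub> y) v = act x (act y v)) \<and>
     (\<forall>c v. act (yangian_scalar N s c) v = scale c v) \<and>
     (\<forall>a b. \<forall>y \<in> yangian_part N s a. \<forall>v \<in> V b. act y v \<in> V (a + b))"

definition graded_submodule ::
  "nat \<Rightarrow> (nat \<Rightarrow> int) \<Rightarrow> (complex \<Rightarrow> 'v::ab_group_add \<Rightarrow> 'v) \<Rightarrow> (bit \<Rightarrow> 'v set) \<Rightarrow>
   (yangian_elt \<Rightarrow> 'v \<Rightarrow> 'v) \<Rightarrow> 'v set \<Rightarrow> bool" where
  "graded_submodule N s scale V act W \<longleftrightarrow>
     module.subspace scale W \<and>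
     (\<forall>w \<in> W. \<exists>w0 \<in> W \<inter> V 0. \<exists>w1 \<in> W \<inter> V 1. w = w0 + w1) \<and>
     (\<forall>y \<in> carrier (yangian N s). \<forall>w \<in> W. act y w \<in> W)"

definition irreducible_yangian_module ::
  "nat \<Rightarrow> (nat \<Rightarrow> int) \<Rightarrow> (complex \<Rightarrow> 'v::ab_group_add \<Rightarrow> 'v) \<Rightarrow> (bit \<Rightarrow> 'v set) \<Rightarrow>
   (yangian_elt \<Rightarrow> 'v \<Rightarrow> 'v) \<Rightarrow> bool" where
  "irreducible_yangian_module N s scale V act \<longleftrightarrow>
     yangian_module N s scale V act \<and> (\<exists>v. v \<noteq> (0 :: 'v)) \<and>
     (\<forall>W. graded_submodule N s scale V act W \<longrightarrow> W = {0} \<or> W = UNIV)"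

text \<open>
  Scalar series in $u^{-1}$ are Laurent series in the variable \<open>fls_X\<close> $= u^{-1}$, so that
  quotients and rational functions of $u$ can be expanded in the field \<open>complex fls\<close>.
\<close>

definition ell_weight :: "nat \<Rightarrow> (nat \<Rightarrow> complex fls) \<Rightarrow> bool" where
  "ell_weight N \<zeta> \<longleftrightarrow> (\<forall>j \<in> {1..N}. \<exists>g. \<zeta> j = fps_to_fls g \<and> fps_nth g 0 = 1)"

definition highest_ell_weight_vector ::
  "nat \<Rightarrow> (nat \<Rightarrow> int) \<Rightarrow> (complex \<Rightarrow> 'v::ab_group_add \<Rightarrow> 'v) \<Rightarrow> (bit \<Rightarrow> 'v set) \<Rightarrow>
   (yangian_elt \<Rightarrow> 'v \<Rightarrow> 'v) \<Rightarrow> (nat \<Rightarrow> complex fls) \<Rightarrow> 'v \<Rightarrow> bool" where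
  "highest_ell_weight_vector N s scale V act \<zeta> v \<longleftrightarrow>
     ell_weight N \<zeta> \<and> v \<noteq> 0 \<and> (\<exists>a. v \<in> V a) \<and>
     (\<forall>j \<in> {1..N}. \<forall>i \<in> {1..<j}. \<forall>r. act (yangian_e N s i j r) v = 0) \<and>
     (\<forall>j \<in> {1..N}. \<forall>r. act (yangian_d N s j r) v = scale (fls_nth (\<zeta> j) (int r)) v)"

text \<open>
  The module \<open>L(\<zeta>)\<close>, determined up to isomorphism, with its highest weight vector \<open>v\<close>.
\<close>

definition irreducible_highest_module ::
  "nat \<Rightarrow> (nat \<Rightarrow> int) \<Rightarrow> (complex \<Rightarrow> 'v::ab_group_add \<Rightarrow> 'v) \<Rightarrow> (bit \<Rightarrow> 'v set) \<Rightarrow>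
   (yangian_elt \<Rightarrow> 'v \<Rightarrow> 'v) \<Rightarrow> (nat \<Rightarrow> complex fls) \<Rightarrow> 'v \<Rightarrow> bool" where
  "irreducible_highest_module N s scale V act \<zeta> v \<longleftrightarrow>
     irreducible_yangian_module N s scale V act \<and>
     highest_ell_weight_vector N s scale V act \<zeta> v \<and>
     (\<forall>w. \<exists>y \<in> carrier (yangian N s). w = act y v)"


section \<open>Switching two adjacent parities\<close>

definition free_relabel ::
  "(nat \<Rightarrow> nat) \<Rightarrow> ((nat \<times> nat \<times> nat) list \<Rightarrow>\<^sub>0 complex) \<Rightarrow> ((nat \<times> nat \<times> nat) list \<Rightarrow>\<^sub>0 complex)"
where
  "free_relabel \<sigma> p = (\<Sum>w \<in> Poly_Mapping.keys p.
     Poly_Mapping.single (map (\<lambda>(a, b, r). (\<sigma> a, \<sigma> b, r)) w) (Poly_Mapping.lookup p w))"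

text \<open>
  Relabelling by the transposition $\sigma = (i, i+1)$ is an automorphism of the free algebra that
  interchanges the ideals for \<open>s\<close> and \<open>switch i s\<close>. Hence taking images of cosets is the
  isomorphism between the two Yangians with $t_{ab} \mapsto t_{\sigma(a)\sigma(b)}$, in either
  direction.
\<close>

definition switch_iso :: "nat \<Rightarrow> yangian_elt \<Rightarrow> yangian_elt" where
  "switch_iso i C = free_relabel (transpose i (i + 1)) ` C"

definition switch_action ::
  "nat \<Rightarrow> (yangian_elt \<Rightarrow> 'v \<Rightarrow> 'v) \<Rightarrow> yangian_elt \<Rightarrow> 'v \<Rightarrow> 'v" where
  "switch_action i act y = act (switch_iso i y)"


section \<open>Expansion at infinity\<close>

text \<open>A polynomial in \<open>u\<close> is expanded by substituting \<open>u = fls_X_inv\<close>.\<close>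

definition poly_at_infinity :: "complex poly \<Rightarrow> complex fls" where
  "poly_at_infinity p = poly (map_poly fls_const p) fls_X_inv"


section \<open>Well-definedness\<close>

text \<open>
  The Gauss decomposition chosen in \<^const>\<open>yangian_gauss\<close> exists
  (\<open>yangian_gauss_decomposition\<close>), and \<^const>\<open>switch_iso\<close> has the stated effect on
  generators (\<open>switch_iso_t\<close>).
\<close>

lemma keys_mult_set:
  assumes "\<forall>w\<in>Poly_Mapping.keys p. set w \<subseteq> X" "\<forall>w\<in>Poly_Mapping.keys (q::'g list \<Rightarrow>\<^sub>0 complex). set w \<subseteq> X"
  shows "\<forall>w\<in>Poly_Mapping.keys (p*q). set w \<subseteq> X"
  using keys_mult[of p q] assms by (fastforce simp: plus_list_def)

lemma free_algebra_ring: "ring (free_algebra X)"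
proof (rule ringI)
  show "abelian_group (free_algebra X)"
  proof (rule abelian_groupI)
    show "x \<oplus>\<^bsub>free_algebra X\<^esub> y \<in> carrier (free_algebra X)" if "x \<in> carrier (free_algebra X)" "y \<in> carrier (free_algebra X)" for x y
      using that Poly_Mapping.keys_add[of x y] by (fastforce simp: free_algebra_def)
    show "\<exists>y\<in>carrier (free_algebra X). y \<oplus>\<^bsub>free_algebra X\<^esub> x = \<zero>\<^bsub>free_algebra X\<^esub>" if "x \<in> carrier (free_algebra X)" for x
      using that by (intro bexI[of _ "-x"]) (auto simp: free_algebra_def)
  qed (auto simp: free_algebra_def add_ac)
  show "Group.monoid (free_algebra X)"
  proof (rule monoidI)
    show "x \<otimes>\<^bsub>free_algebra X\<^esub> y \<in> carrier (free_algebra X)" if "x \<in> carrier (free_algebra X)" "y \<in> carrier (free_algebra X)" for x y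
      using that keys_mult_set[of x X y] by (simp add: free_algebra_def)
  qed (simp_all add: free_algebra_def mult.assoc zero_list_def)
qed (auto simp: free_algebra_def algebra_simps)

context ring begin

lemma series_mult_closed:
  "is_series R a \<Longrightarrow> is_series R b \<Longrightarrow> is_series R (series_mult R a b)"
  by (auto simp: is_series_def series_mult_def)

lemma series_mult_cong:
  assumes "is_series R a" "is_series R b" "\<And>p. p \<le> r \<Longrightarrow> a p = a' p" "\<And>p. p \<le> r \<Longrightarrow> b p = b' p"
  shows "series_mult R a b r = series_mult R a' b' r"
  unfolding series_mult_def
  by (rule add.finprod_cong') (use assms in \<open>auto simp: is_series_def Pi_def simp flip: assms(3,4)\<close>)

lemma triple_cong:
  assumes s: "is_series R a" "is_series R b" "is_series R c"
     and s': "is_series R a'" "is_series R b'" "is_series R c'"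
     and z: "a 0 = \<zero>" "c 0 = \<zero>" "a' 0 = \<zero>" "c' 0 = \<zero>"
     and eq: "\<And>p. p < r \<Longrightarrow> a p = a' p" "\<And>p. p < r \<Longrightarrow> b p = b' p" "\<And>p. p < r \<Longrightarrow> c p = c' p"
  shows "series_mult R a (series_mult R b c) r = series_mult R a' (series_mult R b' c') r"
proof -
  have c0: "series_mult R b c 0 = \<zero>" "series_mult R b' c' 0 = \<zero>"
    using s s' z by (auto simp: series_mult_def is_series_def)
  have "a p \<otimes> series_mult R b c (r - p) = a' p \<otimes> series_mult R b' c' (r - p)" if "p \<le> r" for p
  proof -
    consider "p = 0" | "p = r" | "0 < p" "p < r" using \<open>p \<le> r\<close> by linarith
    then show ?thesis
    proof cases
      case 1 then show ?thesis using z series_mult_closed[OF s(2,3)] series_mult_closed[OF s'(2,3)]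
        by (auto simp: is_series_def)
    next
      case 2 then show ?thesis using c0 s s' by (auto simp: is_series_def)
    next
      case 3
      have "series_mult R b c (r-p) = series_mult R b' c' (r-p)"
        by (rule series_mult_cong) (use s 3 eq in auto)
      then show ?thesis using eq(1) 3 by simp
    qed
  qed
  then show ?thesis
    unfolding series_mult_def[of R a] series_mult_def[of R a']
    by (intro add.finprod_cong')
       (use s s' series_mult_closed[OF s'(2,3)] in \<open>auto simp: is_series_def Pi_def\<close>)
qed


definition gstep :: "nat \<Rightarrow> (nat\<Rightarrow>nat\<Rightarrow>nat\<Rightarrow>'a) \<Rightarrow> nat \<Rightarrow> (nat\<Rightarrow>nat\<Rightarrow>nat\<Rightarrow>'a) \<Rightarrow> nat \<Rightarrow> nat \<Rightarrow> 'a" where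
  "gstep N t r h i j = (if i \<in> {1..N} \<and> j \<in> {1..N} then
     (if r = 0 then (if i = j then \<one> else \<zero>)
      else (t i j r \<ominus> (\<Oplus>k\<in>{1..<min i j}. series_mult R (h i k) (series_mult R (h k k) (h k j)) r))
        \<ominus> (if i < j then (\<Oplus>p\<in>{1..r}. h i i p \<otimes> h i j (r - p))
           else if j < i then (\<Oplus>p\<in>{..<r}. h i j p \<otimes> h j j (r - p)) else \<zero>)) else \<zero>)"

primrec gapprox where
  "gapprox N t 0 = (\<lambda>i j p. \<zero>)"
| "gapprox N t (Suc r) = (\<lambda>i j p. if p = r then gstep N t r (gapprox N t r) i j else gapprox N t r i j p)"

definition gsol where "gsol N t i j r = gapprox N t (Suc r) i j r"

lemma gapprox_eq: "p < r \<Longrightarrow> gapprox N t r i j p = gsol N t i j p"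
  by (induction r) (auto simp: gsol_def less_Suc_eq)

lemma gapprox_carrier:
  assumes t: "\<And>i j r. i \<in> {1..N} \<Longrightarrow> j \<in> {1..N} \<Longrightarrow> t i j r \<in> carrier R"
  shows "gapprox N t r i j p \<in> carrier R"
proof (induction r arbitrary: i j p)
  case (Suc r)
  have "is_series R (gapprox N t r i j)" for i j using Suc by (auto simp: is_series_def)
  then have "is_series R (series_mult R (gapprox N t r i k) (series_mult R (gapprox N t r k k) (gapprox N t r k j)))" for i j k
    by (intro series_mult_closed)
  then have "gstep N t r (gapprox N t r) i j \<in> carrier R"
    unfolding gstep_def using Suc t
    by (auto intro!: minus_closed add.finprod_closed simp: is_series_def)
  then show ?case using Suc by auto
qed auto

lemma gauss_exists:
  assumes t: "\<And>i j r. i \<in> {1..N} \<Longrightarrow> j \<in> {1..N} \<Longrightarrow> t i j r \<in> carrier R"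
    and t0: "\<And>i j. i \<in> {1..N} \<Longrightarrow> j \<in> {1..N} \<Longrightarrow> t i j 0 = (if i = j then \<one> else \<zero>)"
  shows "\<exists>d e f. gauss_decomposition R N t d e f"
proof -
  define g where "g = gsol N t"
  define h where "h = gapprox N t"
  have gc: "g i j r \<in> carrier R" for i j r
    unfolding g_def gsol_def by (rule gapprox_carrier[OF t])
  have hc: "h r i j p \<in> carrier R" for i j r p
    unfolding h_def by (rule gapprox_carrier[OF t])
  have gs: "is_series R (g i j)" "is_series R (h r i j)" for i j r using gc hc by (auto simp: is_series_def)
  have g0: "g i j 0 = (if i = j then \<one> else \<zero>)" if "i \<in> {1..N}" "j \<in> {1..N}" for i j
    using that by (simp add: g_def gsol_def gstep_def)
  have gh: "h r i j p = g i j p" if "p < r" for r i j p using gapprox_eq[OF that] by (simp add: g_def h_def)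
  have grec: "g i j r = gstep N t r (h r) i j" for i j r by (simp add: g_def h_def gsol_def)
  define K where "K g i j r = (\<Oplus>k\<in>{1..<min i j}. series_mult R (g i k) (series_mult R (g k k) (g k j)) r)"
    for g and i j r :: nat
  have tripc: "series_mult R (g i k) (series_mult R (g l m) (g p q)) r \<in> carrier R" for i k l m p q r
    using series_mult_closed[OF gs(1) series_mult_closed[OF gs(1) gs(1)]] by (auto simp: is_series_def)
  have Kc: "K g i j r \<in> carrier R" for i j r
    unfolding K_def using tripc by (auto intro!: add.finprod_closed)
  have Kh: "K (h r) i j r = K g i j r" if "i \<in> {1..N}" "j \<in> {1..N}" "r > 0" for i j r
    unfolding K_def
  proof (rule add.finprod_cong', simp)
    show "(\<lambda>k. series_mult R (g i k) (series_mult R (g k k) (g k j)) r) \<in> {1..<min i j} \<rightarrow> carrier R"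
      using tripc by auto
  next
    fix k assume "k \<in> {1..<min i j}"
    then show "series_mult R (h r i k) (series_mult R (h r k k) (h r k j)) r = series_mult R (g i k) (series_mult R (g k k) (g k j)) r"
      by (intro triple_cong gs) (use that in \<open>auto simp: g0 gh\<close>)
  qed
  have K0: "K g i j 0 = \<zero>" if "i \<in> {1..N}" "j \<in> {1..N}" for i j
    unfolding K_def series_mult_def using that
    by (intro add.finprod_one_eqI) (auto simp: g0 gc)
  have main: "t i j r = (if i < j then series_mult R (g i i) (g i j) r
      else if j < i then series_mult R (g i j) (g j j) r else g i i r) \<oplus> K g i j r"
    if ij: "i \<in> {1..N}" "j \<in> {1..N}" for i j r
  proof (cases "r = 0")
    case True then show ?thesis using ij by (auto simp: K0 t0 g0 series_mult_def)
  next
    case False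
    define c where "c = (if i < j then (\<Oplus>p\<in>{1..r}. g i i p \<otimes> g i j (r - p))
           else if j < i then (\<Oplus>p\<in>{..<r}. g i j p \<otimes> g j j (r - p)) else \<zero>)"
    have cc: "c \<in> carrier R" unfolding c_def using gc by (auto intro!: add.finprod_closed)
    have e1: "(\<Oplus>p\<in>{1..r}. h r i i p \<otimes> h r i j (r - p)) = (\<Oplus>p\<in>{1..r}. g i i p \<otimes> g i j (r - p))" if "i < j"
    proof (rule add.finprod_cong', simp)
      show "(\<lambda>p. g i i p \<otimes> g i j (r - p)) \<in> {1..r} \<rightarrow> carrier R" using gc by auto
      fix p assume p: "p \<in> {1..r}"
      show "h r i i p \<otimes> h r i j (r - p) = g i i p \<otimes> g i j (r - p)"
        using p gh[of "r-p" r] gh[of p r] ij that False gc hc by (cases "p = r") (auto simp: g0)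
    qed
    have e2: "(\<Oplus>p\<in>{..<r}. h r i j p \<otimes> h r j j (r - p)) = (\<Oplus>p\<in>{..<r}. g i j p \<otimes> g j j (r - p))" if "j < i"
    proof (rule add.finprod_cong', simp)
      show "(\<lambda>p. g i j p \<otimes> g j j (r - p)) \<in> {..<r} \<rightarrow> carrier R" using gc by auto
      fix p assume p: "p \<in> {..<r}"
      show "h r i j p \<otimes> h r j j (r - p) = g i j p \<otimes> g j j (r - p)"
        using p gh[of "r-p" r] gh[of p r] ij that False gc hc by (cases "p = 0") (auto simp: g0)
    qed
    have grec': "g i j r = (t i j r \<ominus> K g i j r) \<ominus> c"
      using e1 e2 Kh[OF ij] False ij unfolding grec[of i j r] gstep_def c_def K_def[symmetric] by auto
    have tt: "t i j r = (g i j r \<oplus> c) \<oplus> K g i j r"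
      unfolding grec' using t[OF ij, of r] cc Kc[of i j r] by (simp add: a_minus_def a_assoc) (metis a_assoc a_comm add.inv_closed l_neg r_zero)
    have s1: "series_mult R (g i i) (g i j) r = g i j r \<oplus> c" if "i < j"
    proof -
      have "{..r} = insert 0 {1..r}" by auto
      then show ?thesis using that ij gc by (simp add: series_mult_def c_def g0)
    qed
    have s2: "series_mult R (g i j) (g j j) r = g i j r \<oplus> c" if "j < i"
    proof -
      have "{..r} = insert r {..<r}" by auto
      then show ?thesis using that ij gc by (simp add: series_mult_def c_def g0)
    qed
    show ?thesis using tt s1 s2 gc by (auto simp: c_def not_less)
  qed
  have "t i i r = g i i r \<oplus> (\<Oplus>k\<in>{1..<i}. series_mult R (g i k) (series_mult R (g k k) (g k i)) r)"
    if "i \<in> {1..N}" for i r using main[OF that that, of r] by (simp add: K_def)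
  moreover have "t i j r = series_mult R (g i i) (g i j) r
      \<oplus> (\<Oplus>k\<in>{1..<i}. series_mult R (g i k) (series_mult R (g k k) (g k j)) r)"
      "t j i r = series_mult R (g j i) (g i i) r
      \<oplus> (\<Oplus>k\<in>{1..<i}. series_mult R (g j k) (series_mult R (g k k) (g k i)) r)"
    if "j \<in> {1..N}" "i \<in> {1..<j}" for i j r
    using main[of i j r] main[of j i r] that by (simp_all add: K_def min_def)
  ultimately have "gauss_decomposition R N t (\<lambda>i. g i i) g g"
    unfolding gauss_decomposition_def using gs(1) g0 by auto
  then show ?thesis by blast
qed
end


lemma free_carrier_ring:
  "p \<in> carrier (free_algebra X) \<Longrightarrow> q \<in> carrier (free_algebra X) \<Longrightarrow> p * q \<in> carrier (free_algebra X)"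
  "p \<in> carrier (free_algebra X) \<Longrightarrow> q \<in> carrier (free_algebra X) \<Longrightarrow> p + q \<in> carrier (free_algebra X)"
  "p \<in> carrier (free_algebra X) \<Longrightarrow> q \<in> carrier (free_algebra X) \<Longrightarrow> p - q \<in> carrier (free_algebra X)"
  "free_scalar c \<in> carrier (free_algebra X)"
proof -
  interpret ring "free_algebra X" by (rule free_algebra_ring)
  show "p \<in> carrier (free_algebra X) \<Longrightarrow> q \<in> carrier (free_algebra X) \<Longrightarrow> p * q \<in> carrier (free_algebra X)"
    using m_closed[of p q] by (simp add: free_algebra_def)
  show "p \<in> carrier (free_algebra X) \<Longrightarrow> q \<in> carrier (free_algebra X) \<Longrightarrow> p + q \<in> carrier (free_algebra X)"
    using a_closed[of p q] by (simp add: free_algebra_def)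
  show "p \<in> carrier (free_algebra X) \<Longrightarrow> q \<in> carrier (free_algebra X) \<Longrightarrow> p - q \<in> carrier (free_algebra X)"
    using Poly_Mapping.keys_diff[of p q] by (fastforce simp: free_algebra_def)
  show "free_scalar c \<in> carrier (free_algebra X)"
    by (simp add: free_algebra_def free_scalar_def zero_list_def)
qed

lemma free_t_carrier:
  "i \<in> {1..N} \<Longrightarrow> j \<in> {1..N} \<Longrightarrow> free_t i j r \<in> carrier (free_algebra (yangian_letters N))"
  using free_carrier_ring(4)[of 1] unfolding free_t_def free_scalar_def
  by (cases "r = 0") (auto simp: free_algebra_def yangian_letters_def zero_list_def)

lemma relator_carrier:
  assumes "i \<in> {1..N}" "j \<in> {1..N}" "k \<in> {1..N}" "l \<in> {1..N}"
  shows "yangian_relator s i j k l p q \<in> carrier (free_algebra (yangian_letters N))"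
  unfolding yangian_relator_def free_supercomm_def prod.case
  by (intro free_carrier_ring free_t_carrier assms)

lemma relators_carrier: "{yangian_relator s i j k l p q | i j k l p q.
        i \<in> {1..N} \<and> j \<in> {1..N} \<and> k \<in> {1..N} \<and> l \<in> {1..N}} \<subseteq> carrier (free_algebra (yangian_letters N))"
  using relator_carrier by blast

lemma ideal_yangian: "ideal (yangian_ideal N s) (free_algebra (yangian_letters N))"
  unfolding yangian_ideal_def
  by (rule ring.genideal_ideal[OF free_algebra_ring relators_carrier])

lemma ring_yangian: "ring (yangian N s)"
  unfolding yangian_def by (rule ideal.quotient_is_ring[OF ideal_yangian])

lemma yangian_t_carrier:
  assumes "i \<in> {1..N}" "j \<in> {1..N}"
  shows "yangian_t N s i j r \<in> carrier (yangian N s)"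
  unfolding yangian_def yangian_t_def yangian_class_def
  using ring_hom_closed[OF ideal.rcos_ring_hom[OF ideal_yangian] free_t_carrier[OF assms]] .

lemma yangian_t_0:
  "yangian_t N s i j 0 = (if i = j then \<one>\<^bsub>yangian N s\<^esub> else \<zero>\<^bsub>yangian N s\<^esub>)"
  by (auto simp: yangian_t_def free_t_def yangian_class_def yangian_def FactRing_def a_r_coset_def
    r_coset_def free_algebra_def)

lemma yangian_gauss_decomposition:
  "gauss_decomposition (yangian N s) N (yangian_t N s) (yangian_d N s) (yangian_e N s) (yangian_f N s)"
proof -
  have "\<exists>d e f. gauss_decomposition (yangian N s) N (yangian_t N s) d e f"
    by (rule ring.gauss_exists[OF ring_yangian]) (simp_all add: yangian_t_carrier yangian_t_0)
  then have "\<exists>x. case x of (d, e, f) \<Rightarrow> gauss_decomposition (yangian N s) N (yangian_t N s) d e f"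
    by (simp add: split_paired_Ex)
  from someI_ex[OF this] show ?thesis
    unfolding yangian_d_def yangian_e_def yangian_f_def yangian_gauss_def by (simp add: case_prod_unfold)
qed

abbreviation relabel_word :: "(nat \<Rightarrow> nat) \<Rightarrow> (nat \<times> nat \<times> nat) list \<Rightarrow> (nat \<times> nat \<times> nat) list" where
  "relabel_word \<sigma> w \<equiv> map (\<lambda>(a, b, r). (\<sigma> a, \<sigma> b, r)) w"

lemma relabel_superset:
  "finite A \<Longrightarrow> Poly_Mapping.keys p \<subseteq> A \<Longrightarrow> free_relabel \<sigma> p = (\<Sum>w\<in>A. Poly_Mapping.single (relabel_word \<sigma> w) (Poly_Mapping.lookup p w))"
  unfolding free_relabel_def by (intro sum.mono_neutral_left) (auto simp: in_keys_iff)

lemma relabel_add: "free_relabel \<sigma> (p + q) = free_relabel \<sigma> p + free_relabel \<sigma> q"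
  by (subst (1 2 3) relabel_superset[of "Poly_Mapping.keys p \<union> Poly_Mapping.keys q"])
     (use Poly_Mapping.keys_add[of p q] in \<open>auto simp: lookup_add single_add sum.distrib\<close>)

lemma relabel_single: "free_relabel \<sigma> (Poly_Mapping.single w c) = Poly_Mapping.single (relabel_word \<sigma> w) c"
  by (subst relabel_superset[of "{w}"]) auto

lemma relabel_0: "free_relabel \<sigma> 0 = 0" by (simp add: free_relabel_def)

lemma relabel_diff: "free_relabel \<sigma> (p - q) = free_relabel \<sigma> p - free_relabel \<sigma> q"
  using relabel_add[of \<sigma> "p - q" q] by (simp add: algebra_simps)

lemma poly_mapping_sum_monomials:
  fixes p :: "'k \<Rightarrow>\<^sub>0 complex"
  shows "(\<Sum>w\<in>Poly_Mapping.keys p. Poly_Mapping.single w (Poly_Mapping.lookup p w)) = p"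
proof (rule poly_mapping_eqI)
  fix k
  have "Poly_Mapping.lookup (\<Sum>w\<in>Poly_Mapping.keys p. Poly_Mapping.single w (Poly_Mapping.lookup p w)) k
     = (\<Sum>w\<in>Poly_Mapping.keys p. if w = k then Poly_Mapping.lookup p w else 0)"
    by (simp add: lookup_sum lookup_single when_def)
  then show "Poly_Mapping.lookup (\<Sum>w\<in>Poly_Mapping.keys p. Poly_Mapping.single w (Poly_Mapping.lookup p w)) k = Poly_Mapping.lookup p k"
    by (simp add: in_keys_iff)
qed

lemma relabel_sum: "free_relabel \<sigma> (sum f A) = (\<Sum>a\<in>A. free_relabel \<sigma> (f a))"
  by (induction A rule: infinite_finite_induct) (auto simp: relabel_0 relabel_add)

lemma relabel_mult: "free_relabel \<sigma> (p * q) = free_relabel \<sigma> p * free_relabel \<sigma> q"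
proof -
  have "p * q = (\<Sum>w\<in>Poly_Mapping.keys p. Poly_Mapping.single w (Poly_Mapping.lookup p w)) *
    (\<Sum>w\<in>Poly_Mapping.keys q. Poly_Mapping.single w (Poly_Mapping.lookup q w))"
    by (simp add: poly_mapping_sum_monomials)
  then have "free_relabel \<sigma> (p * q) = (\<Sum>v\<in>Poly_Mapping.keys p. \<Sum>w\<in>Poly_Mapping.keys q.
     Poly_Mapping.single (relabel_word \<sigma> v) (Poly_Mapping.lookup p v) * Poly_Mapping.single (relabel_word \<sigma> w) (Poly_Mapping.lookup q w))"
    by (simp add: sum_product relabel_sum relabel_single mult_single plus_list_def)
  then show ?thesis by (simp add: free_relabel_def sum_product)
qed

lemma relabel_invol: "(\<And>x. \<sigma> (\<sigma> x) = x) \<Longrightarrow> free_relabel \<sigma> (free_relabel \<sigma> p) = p"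
proof -
  assume s: "\<And>x. \<sigma> (\<sigma> x) = x"
  have "relabel_word \<sigma> (relabel_word \<sigma> w) = w" for w using s by (induction w) auto
  then have "free_relabel \<sigma> (free_relabel \<sigma> p) = (\<Sum>w\<in>Poly_Mapping.keys p. Poly_Mapping.single w (Poly_Mapping.lookup p w))"
    unfolding free_relabel_def[of \<sigma> p] by (simp add: relabel_sum relabel_single del: map_map)
  then show ?thesis by (simp add: poly_mapping_sum_monomials)
qed

lemma relabel_t:
  assumes "inj \<sigma>" shows "free_relabel \<sigma> (free_t a b r) = free_t (\<sigma> a) (\<sigma> b) r"
  using inj_eq[OF assms] by (auto simp: free_t_def relabel_single relabel_0 simp flip: single_one) (auto simp: zero_list_def relabel_single)

lemma relabel_scalar: "free_relabel \<sigma> (free_scalar c) = free_scalar c"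
  by (simp add: free_scalar_def relabel_single zero_list_def)

lemma relabel_relator:
  assumes "inj \<sigma>" "\<And>a. s (\<sigma> a) = s' a"
  shows "free_relabel \<sigma> (yangian_relator s' a b c d p q) = yangian_relator s (\<sigma> a) (\<sigma> b) (\<sigma> c) (\<sigma> d) p q"
  using assms(2)
  by (simp add: yangian_relator_def free_supercomm_def relabel_diff relabel_mult relabel_scalar relabel_t assms(1) parity_def)

lemma relabel_carrier:
  assumes "\<And>a. a \<in> {1..N} \<Longrightarrow> \<sigma> a \<in> {1..N}" "p \<in> carrier (free_algebra (yangian_letters N))"
  shows "free_relabel \<sigma> p \<in> carrier (free_algebra (yangian_letters N))"
proof -
  have "Poly_Mapping.keys (free_relabel \<sigma> p) \<subseteq> (\<Union>w\<in>Poly_Mapping.keys p. {relabel_word \<sigma> w})"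
    unfolding free_relabel_def
    by (rule order.trans[OF keys_sum]) (auto split: if_splits)
  moreover have "set (relabel_word \<sigma> w) \<subseteq> yangian_letters N" if "w \<in> Poly_Mapping.keys p" for w
  proof -
    have "set w \<subseteq> yangian_letters N" using that assms(2) by (simp add: free_algebra_def)
    moreover have "(\<lambda>(a, b, r). (\<sigma> a, \<sigma> b, r)) x \<in> yangian_letters N" if "x \<in> yangian_letters N" for x :: "nat \<times> nat \<times> nat"
      using that assms(1) by (cases x) (simp add: yangian_letters_def)
    ultimately show ?thesis by auto
  qed
  ultimately have "\<forall>w\<in>Poly_Mapping.keys (free_relabel \<sigma> p). set w \<subseteq> yangian_letters N" by blast
  then show ?thesis by (simp add: free_algebra_def)
qed

lemma relabel_ideal:
  assumes "inj \<sigma>" "\<And>a. s (\<sigma> a) = s' a" "\<And>a. a \<in> {1..N} \<Longrightarrow> \<sigma> a \<in> {1..N}"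
  shows "free_relabel \<sigma> ` yangian_ideal N s' \<subseteq> yangian_ideal N s"
proof -
  let ?F = "free_algebra (yangian_letters N)"
  have "free_relabel \<sigma> \<in> ring_hom ?F ?F"
    by (rule ring_hom_memI) (use relabel_carrier[OF assms(3)] in \<open>auto simp: free_algebra_def relabel_add relabel_mult relabel_scalar[of \<sigma> 1, unfolded free_scalar_def, simplified]\<close>)
  then interpret ring_hom_ring ?F ?F "free_relabel \<sigma>"
    by (intro ring_hom_ringI2 free_algebra_ring)
  have "ideal {r \<in> carrier ?F. free_relabel \<sigma> r \<in> yangian_ideal N s} ?F"
    by (rule ideal_vimage[OF ideal_yangian])
  moreover have "{yangian_relator s' i j k l p q | i j k l p q.
        i \<in> {1..N} \<and> j \<in> {1..N} \<and> k \<in> {1..N} \<and> l \<in> {1..N}} \<subseteq> {r \<in> carrier ?F. free_relabel \<sigma> r \<in> yangian_ideal N s}"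
  proof safe
    fix i j k l p q :: nat assume h: "i \<in> {1..N}" "j \<in> {1..N}" "k \<in> {1..N}" "l \<in> {1..N}"
    then show "yangian_relator s' i j k l p q \<in> carrier ?F" using relators_carrier[of s' N] by blast
    show "free_relabel \<sigma> (yangian_relator s' i j k l p q) \<in> yangian_ideal N s"
      using ring.genideal_self[OF free_algebra_ring relators_carrier] h assms(3)
      unfolding relabel_relator[where s = s and s' = s', OF assms(1) assms(2)] yangian_ideal_def by blast
  qed
  ultimately have "yangian_ideal N s' \<subseteq> {r \<in> carrier ?F. free_relabel \<sigma> r \<in> yangian_ideal N s}"
    unfolding yangian_ideal_def[of N s'] by (rule ring.genideal_minimal[OF free_algebra_ring])
  then show ?thesis by blast
qed

lemma switch_iso_class:
  assumes i: "i \<in> {1..<N}"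
  shows "switch_iso i (yangian_class N (switch i s) p) = yangian_class N s (free_relabel (transpose i (i+1)) p)"
proof -
  let ?\<sigma> = "transpose i (i+1)"
  have c: "a \<in> {1..N} \<Longrightarrow> ?\<sigma> a \<in> {1..N}" for a using i by (auto simp: transpose_def)
  have inj: "inj ?\<sigma>" by simp
  have 1: "free_relabel ?\<sigma> ` yangian_ideal N (switch i s) \<subseteq> yangian_ideal N s"
    by (rule relabel_ideal[OF inj _ c]) (simp_all add: switch_def)
  have 2: "free_relabel ?\<sigma> ` yangian_ideal N s \<subseteq> yangian_ideal N (switch i s)"
    by (rule relabel_ideal[OF inj _ c]) (simp_all add: switch_def)
  have "free_relabel ?\<sigma> (free_relabel ?\<sigma> x) = x" for x
    by (rule relabel_invol) simp
  then have "yangian_ideal N s \<subseteq> free_relabel ?\<sigma> ` yangian_ideal N (switch i s)"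
    using 2 by (metis image_subset_iff rev_image_eqI subsetI)
  then have e: "free_relabel ?\<sigma> ` yangian_ideal N (switch i s) = yangian_ideal N s" using 1 by auto
  have cl: "yangian_class N s' q = (\<lambda>x. x + q) ` yangian_ideal N s'" for s' q
    by (auto simp: yangian_class_def a_r_coset_def r_coset_def free_algebra_def)
  have "switch_iso i (yangian_class N (switch i s) p) = (\<lambda>x. x + free_relabel ?\<sigma> p) ` (free_relabel ?\<sigma> ` yangian_ideal N (switch i s))"
    by (simp add: switch_iso_def cl image_image relabel_add)
  then show ?thesis unfolding e cl .
qed

lemma switch_iso_t:
  assumes i: "i \<in> {1..<N}"
  shows "switch_iso i (yangian_t N (switch i s) a b r) = yangian_t N s (transpose i (i+1) a) (transpose i (i+1) b) r"
  unfolding yangian_t_def switch_iso_class[OF i] by (subst relabel_t) auto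

end

theory Submission
  imports Defs
begin

text \<open>
  Write \<open>A\<close>, \<open>B\<close>, \<open>C\<close>, \<open>D\<close> for the action of \<open>t\<^sub>i\<^sub>i\<close>, \<open>t\<^sub>i\<^sub>j\<close>, \<open>t\<^sub>j\<^sub>i\<close>, \<open>t\<^sub>j\<^sub>j\<close>, where \<open>j = i + 1\<close>. The vectors
  annihilated by all other \<open>t\<^sub>a\<^sub>b\<close> with \<open>a < b\<close> form a subspace that is stable under these four
  series, and on which \<open>f\<^sub>i = F = C A\<^sup>-\<^sup>1\<close>. The defining relations give a Clifford type algebra: the
  \<open>F\<^sub>k\<close> anticommute, and with \<open>E = A\<^sup>-\<^sup>1 B\<close> the anticommutator of \<open>E\<^sub>a\<close> and \<open>F\<^sub>k\<close> is \<open>s\<^sub>i G\<^sub>a\<^sub>+\<^sub>k\<^sub>-\<^sub>1\<close>, where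
  \<open>G = (D - F B) A\<^sup>-\<^sup>1\<close> commutes with \<open>A\<close> and \<open>F\<close> and acts on \<open>v\<close> by \<open>\<psi> / \<phi>\<close>.

  By irreducibility, the coefficients of \<open>F(u) v\<close> satisfy the linear recurrence with characteristic
  polynomial \<open>\<phi>\<close>, so a polynomial \<open>q\<close> modulo \<open>\<phi>\<close> acts by a combination \<open>F\<^sub>q\<close> of \<open>F\<^sub>1, \<dots>, F\<^sub>k\<close>. Along a flag
  of divisors of \<open>\<phi>\<close> obtained by removing one root \<open>r\<close> at a time, the product \<open>F\<^sub>1 \<dots> F\<^sub>k v\<close> becomes a
  product of vectors that are triangular for \<open>A(u)\<close>; each step contributes the factor
  \<open>(u - s\<^sub>i - r) / (u - r)\<close> to the eigenvalue of \<open>A(u)\<close>, and the step is undone by a combination of the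
  \<open>E\<^sub>a\<close> up to the factor \<open>\<psi>(r) \<noteq> 0\<close>, so the result does not vanish.
\<close>

section \<open>Power series over noncommutative rings\<close>

unbundle fps_syntax

text \<open>The sign s_i as an operation on any abelian group, so that the coefficient ring carries
  no scalars; \<open>b\<close> stands for \<open>s i = 1\<close>.\<close>

definition twist :: "bool \<Rightarrow> 'a::ab_group_add \<Rightarrow> 'a" where
  "twist b x = (if b then x else - x)"

lemma twist_simps [simp]:
  "twist b (x + y) = twist b x + twist b y" "twist b (x - y) = twist b x - twist b y"
  "twist b (- x) = - twist b x" "twist b (twist b x) = x" "twist b 0 = 0"
  by (simp_all add: twist_def)

lemma twist_mult [simp]:
  fixes x y :: "'a::ring"
  shows "twist b x * y = twist b (x * y)" "x * twist b y = twist b (x * y)"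
  by (simp_all add: twist_def)

lemma twist_sum: "twist b (sum f A) = (\<Sum>a\<in>A. twist b (f a))"
  by (simp add: twist_def sum_negf)

lemma twist_nth [simp]: "twist b f $ n = twist b (f $ n)"
  for f :: "'a::ab_group_add fps"
  by (simp add: twist_def)

lemma twist_eq_iff [simp]: "twist b x = 0 \<longleftrightarrow> x = 0"
  by (simp add: twist_def)

text \<open>Solves f g = 1 degree by degree for a series with \<open>f $ 0 = 1\<close>.\<close>

fun unit_inverse_coeff :: "'a::{ring,monoid_mult} fps \<Rightarrow> nat \<Rightarrow> 'a" where
  "unit_inverse_coeff f n = (if n = 0 then 1 else - (\<Sum>i<n. f $ (n - i) * unit_inverse_coeff f i))"

declare unit_inverse_coeff.simps [simp del]

definition unit_inverse :: "'a::{ring,monoid_mult} fps \<Rightarrow> 'a fps" where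
  "unit_inverse f = Abs_fps (unit_inverse_coeff f)"

lemma unit_inverse_nth_0 [simp]: "unit_inverse f $ 0 = 1"
  by (simp add: unit_inverse_def unit_inverse_coeff.simps)

lemma unit_inverse_nth:
  "n > 0 \<Longrightarrow> unit_inverse f $ n = - (\<Sum>i<n. f $ (n - i) * unit_inverse f $ i)"
  by (simp add: unit_inverse_def) (subst unit_inverse_coeff.simps, simp)

lemma mult_unit_inverse:
  assumes "f $ 0 = 1" shows "f * unit_inverse f = 1"
proof (rule fps_ext)
  fix n
  have "(f * unit_inverse f) $ n = (\<Sum>i\<le>n. f $ (n - i) * unit_inverse f $ i)"
    unfolding fps_mult_nth atLeast0AtMost
    by (rule sum.reindex_bij_witness[of _ "\<lambda>i. n - i" "\<lambda>i. n - i"]) auto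
  also have "\<dots> = 1 $ n"
    using assms by (cases "n = 0") (simp_all add: unit_inverse_nth flip: lessThan_Suc_atMost)
  finally show "(f * unit_inverse f) $ n = 1 $ n" .
qed

text \<open>The right inverse g also has constant coefficient 1, hence a right inverse h of its own,
  and f = f g h = h.\<close>

lemma unit_inverse_mult:
  assumes "f $ 0 = 1" shows "unit_inverse f * f = 1"
proof -
  define g h where "g = unit_inverse f" and "h = unit_inverse g"
  have "f * g = 1" "g * h = 1"
    using assms by (simp_all add: g_def h_def mult_unit_inverse)
  then have "f = h" by (metis mult.assoc fps_one_mult)
  then show ?thesis using \<open>g * h = 1\<close> by (simp add: g_def)
qed

lemma fps_X_left_commute: "f * (fps_X * g) = fps_X * (f * g)"
  for f :: "'a::{ring,monoid_mult} fps"
  by (metis fps_mult_fps_X_commute mult.assoc)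

section \<open>The relations of a pair of adjacent indices\<close>

text \<open>Multiplication by \<open>s\<^sub>i\<close> is \<open>twist b\<close>, and the power series variable is \<open>u\<^sup>-\<^sup>1\<close>.\<close>

locale odd_gl2 =
  fixes b :: bool and A B C D :: "'a::{ring,monoid_mult} fps"
  assumes A_0: "A $ 0 = 1" and B_0: "B $ 0 = 0" and C_0: "C $ 0 = 0" and D_0: "D $ 0 = 1"
    and AA: "A $ Suc p * A $ q - A $ q * A $ Suc p - (A $ p * A $ Suc q - A $ Suc q * A $ p)
      = twist b (A $ p * A $ q - A $ q * A $ p)"
    and AC: "A $ Suc p * C $ q - C $ q * A $ Suc p - (A $ p * C $ Suc q - C $ Suc q * A $ p)
      = twist b (C $ p * A $ q - C $ q * A $ p)"
    and AB: "A $ Suc p * B $ q - B $ q * A $ Suc p - (A $ p * B $ Suc q - B $ Suc q * A $ p)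
      = twist b (A $ p * B $ q - A $ q * B $ p)"
    and BA: "B $ Suc p * A $ q - A $ q * B $ Suc p - (B $ p * A $ Suc q - A $ Suc q * B $ p)
      = twist b (B $ p * A $ q - B $ q * A $ p)"
    and AD: "A $ Suc p * D $ q - D $ q * A $ Suc p - (A $ p * D $ Suc q - D $ Suc q * A $ p)
      = twist b (C $ p * B $ q - C $ q * B $ p)"
    and BC: "B $ Suc p * C $ q + C $ q * B $ Suc p - (B $ p * C $ Suc q + C $ Suc q * B $ p)
      = - twist b (D $ p * A $ q - D $ q * A $ p)"
    and CC: "C $ 1 * C $ 1 = 0"
    and torsion_free: "x + x = 0 \<Longrightarrow> x = (0::'a)"
begin

text \<open>Gauss factors of the block with rows (A, B) and (C, D): \<open>F\<close> and
  \<open>E\<close> are the off-diagonal ones, \<open>H\<close> = D - C A' B is the second diagonal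
  one, and \<open>G\<close> is the ratio of the two diagonal ones.\<close>

definition A' :: "'a fps" where "A' = unit_inverse A"
definition F :: "'a fps" where "F = C * A'"
definition E :: "'a fps" where "E = A' * B"
definition H :: "'a fps" where "H = D - F * B"
definition G :: "'a fps" where "G = H * A'"

lemma A'_simps: "A * A' = 1" "A' * A = 1" "A * (A' * x) = x" "A' * (A * x) = x" "1 * x = x" "x * 1 = x"
proof -
  show 1: "A * A' = 1" "A' * A = 1"
    using A_0 by (simp_all add: A'_def mult_unit_inverse unit_inverse_mult)
  then show "A * (A' * x) = x" "A' * (A * x) = x" "1 * x = x" "x * 1 = x"
    by (simp_all add: fps_one_mult flip: mult.assoc)
qed

lemma FA: "F * A = C" by (simp add: F_def mult.assoc A'_simps)
lemma FA_left: "F * (A * x) = C * x" by (simp add: FA flip: mult.assoc)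
lemma AE: "A * E = B" by (simp add: E_def A'_simps)
lemma GA: "G * A + F * B = D" by (simp add: G_def H_def mult.assoc A'_simps)

lemma F_0 [simp]: "F $ 0 = 0" using C_0 by (simp add: F_def)
lemma E_0 [simp]: "E $ 0 = 0" using B_0 by (simp add: E_def)

text \<open>\<open>AA\<close> expresses the commutator of A_(p+1) with A_q by commutators of
  A_p.\<close>

lemma A_commute: "A $ p * A $ q = A $ q * A $ p"
proof (induction p arbitrary: q)
  case 0 then show ?case by (simp add: A_0)
next
  case (Suc p)
  show ?case using AA[of p q] Suc[of q] Suc[of "Suc q"] by simp
qed

abbreviation const :: "'a \<Rightarrow> 'a fps" where "const \<equiv> fps_const"

lemma const_A_commute: "const (A $ p) * A = A * const (A $ p)"
  by (rule fps_ext) (simp add: A_commute)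

lemma const_A_commute': "A' * const (A $ p) = const (A $ p) * A'"
proof -
  have "A' * (const (A $ p) * A) * A' = A' * (A * const (A $ p)) * A'"
    by (simp add: const_A_commute)
  then show ?thesis by (simp add: mult.assoc A'_simps)
qed

text \<open>
  In the following lemmas one coefficient in \<open>u\<close> is fixed, and the series are series in the other
  variable \<open>v\<close>; \<open>fps_X\<close> is \<open>v\<^sup>-\<^sup>1\<close>.
\<close>

lemma AC_series:
  "fps_X * (const (A $ Suc p) * C - C * const (A $ Suc p)) - (const (A $ p) * C - C * const (A $ p))
    = twist b (fps_X * (const (C $ p) * A - C * const (A $ p)))"
proof (rule fps_ext)
  fix n show "(fps_X * (const (A $ Suc p) * C - C * const (A $ Suc p)) - (const (A $ p) * C - C * const (A $ p))) $ n
    = twist b (fps_X * (const (C $ p) * A - C * const (A $ p))) $ n"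
    using AC[of p "n - 1"] by (cases n) (simp_all add: C_0)
qed

lemma AB_series:
  "fps_X * (const (A $ Suc p) * B - B * const (A $ Suc p)) - (const (A $ p) * B - B * const (A $ p))
    = twist b (fps_X * (const (A $ p) * B - A * const (B $ p)))"
proof (rule fps_ext)
  fix n show "(fps_X * (const (A $ Suc p) * B - B * const (A $ Suc p)) - (const (A $ p) * B - B * const (A $ p))) $ n
    = twist b (fps_X * (const (A $ p) * B - A * const (B $ p))) $ n"
    using AB[of p "n - 1"] by (cases n) (simp_all add: B_0)
qed

lemma BA_series:
  "fps_X * (const (B $ Suc p) * A - A * const (B $ Suc p)) - (const (B $ p) * A - A * const (B $ p))
    = twist b (fps_X * (const (B $ p) * A - B * const (A $ p)))"
proof (rule fps_ext)
  fix n show "(fps_X * (const (B $ Suc p) * A - A * const (B $ Suc p)) - (const (B $ p) * A - A * const (B $ p))) $ n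
    = twist b (fps_X * (const (B $ p) * A - B * const (A $ p))) $ n"
    using BA[of p "n - 1"] by (cases n) (simp_all add: A_0)
qed

lemma AD_series:
  "fps_X * (const (A $ Suc p) * D - D * const (A $ Suc p)) - (const (A $ p) * D - D * const (A $ p))
    = twist b (fps_X * (const (C $ p) * B - C * const (B $ p)))"
proof (rule fps_ext)
  fix n show "(fps_X * (const (A $ Suc p) * D - D * const (A $ Suc p)) - (const (A $ p) * D - D * const (A $ p))) $ n
    = twist b (fps_X * (const (C $ p) * B - C * const (B $ p))) $ n"
    using AD[of p "n - 1"] D_0 by (cases n) simp_all
qed

lemma BC_series:
  "fps_X * (const (B $ Suc p) * C + C * const (B $ Suc p)) - (const (B $ p) * C + C * const (B $ p))
    = - twist b (fps_X * (const (D $ p) * A - D * const (A $ p)))"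
proof (rule fps_ext)
  fix n show "(fps_X * (const (B $ Suc p) * C + C * const (B $ Suc p)) - (const (B $ p) * C + C * const (B $ p))) $ n
    = (- twist b (fps_X * (const (D $ p) * A - D * const (A $ p)))) $ n"
    using BC[of p "n - 1"] by (cases n) (simp_all add: C_0)
qed

section \<open>Relations of the Gauss factors with A and B\<close>

lemma AF_series:
  "fps_X * (const (A $ Suc p) * F - F * const (A $ Suc p)) - (const (A $ p) * F - F * const (A $ p))
    = twist b (fps_X * (const (C $ p) - F * const (A $ p)))" (is "?L = ?R")
proof -
  have "?L = (fps_X * (const (A $ Suc p) * C - C * const (A $ Suc p)) - (const (A $ p) * C - C * const (A $ p))) * A'"
    by (simp add: F_def algebra_simps const_A_commute')
  also have "\<dots> = ?R"
    unfolding AC_series by (simp add: F_def algebra_simps A'_simps const_A_commute')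
  finally show ?thesis .
qed

text \<open>Super Leibniz rule for F = C A': the relation \<open>BC\<close> enters with A' on its
  right, and since [x, A'] = - A' [x, A] A', the relation \<open>BA\<close> enters between F and
  A'.\<close>

lemma BF_series:
  "fps_X * (const (B $ Suc p) * F + F * const (B $ Suc p)) - (const (B $ p) * F + F * const (B $ p))
    = twist b (fps_X * (G * const (A $ p) + F * const (B $ p) - const (D $ p)))" (is "?L = ?R")
proof -
  have "?L = (fps_X * (const (B $ Suc p) * C + C * const (B $ Suc p)) - (const (B $ p) * C + C * const (B $ p))) * A'
     + F * ((fps_X * (const (B $ Suc p) * A - A * const (B $ Suc p)) - (const (B $ p) * A - A * const (B $ p))) * A')"
    by (simp add: F_def algebra_simps A'_simps fps_X_left_commute)
  also have "\<dots> = ?R"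
    unfolding BC_series BA_series
    by (simp add: F_def G_def H_def algebra_simps A'_simps fps_X_left_commute const_A_commute')
  finally show ?thesis .
qed

text \<open>The commutator with A_p is a derivation, so its recursion on H = D - F B combines those
  on D, F and B; the right-hand sides cancel because F A = C. The homogeneous recursion then starts
  from A_0 = 1.\<close>

lemma A_H_commute: "const (A $ p) * H = H * const (A $ p)"
proof -
  have "fps_X * (const (A $ Suc p) * H - H * const (A $ Suc p)) - (const (A $ p) * H - H * const (A $ p)) = 0" (is "?L = 0") for p
  proof -
    have "?L = (fps_X * (const (A $ Suc p) * D - D * const (A $ Suc p)) - (const (A $ p) * D - D * const (A $ p)))
      - (fps_X * (const (A $ Suc p) * F - F * const (A $ Suc p)) - (const (A $ p) * F - F * const (A $ p))) * B
      - F * (fps_X * (const (A $ Suc p) * B - B * const (A $ Suc p)) - (const (A $ p) * B - B * const (A $ p)))"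
      by (simp add: H_def algebra_simps fps_X_left_commute)
    also have "\<dots> = 0"
      unfolding AD_series AF_series AB_series
      by (simp add: FA_left algebra_simps fps_X_left_commute)
    finally show ?thesis .
  qed
  note step = this
  have "const (A $ p) * H - H * const (A $ p) = 0"
  proof (induction p)
    case 0 then show ?case by (simp add: A_0 fps_one_mult)
  next
    case (Suc p)
    have "(const (A $ Suc p) * H - H * const (A $ Suc p)) $ n = 0" for n
      using arg_cong[OF step[of p], of "\<lambda>f. f $ Suc n"] Suc by simp
    then show ?case by (intro fps_ext) simp
  qed
  then show ?thesis by simp
qed

lemma A_G_commute: "const (A $ p) * G = G * const (A $ p)"
  by (simp add: G_def mult.assoc const_A_commute') (simp add: A_H_commute flip: mult.assoc)

text \<open>Iterates \<open>AF_series\<close>: each step lowers the index of A by one, raises that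
  of F by one and leaves one term with F on the left.\<close>

lemma AF:
  "A $ n * F $ Suc k = F $ Suc k * A $ n - (\<Sum>a<n. twist b (F $ Suc (k + a) * A $ (n - Suc a)))"
proof (induction n arbitrary: k)
  case 0 then show ?case by (simp add: A_0)
next
  case (Suc n)
  have "A $ Suc n * F $ Suc k - F $ Suc k * A $ Suc n
    = A $ n * F $ Suc (Suc k) - F $ Suc (Suc k) * A $ n - twist b (F $ Suc k * A $ n)"
    using arg_cong[OF AF_series[of n], of "\<lambda>f. f $ Suc (Suc k)"] by (simp add: algebra_simps)
  then show ?case
    using Suc[of "Suc k"] by (simp add: sum.lessThan_Suc_shift algebra_simps del: sum.lessThan_Suc)
qed

lemma BF_step:
  "B $ Suc n * F $ Suc k + F $ Suc k * B $ Suc n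
    = B $ n * F $ Suc (Suc k) + F $ Suc (Suc k) * B $ n + twist b (F $ Suc k * B $ n + G $ Suc k * A $ n)"
  using arg_cong[OF BF_series[of n], of "\<lambda>f. f $ Suc (Suc k)"] by (simp add: algebra_simps)

lemma BF:
  "B $ n * F $ Suc k = - (F $ Suc k * B $ n)
    + (\<Sum>a<n. twist b (F $ Suc (k + a) * B $ (n - Suc a) + G $ Suc (k + a) * A $ (n - Suc a)))"
proof (induction n arbitrary: k)
  case 0 then show ?case by (simp add: B_0)
next
  case (Suc n)
  show ?case
    using BF_step[of n k] Suc[of "Suc k"]
    by (simp add: sum.lessThan_Suc_shift algebra_simps del: sum.lessThan_Suc)
qed

lemma G_0 [simp]: "G $ 0 = 1"
  by (simp add: G_def H_def D_0 A'_def)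

text \<open>The lowest coefficient of \<open>BF_series\<close>, where F_0 = 0 and G_0 = 1. It later
  yields D from A and F_1 B on vectors killed by F.\<close>

lemma F1_B: "B $ n * F $ 1 + F $ 1 * B $ n = twist b (D $ n - A $ n)"
proof -
  have "(fps_X * (const (B $ Suc n) * F + F * const (B $ Suc n)) - (const (B $ n) * F + F * const (B $ n))) $ 1
    = twist b (fps_X * (G * const (A $ n) + F * const (B $ n) - const (D $ n))) $ 1"
    by (simp only: BF_series)
  then show ?thesis by (simp add: algebra_simps)
qed

section \<open>Conjugation by A and anticommutators\<close>

definition F_tail :: "nat \<Rightarrow> 'a fps" where "F_tail k = fps_shift (Suc k) F"
definition G_tail :: "nat \<Rightarrow> 'a fps" where "G_tail k = fps_shift (Suc k) G"
text \<open>Closed form of A F_(k+1) A', see \<open>A_const_F\<close>.\<close>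

definition F_tilde :: "nat \<Rightarrow> 'a fps" where
  "F_tilde k = const (F $ Suc k) - twist b (fps_X * F_tail k)"

lemma A_const_F: "A * const (F $ Suc k) = F_tilde k * A"
proof (rule fps_ext)
  fix n
  have "(F_tail k * A) $ m = (\<Sum>a<Suc m. F $ Suc (k + a) * A $ (m - a))" for m
    unfolding fps_mult_nth F_tail_def lessThan_Suc_atMost atLeast0AtMost by (simp add: add.commute)
  then show "(A * const (F $ Suc k)) $ n = (F_tilde k * A) $ n"
    by (cases n) (simp_all add: AF F_tilde_def left_diff_distrib mult.assoc twist_sum)
qed

lemma A'_F_tilde: "A' * F_tilde k = const (F $ Suc k) * A'"
proof -
  have "A' * (F_tilde k * A) * A' = A' * (A * const (F $ Suc k)) * A'"
    by (simp add: A_const_F)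
  then show ?thesis by (simp add: mult.assoc A'_simps)
qed

lemma F_1_square: "F $ 1 * F $ 1 = 0"
proof -
  have "F $ 1 = C $ 1"
    using F_0 by (simp add: F_def fps_mult_nth C_0 A'_def)
  then show ?thesis using CC by simp
qed

text \<open>
  Conjugation by \<open>A(u)\<close> carries \<open>F\<^sub>k\<close> to \<open>F_tilde\<close>, so every anticommutator that vanishes gives a
  relation between those of higher degree; \<open>F\<^sub>1\<^sup>2 = 0\<close> starts the induction.
\<close>

lemma F_anticommute: "F $ j * F $ k + F $ k * F $ j = 0"
proof -
  define T where "T j k = F $ j * F $ k + F $ k * F $ j" for j k
  have T_sym: "T j k = T k j" for j k by (simp add: T_def add.commute)
  have "\<forall>j k. j + k \<le> n \<longrightarrow> T j k = 0" for n
  proof (induction n)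
    case 0 then show ?case by (simp add: T_def)
  next
    case (Suc n)
    \<comment> \<open>Coefficient m of the anticommutator of \<open>F_tail k\<close> and
      \<open>F_tail l\<close>: a sum of anticommutators of total index k + l + m + 2, known by
      induction.\<close>
    have square: "(\<Sum>a\<le>m. F $ Suc (k + a) * F $ Suc (l + (m - a)) + F $ Suc (l + a) * F $ Suc (k + (m - a))) = 0"
      if "k + l + m + 2 \<le> n" for k l m
    proof -
      have "(\<Sum>a\<le>m. F $ Suc (l + a) * F $ Suc (k + (m - a))) = (\<Sum>a\<le>m. F $ Suc (l + (m - a)) * F $ Suc (k + a))"
        by (rule sum.reindex_bij_witness[of _ "\<lambda>a. m - a" "\<lambda>a. m - a"]) auto
      then have "(\<Sum>a\<le>m. F $ Suc (k + a) * F $ Suc (l + (m - a)) + F $ Suc (l + a) * F $ Suc (k + (m - a)))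
        = (\<Sum>a\<le>m. T (Suc (k + a)) (Suc (l + (m - a))))"
        by (simp add: T_def sum.distrib)
      then show ?thesis using Suc that by simp
    qed
    \<comment> \<open>Conjugating T (k+1) (l+1) = 0 by A gives zero; in degree m + 1 the terms
      linear in the tails are the two stated ones, and the quadratic terms vanish by
      \<open>square\<close>.\<close>
    have step: "T (Suc k) (Suc (l + m)) + T (Suc l) (Suc (k + m)) = 0"
      if 0: "T (Suc k) (Suc l) = 0" and le: "k + l + m + 1 \<le> n" for k l m
    proof -
      have "F_tilde k * F_tilde l + F_tilde l * F_tilde k = A * (const (T (Suc k) (Suc l))) * A'"
      proof -
        have "A * const (F $ Suc k) * const (F $ Suc l) * A' = F_tilde k * F_tilde l" for k l
          by (simp only: A_const_F mult.assoc) (simp add: A_const_F A'_simps flip: mult.assoc)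
        from this[of k l] this[of l k] show ?thesis
          by (simp add: T_def algebra_simps flip: fps_const_add fps_const_mult)
      qed
      then have "(F_tilde k * F_tilde l + F_tilde l * F_tilde k) $ Suc m = 0" using 0 by simp
      moreover have "(fps_X * (F_tail k * F_tail l) + fps_X * (F_tail l * F_tail k)) $ m = 0"
      proof (cases m)
        case 0 then show ?thesis by simp
      next
        case (Suc m')
        have "(F_tail k * F_tail l + F_tail l * F_tail k) $ m' = 0"
          using square[of k l m'] le Suc
          by (simp add: fps_mult_nth F_tail_def atLeast0AtMost add.commute sum.distrib)
        then show ?thesis using Suc by simp
      qed
      ultimately have "twist b (T (Suc k) (Suc (l + m)) + T (Suc l) (Suc (k + m))) = 0"
        by (simp add: F_tilde_def algebra_simps T_def fps_X_left_commute[of "F_tail k" for k])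
          (simp add: F_tail_def algebra_simps)
      then show ?thesis by (simp only: twist_eq_iff)
    qed
    \<comment> \<open>For k = l = 0 the two terms of \<open>step\<close> coincide.\<close>
    have T1: "T 1 (Suc k) = 0" if "Suc (Suc k) \<le> Suc n" for k
    proof (cases k)
      case 0 then show ?thesis using F_1_square by (simp add: T_def)
    next
      case (Suc m)
      then show ?thesis
        using step[of 0 0 "m + 1"] that F_1_square torsion_free[of "T (Suc 0) (Suc (Suc m))"] by (simp add: T_def)
    qed
    show ?case
    proof (intro allI impI)
      fix j k assume jk: "j + k \<le> Suc n"
      show "T j k = 0"
      proof (cases "j = 0 \<or> k = 0")
        case True then show ?thesis by (auto simp: T_def)
      next
        case False
        then obtain p q where [simp]: "j = Suc p" "k = Suc q" by (metis not0_implies_Suc)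
        show ?thesis
        proof (cases p)
          case 0 then show ?thesis using T1 jk by simp
        next
          case (Suc p')
          \<comment> \<open>With k = 0, \<open>step\<close> reduces T (q+1) (p+1) to T 1
            (q+p+1).\<close>
          then show ?thesis
            using step[of 0 q p] T1[of q] T1[of "q + p"] jk T_sym by (simp add: add.commute)
        qed
      qed
    qed
  qed
  then show ?thesis by (auto simp: T_def)
qed

text \<open>As a series, \<open>BF\<close> reads B F_(k+1) = - F_tilde B + s X G_tail A.
  Multiplication by A' on the left turns F_tilde B into F_(k+1) E and cancels A, which commutes with
  G.\<close>

lemma EF: "E $ Suc a * F $ Suc k + F $ Suc k * E $ Suc a = twist b (G $ Suc (a + k))"
proof -
  have GA: "G_tail k * A = A * G_tail k"
  proof -
    have "A $ p * G $ q = G $ q * A $ p" for p q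
      using arg_cong[OF A_G_commute[of p], of "\<lambda>f. f $ q"] by simp
    then have "(G_tail k * A) $ n = (A * G_tail k) $ n" for n
      unfolding fps_mult_nth G_tail_def
      by (intro sum.reindex_bij_witness[of _ "\<lambda>i. n - i" "\<lambda>i. n - i"]) auto
    then show ?thesis by (rule fps_ext)
  qed
  have "B * const (F $ Suc k) = - (F_tilde k * B) + twist b (fps_X * (G_tail k * A))"
  proof (rule fps_ext)
    fix n
    have "(F_tail k * B) $ m = (\<Sum>a<Suc m. F $ Suc (k + a) * B $ (m - a))"
      "(G_tail k * A) $ m = (\<Sum>a<Suc m. G $ Suc (k + a) * A $ (m - a))" for m
      unfolding fps_mult_nth F_tail_def G_tail_def lessThan_Suc_atMost atLeast0AtMost by (simp_all add: add.commute)
    then show "(B * const (F $ Suc k)) $ n = (- (F_tilde k * B) + twist b (fps_X * (G_tail k * A))) $ n"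
      by (cases n) (simp_all add: BF F_tilde_def left_diff_distrib mult.assoc twist_sum sum.distrib B_0)
  qed
  then have "E * const (F $ Suc k) = - (A' * F_tilde k * B) + twist b (fps_X * (A' * (A * G_tail k)))"
    by (simp add: E_def distrib_left right_diff_distrib mult.assoc GA fps_X_left_commute)
  then have "E * const (F $ Suc k) = - (const (F $ Suc k) * E) + twist b (fps_X * G_tail k)"
    by (simp add: A'_F_tilde A'_simps mult.assoc E_def)
  from arg_cong[OF this, of "\<lambda>f. f $ Suc a"] show ?thesis
    by (simp add: G_tail_def algebra_simps)
qed

text \<open>
  Since the \<open>F\<^sub>k\<close> anticommute, the super Jacobi identity for \<open>E\<^sub>a\<close>, \<open>F\<^sub>j\<close>, \<open>F\<^sub>k\<close> makes the commutator of
  \<open>G\<^sub>a\<^sub>+\<^sub>j\<close> with \<open>F\<^sub>k\<close> antisymmetric in \<open>j\<close> and \<open>k\<close>, which leaves no room for nonzero values.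
\<close>

lemma GF_commute: "G $ n * F $ k = F $ k * G $ n"
proof (cases "n = 0 \<or> k = 0")
  case True then show ?thesis by auto
next
  case False
  define X where "X n k = G $ Suc n * F $ Suc k - F $ Suc k * G $ Suc n" for n k
  have sum: "X (a + j) k + X (a + k) j = 0" for a j k
  proof -
    have X: "twist b (X (a + j) k) = (E $ Suc a * F $ Suc j + F $ Suc j * E $ Suc a) * F $ Suc k
      - F $ Suc k * (E $ Suc a * F $ Suc j + F $ Suc j * E $ Suc a)" for j k
      by (simp add: X_def EF)
    have "twist b (X (a + j) k + X (a + k) j)
      = E $ Suc a * (F $ Suc j * F $ Suc k + F $ Suc k * F $ Suc j)
      - (F $ Suc j * F $ Suc k + F $ Suc k * F $ Suc j) * E $ Suc a"
      by (simp only: twist_simps X) (simp add: algebra_simps)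
    then have "twist b (X (a + j) k + X (a + k) j) = 0"
      by (simp only: F_anticommute mult_zero_left mult_zero_right diff_self)
    then show ?thesis by (simp only: twist_eq_iff)
  qed
  \<comment> \<open>The case j = k of \<open>sum\<close> settles k \<le> n; its case a = 0 then
    relates X n k with k > n to X k n.\<close>
  have ge: "X n k = 0" if "k \<le> n" for n k
    by (rule torsion_free) (use sum[of "n - k" k k] that in simp)
  have "X n k = 0" for n k
    using ge[of k n] ge[of n k] sum[of 0 n k] by (cases "k \<le> n") auto
  with False show ?thesis by (cases n; cases k) (auto simp: X_def)
qed

end

section \<open>Endomorphisms of an abelian group\<close>

text \<open>
  Products are composition. The zero group is allowed, which is why this is an instance of
  \<open>{ring, monoid_mult}\<close> and not of \<open>ring_1\<close>, where \<open>0 \<noteq> 1\<close>.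
\<close>

typedef (overloaded) 'v endo = "{f :: 'v::ab_group_add \<Rightarrow> 'v. \<forall>x y. f (x + y) = f x + f y}"
  morphisms app Endo
  by (rule exI[of _ id]) simp

setup_lifting type_definition_endo

instantiation endo :: (ab_group_add) "{ring, monoid_mult}"
begin
lift_definition zero_endo :: "'a endo" is "\<lambda>_. 0" by simp
lift_definition one_endo :: "'a endo" is "\<lambda>x. x" by simp
lift_definition plus_endo :: "'a endo \<Rightarrow> 'a endo \<Rightarrow> 'a endo" is "\<lambda>f g x. f x + g x"
  by (simp add: algebra_simps)
lift_definition minus_endo :: "'a endo \<Rightarrow> 'a endo \<Rightarrow> 'a endo" is "\<lambda>f g x. f x - g x"
  by (simp add: algebra_simps)
lift_definition uminus_endo :: "'a endo \<Rightarrow> 'a endo" is "\<lambda>f x. - f x"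
  by simp
lift_definition times_endo :: "'a endo \<Rightarrow> 'a endo \<Rightarrow> 'a endo" is "\<lambda>f g x. f (g x)"
  by simp
instance
  by standard (transfer; auto simp: fun_eq_iff algebra_simps)+
end

lemma app_simps [simp]:
  "app 0 x = 0" "app 1 x = x" "app (f + g) x = app f x + app g x"
  "app (f - g) x = app f x - app g x" "app (- f) x = - app f x" "app (f * g) x = app f (app g x)"
  "app f (x + y) = app f x + app f y" "app f 0 = 0"
  "app f (x - y) = app f x - app f y" "app f (- x) = - app f x"
proof -
  show add: "app f (x + y) = app f x + app f y" for f :: "'a endo" and x y
    by transfer simp
  show zero: "app f 0 = 0" for f :: "'a endo"
    using add[of f 0 0] by simp
  show minus: "app f (- x) = - app f x" for f :: "'a endo" and x
    using add[of f x "- x"] zero[of f] by (simp add: add_eq_0_iff2)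
  show "app f (x - y) = app f x - app f y"
    using add[of f x "- y"] minus[of f y] by simp
qed (transfer, simp)+

lemma app_sum: "app (sum f I) x = (\<Sum>i\<in>I. app (f i) x)" "app g (sum h I) = (\<Sum>i\<in>I. app g (h i))"
  by (induction I rule: infinite_finite_induct) simp_all

lemma app_twist: "app (twist b f) x = twist b (app f x)"
  by (simp add: twist_def)

lemma endo_eqI: "(\<And>x. app f x = app g x) \<Longrightarrow> f = g"
  by transfer auto

text \<open>A property that defines a subring passes to the coefficients of products and of inverses
  of series. This is used for linearity, stability of \<open>K c\<close>, parity and commutation
  with \<open>height\<close>.\<close>

definition subring_set :: "'a::{ring,monoid_mult} set \<Rightarrow> bool" where
  "subring_set S \<longleftrightarrow> 0 \<in> S \<and> 1 \<in> S \<and> (\<forall>x\<in>S. - x \<in> S) \<and> (\<forall>x\<in>S. \<forall>y\<in>S. x + y \<in> S \<and> x * y \<in> S)"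

lemma subring_set_sum:
  "subring_set S \<Longrightarrow> (\<And>i. i \<in> I \<Longrightarrow> f i \<in> S) \<Longrightarrow> sum f I \<in> S"
  by (induction I rule: infinite_finite_induct) (auto simp: subring_set_def)

lemma subring_set_mult:
  "subring_set S \<Longrightarrow> (\<And>n. f $ n \<in> S) \<Longrightarrow> (\<And>n. g $ n \<in> S) \<Longrightarrow> (f * g) $ n \<in> S"
  unfolding fps_mult_nth by (rule subring_set_sum) (auto simp: subring_set_def)

lemma subring_set_diff: "subring_set S \<Longrightarrow> x \<in> S \<Longrightarrow> y \<in> S \<Longrightarrow> x - y \<in> S"
  unfolding subring_set_def by (metis add_uminus_conv_diff)

lemma subring_set_unit_inverse:
  assumes "subring_set S" "\<And>n. f $ n \<in> S"
  shows "unit_inverse f $ n \<in> S"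
proof (induction n rule: less_induct)
  case (less n)
  show ?case
  proof (cases "n = 0")
    case True then show ?thesis using assms by (simp add: subring_set_def)
  next
    case False
    have "(\<Sum>i<n. f $ (n - i) * unit_inverse f $ i) \<in> S"
      by (rule subring_set_sum[OF assms(1)]) (use assms less in \<open>auto simp: subring_set_def\<close>)
    with False show ?thesis using assms(1) by (simp add: unit_inverse_nth subring_set_def)
  qed
qed

section \<open>Evaluation of polynomials at Laurent series\<close>

lemma fps_to_fls_sum: "fps_to_fls (sum f I) = (\<Sum>i\<in>I. fps_to_fls (f i))"
  by (induction I rule: infinite_finite_induct) simp_all

lemma fls_const_sum: "fls_const (sum f I) = (\<Sum>i\<in>I. fls_const (f i))"
  by (induction I rule: infinite_finite_induct) (simp_all flip: fls_plus_const)

lemma fls_X_inv_mult_X: "fls_X_inv * (fls_X * f) = f" for f :: "'a::ring_1 fls"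
  by (simp add: fls_X_inv_times_conv_shift fls_X_times_conv_shift)

text \<open>The point z is free so that polynomials can be evaluated both at u and at the shifted
  point u - s_i.\<close>

definition fls_eval :: "complex poly \<Rightarrow> complex fls \<Rightarrow> complex fls" where
  "fls_eval p z = poly (map_poly fls_const p) z"

lemma poly_at_infinity_eq: "poly_at_infinity p = fls_eval p fls_X_inv"
  by (simp add: poly_at_infinity_def fls_eval_def)

lemma fls_eval_0 [simp]: "fls_eval 0 z = 0" by (simp add: fls_eval_def)

lemma fls_eval_pCons [simp]: "fls_eval (pCons c p) z = fls_const c + z * fls_eval p z"
  by (simp add: fls_eval_def map_poly_pCons)

lemma fls_eval_1 [simp]: "fls_eval 1 z = 1"
  by (simp add: fls_eval_def)

lemma fls_eval_add [simp]: "fls_eval (p + q) z = fls_eval p z + fls_eval q z"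
  by (induction p q rule: poly_induct2) (simp_all add: algebra_simps flip: fls_plus_const)

lemma fls_eval_smult [simp]: "fls_eval (smult c p) z = fls_const c * fls_eval p z"
  by (induction p) (simp_all add: algebra_simps flip: fls_const_mult_const)

lemma fls_eval_mult [simp]: "fls_eval (p * q) z = fls_eval p z * fls_eval q z"
  by (induction p) (simp_all add: algebra_simps)

lemma fls_eval_pcompose: "fls_eval (pcompose p q) z = fls_eval p (fls_eval q z)"
  by (induction p) (simp_all add: pcompose_pCons)

lemma fls_eval_altdef: "fls_eval p z = (\<Sum>j\<le>degree p. fls_const (coeff p j) * z ^ j)"
proof -
  have "degree (map_poly fls_const p) = degree p" by (rule degree_map_poly) simp
  then show ?thesis by (simp add: fls_eval_def poly_altdef coeff_map_poly)
qed

lemma fls_eval_X_inv_mult_nth: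
  "(fls_eval p fls_X_inv * f) $$ n = (\<Sum>j\<le>degree p. coeff p j * f $$ (n + int j))"
proof -
  have "(fls_const c * fls_X_inv ^ j * f) $$ n = c * f $$ (n + int j)" for c j
    by (simp only: mult.assoc fls_X_inv_power_times_conv_shift(1)) simp
  then show ?thesis
    by (simp add: fls_eval_altdef sum_distrib_right fls_nth_sum)
qed

lemma fls_eval_X_inv_nth: "fls_eval p fls_X_inv $$ n = (if n \<le> 0 then coeff p (nat (- n)) else 0)"
proof -
  have "fls_eval p fls_X_inv $$ n = (\<Sum>j\<le>degree p. if j = nat (- n) \<and> n \<le> 0 then coeff p j else 0)"
    using fls_eval_X_inv_mult_nth[of p 1 n] by (simp, intro sum.cong) (auto simp: fls_one_nth)
  then show ?thesis by (auto simp: coeff_eq_0)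
qed

lemma fls_eval_X_inv_eq_0_iff: "fls_eval p fls_X_inv = 0 \<longleftrightarrow> p = 0"
proof
  assume "fls_eval p fls_X_inv = 0"
  then have "coeff p n = 0" for n
    using fls_eval_X_inv_nth[of p "- int n"] by simp
  then show "p = 0" by (simp add: poly_eq_iff)
qed simp

text \<open>The coefficient of u^-1 in q g; by \<open>EF_poly\<close> this residue governs the
  anticommutators of E and F.\<close>

definition pairing :: "complex fls \<Rightarrow> complex poly \<Rightarrow> complex" where
  "pairing g q = (fls_eval q fls_X_inv * g) $$ 1"

text \<open>With g = \<psi> / \<phi>, the product \<phi> q g = q \<psi> is a polynomial and has no
  term u^-1, whereas p g = \<psi> / (u - r) has residue \<psi>(r).\<close>

lemma pairing_root:
  assumes g: "fps_to_fls g * fls_eval \<phi> fls_X_inv = fls_eval \<psi> fls_X_inv"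
  shows "pairing (fps_to_fls g) (\<phi> * q) = 0"
    and "\<phi> = [:- r, 1:] * p \<Longrightarrow> pairing (fps_to_fls g) p = poly \<psi> r"
proof -
  have "fls_eval (\<phi> * q) fls_X_inv * fps_to_fls g = fls_eval (q * \<psi>) fls_X_inv"
    using g by (simp add: algebra_simps)
  then show "pairing (fps_to_fls g) (\<phi> * q) = 0"
    by (simp only: pairing_def fls_eval_X_inv_nth) simp
next
  assume p: "\<phi> = [:- r, 1:] * p"
  define f where "f = fls_eval p fls_X_inv * fps_to_fls g"
  obtain q where "\<psi> = [:- r, 1:] * q + [:poly \<psi> r:]"
    by (metis synthetic_div_correct')
  then have "fls_eval \<psi> fls_X_inv = fls_eval ([:- r, 1:] * q + [:poly \<psi> r:]) fls_X_inv" by simp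
  moreover have "fls_eval [:- r, 1:] fls_X_inv = fls_X_inv - fls_const r" by simp
  ultimately have "(fls_X_inv - fls_const r) * f = (fls_X_inv - fls_const r) * fls_eval q fls_X_inv + fls_const (poly \<psi> r)"
    using g unfolding p f_def by (simp only: fls_eval_mult fls_eval_add fls_eval_pCons fls_eval_0 mult_zero_right add_0_right mult_ac)
  then have eq: "(fls_X_inv - fls_const r) * (f - fls_eval q fls_X_inv) = fls_const (poly \<psi> r)"
    by (simp add: algebra_simps)
  define h where "h = f - fls_eval q fls_X_inv"
  have h_eq: "h $$ (n + 1) = r * h $$ n + (if n = 0 then poly \<psi> r else 0)" for n
    using arg_cong[OF eq, of "\<lambda>f. f $$ n"]
    by (simp add: h_def left_diff_distrib fls_X_inv_times_conv_shift algebra_simps)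
  \<comment> \<open>The recurrence, used one index below the lowest term of h, would make that term
    zero.\<close>
  have "h $$ n = 0" if "n \<le> 0" for n
  proof (cases "h = 0")
    case False
    show ?thesis
    proof (rule ccontr)
      assume "h $$ n \<noteq> 0"
      then have le: "fls_subdegree h \<le> n" by (rule fls_subdegree_leI)
      have "h $$ (fls_subdegree h - 1 + 1) = 0"
        unfolding h_eq using le that by (simp)
      then show False using False by simp
    qed
  qed simp
  then have "h $$ 1 = poly \<psi> r" using h_eq[of 0] by simp
  then show "pairing (fps_to_fls g) p = poly \<psi> r"
    by (simp add: pairing_def h_def f_def fls_eval_X_inv_nth)
qed

section \<open>The vectors generated by an odd root vector\<close>

locale endo_module = vector_space scale for scale :: "complex \<Rightarrow> 'v::ab_group_add \<Rightarrow> 'v"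
begin

definition linear_endos :: "'v endo set" where
  "linear_endos = {f. \<forall>c x. app f (scale c x) = scale c (app f x)}"

lemma subring_linear_endos: "subring_set linear_endos"
  by (simp add: subring_set_def linear_endos_def scale_right_distrib)

text \<open>The coefficient of u^-1 in q(u) X(u): u^j acts by X_(j+1), and multiplication of q by u
  shifts the series.\<close>

definition poly_act :: "'v endo fps \<Rightarrow> complex poly \<Rightarrow> 'v \<Rightarrow> 'v" where
  "poly_act X q x = (\<Sum>j\<le>degree q. scale (coeff q j) (app (X $ Suc j) x))"

lemma poly_act_upto:
  "degree q \<le> N \<Longrightarrow> poly_act X q x = (\<Sum>j\<le>N. scale (coeff q j) (app (X $ Suc j) x))"
  unfolding poly_act_def by (rule sum.mono_neutral_left) (auto simp: coeff_eq_0)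

lemma poly_act_add: "poly_act X (p + q) x = poly_act X p x + poly_act X q x"
proof -
  define N where "N = max (degree p) (degree q)"
  have "degree (p + q) \<le> N" "degree p \<le> N" "degree q \<le> N"
    by (auto simp: N_def degree_add_le_max)
  then show ?thesis by (simp add: poly_act_upto[of _ N] scale_left_distrib sum.distrib)
qed

lemma poly_act_smult: "poly_act X (smult c p) x = scale c (poly_act X p x)"
  using poly_act_upto[of "smult c p" "degree p"] degree_smult_le[of c p]
  by (simp add: poly_act_def scale_sum_right)

lemma poly_act_zero_right [simp]: "poly_act X q 0 = 0"
  by (simp add: poly_act_def)

lemma poly_act_monom: "poly_act X (monom c j) x = scale c (app (X $ Suc j) x)"
proof -
  have "poly_act X (monom c j) x = (\<Sum>i\<le>j. if i = j then scale c (app (X $ Suc j) x) else 0)"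
    unfolding poly_act_upto[OF degree_monom_le] by (rule sum.cong) auto
  then show ?thesis by simp
qed

lemma poly_act_pCons_0:
  "poly_act X (pCons 0 q) x = (\<Sum>j\<le>degree q. scale (coeff q j) (app (X $ Suc (Suc j)) x))"
  using poly_act_upto[of "pCons 0 q" "Suc (degree q)" X x] degree_pCons_le[of 0 q]
  by (simp add: sum.atMost_Suc_shift del: sum.atMost_Suc)

end

locale odd_gl2_module = odd_gl2 b A B C D + endo_module scale
  for b and A B C D :: "'v::ab_group_add endo fps" and scale :: "complex \<Rightarrow> 'v \<Rightarrow> 'v" +
  assumes linear: "A $ n \<in> linear_endos" "B $ n \<in> linear_endos" "C $ n \<in> linear_endos" "D $ n \<in> linear_endos"
begin

abbreviation \<sigma> :: complex where "\<sigma> \<equiv> (if b then 1 else -1)"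

lemma twist_scale: "twist b (scale c x) = scale (\<sigma> * c) x"
  by (simp add: twist_def)

lemma twist_scale_1: "twist b (x::'v) = scale \<sigma> x"
  by (simp add: twist_def)

lemma linear_A': "A' $ n \<in> linear_endos"
  unfolding A'_def by (rule subring_set_unit_inverse[OF subring_linear_endos linear(1)])

lemma linear_F: "F $ n \<in> linear_endos"
  unfolding F_def by (rule subring_set_mult[OF subring_linear_endos linear(3) linear_A'])

lemma linear_E: "E $ n \<in> linear_endos"
  unfolding E_def by (rule subring_set_mult[OF subring_linear_endos linear_A' linear(2)])

lemma linear_G: "G $ n \<in> linear_endos"
proof -
  have "(F * B) $ n \<in> linear_endos" for n
    by (rule subring_set_mult[OF subring_linear_endos linear_F linear(2)])
  then have "H $ n \<in> linear_endos" for n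
    using linear(4)[of n] by (simp add: H_def subring_set_diff subring_linear_endos)
  then show ?thesis
    unfolding G_def using subring_set_mult[OF subring_linear_endos _ linear_A'] by blast
qed

lemma scale_simps:
  "app (G $ n) (scale c x) = scale c (app (G $ n) x)"
  "app (A $ n) (scale c x) = scale c (app (A $ n) x)"
  "app (B $ n) (scale c x) = scale c (app (B $ n) x)"
  "app (D $ n) (scale c x) = scale c (app (D $ n) x)"
  "app (F $ n) (scale c x) = scale c (app (F $ n) x)"
  "app (E $ n) (scale c x) = scale c (app (E $ n) x)"
  using linear(1,2,4) linear_E linear_F linear_G by (auto simp: linear_endos_def)

lemma app_F_anticommute: "app (F $ j) (app (F $ k) x) = - app (F $ k) (app (F $ j) x)"
  using arg_cong[OF F_anticommute[of j k], of "\<lambda>f. app f x"] by (simp add: eq_neg_iff_add_eq_0)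

lemma app_F_square: "app (F $ j) (app (F $ j) x) = 0"
  using torsion_free[of "F $ j * F $ j"] F_anticommute[of j j] by (metis app_simps(1,6))

lemma app_EF:
  "app (E $ Suc a) (app (F $ Suc k) x) = - app (F $ Suc k) (app (E $ Suc a) x) + twist b (app (G $ Suc (a + k)) x)"
  using arg_cong[OF EF[of a k], of "\<lambda>f. app f x"] by (simp add: app_twist algebra_simps)

section \<open>Polynomials acting through F and E\<close>

lemma FF_poly: "poly_act F p (poly_act F q x) = - poly_act F q (poly_act F p x)"
proof -
  have "poly_act F p (poly_act F q x) = (\<Sum>i\<le>degree p. \<Sum>j\<le>degree q.
      scale (coeff p i) (scale (coeff q j) (app (F $ Suc i) (app (F $ Suc j) x))))"
    by (simp add: poly_act_def app_sum scale_simps scale_sum_right)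
  also have "\<dots> = (\<Sum>i\<le>degree p. \<Sum>j\<le>degree q.
      - scale (coeff p i) (scale (coeff q j) (app (F $ Suc j) (app (F $ Suc i) x))))"
    by (intro sum.cong refl) (metis app_F_anticommute scale_minus_right)
  also have "\<dots> = - poly_act F q (poly_act F p x)"
    by (subst sum.swap) (simp add: poly_act_def app_sum scale_simps scale_sum_right sum_negf mult.commute)
  finally show ?thesis .
qed

lemma FF_poly_square: "poly_act F q (poly_act F q x) = 0"
proof -
  have "poly_act F q (poly_act F q x) + poly_act F q (poly_act F q x) = 0"
    using FF_poly[of q q x] by (simp add: eq_neg_iff_add_eq_0)
  then have "scale 2 (poly_act F q (poly_act F q x)) = 0"
    using scale_left_distrib[of 1 1 "poly_act F q (poly_act F q x)"] by (simp del: scale_eq_0_iff)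
  then show ?thesis by simp
qed

text \<open>The anticommutator of E_(i+1) and F_(j+1) depends on i + j only, so on an eigenvector of
  G the polynomials enter through their product.\<close>

lemma EF_poly:
  assumes G: "\<And>n. app (G $ n) x = scale (g $ n) x"
  shows "poly_act E p (poly_act F q x) = - poly_act F q (poly_act E p x) + scale (\<sigma> * pairing (fps_to_fls g) (p * q)) x"
proof -
  have "poly_act E p (poly_act F q x) = (\<Sum>i\<le>degree p. \<Sum>j\<le>degree q.
      scale (coeff p i) (scale (coeff q j) (app (E $ Suc i) (app (F $ Suc j) x))))"
    by (simp add: poly_act_def app_sum scale_simps scale_sum_right)
  also have "\<dots> = (\<Sum>i\<le>degree p. \<Sum>j\<le>degree q.
      - scale (coeff p i) (scale (coeff q j) (app (F $ Suc j) (app (E $ Suc i) x))))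
      + (\<Sum>i\<le>degree p. \<Sum>j\<le>degree q. scale (\<sigma> * (coeff p i * (coeff q j * g $ Suc (i + j)))) x)"
    unfolding app_EF G twist_scale
    by (simp add: scale_right_diff_distrib scale_right_distrib sum.distrib sum_subtractf sum_negf mult_ac)
  also have "(\<Sum>i\<le>degree p. \<Sum>j\<le>degree q.
      - scale (coeff p i) (scale (coeff q j) (app (F $ Suc j) (app (E $ Suc i) x))))
      = - poly_act F q (poly_act E p x)"
    by (subst sum.swap) (simp add: poly_act_def app_sum scale_simps scale_sum_right sum_negf mult.commute)
  also have "(\<Sum>i\<le>degree p. \<Sum>j\<le>degree q. scale (\<sigma> * (coeff p i * (coeff q j * g $ Suc (i + j)))) x)
    = scale (\<sigma> * (\<Sum>i\<le>degree p. \<Sum>j\<le>degree q. coeff p i * (coeff q j * g $ Suc (i + j)))) x"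
    by (simp only: scale_sum_left sum_distrib_left)
  also have "(\<Sum>i\<le>degree p. \<Sum>j\<le>degree q. coeff p i * (coeff q j * g $ Suc (i + j))) = pairing (fps_to_fls g) (p * q)"
    unfolding pairing_def fls_eval_mult mult.assoc fls_eval_X_inv_mult_nth
    by (simp add: sum_distrib_left nat_add_distrib add.assoc)
  finally show ?thesis .
qed

text \<open>If multiplying Q by u amounts to the scalar r, the correction terms of \<open>AF\<close>
  become geometric in r and F_Q x is again an eigenvector of A.\<close>

lemma A_poly_act:
  assumes A: "\<And>n. app (A $ n) x = scale (\<nu> $ n) x"
    and F: "\<And>a. poly_act F (monom 1 a * Q) x = scale (r ^ a) (poly_act F Q x)"
  shows "app (A $ n) (poly_act F Q x) = scale (\<nu> $ n - \<sigma> * (\<Sum>a<n. r ^ a * \<nu> $ (n - Suc a))) (poly_act F Q x)"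
proof -
  have shift: "poly_act F (monom 1 a * Q) x = (\<Sum>j\<le>degree Q. scale (coeff Q j) (app (F $ Suc (j + a)) x))" for a
  proof -
    have "poly_act F (monom 1 a * Q) x = (\<Sum>j\<le>degree Q + a. scale (coeff (monom 1 a * Q) j) (app (F $ Suc j) x))"
      by (rule poly_act_upto) (metis add.commute degree_monom_le degree_mult_le le_trans add_le_mono1)
    also have "\<dots> = (\<Sum>j\<in>{a..degree Q + a}. scale (coeff (monom 1 a * Q) j) (app (F $ Suc j) x))"
      by (rule sum.mono_neutral_right) (auto simp: coeff_monom_mult)
    also have "\<dots> = (\<Sum>j\<le>degree Q. scale (coeff Q j) (app (F $ Suc (j + a)) x))"
      by (rule sum.reindex_bij_witness[of _ "\<lambda>j. j + a" "\<lambda>j. j - a"]) (auto simp: coeff_monom_mult)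
    finally show ?thesis .
  qed
  have AF': "app (A $ n) (app (F $ Suc k) x) = scale (\<nu> $ n) (app (F $ Suc k) x)
    - (\<Sum>a<n. scale (\<sigma> * \<nu> $ (n - Suc a)) (app (F $ Suc (k + a)) x))" for k
    using arg_cong[OF AF[of n k], of "\<lambda>f. app f x"]
    by (simp add: app_sum app_twist A scale_simps twist_scale)
  have "app (A $ n) (poly_act F Q x) = scale (\<nu> $ n) (poly_act F Q x)
    - (\<Sum>j\<le>degree Q. \<Sum>a<n. scale (\<sigma> * \<nu> $ (n - Suc a)) (scale (coeff Q j) (app (F $ Suc (j + a)) x)))"
    by (simp add: poly_act_def app_sum scale_simps AF' scale_right_diff_distrib scale_sum_right sum_subtractf mult_ac)
  also have "\<dots> = scale (\<nu> $ n) (poly_act F Q x) - (\<Sum>a<n. scale (\<sigma> * \<nu> $ (n - Suc a)) (poly_act F (monom 1 a * Q) x))"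
    by (subst sum.swap) (simp only: shift scale_sum_right)
  also have "\<dots> = scale (\<nu> $ n - (\<Sum>a<n. \<sigma> * \<nu> $ (n - Suc a) * r ^ a)) (poly_act F Q x)"
    by (simp add: F scale_left_diff_distrib scale_sum_left)
  finally show ?thesis by (simp add: sum_distrib_left mult_ac)
qed

section \<open>The product F_1 ... F_l\<close>

definition F_product :: "nat \<Rightarrow> 'v \<Rightarrow> 'v" where
  "F_product l = foldr (\<lambda>r. app (F $ r)) [1..<l + 1]"

lemma F_product_simps [simp]:
  "F_product 0 x = x" "F_product (Suc l) x = F_product l (app (F $ Suc l) x)"
  by (simp_all add: F_product_def)

text \<open>Anticommutation moves F_j to its own copy in the product, and F_j^2 = 0.\<close>

lemma F_product_kill: "1 \<le> j \<Longrightarrow> j \<le> l \<Longrightarrow> F_product l (app (F $ j) x) = 0"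
proof (induction l arbitrary: x)
  case (Suc l)
  have zero: "F_product l 0 = 0" by (induction l) simp_all
  have minus: "F_product l (- y) = - F_product l y" for y by (induction l arbitrary: y) simp_all
  show ?case
  proof (cases "j = Suc l")
    case True then show ?thesis using zero by (simp add: app_F_square)
  next
    case False
    then have "F_product l (app (F $ j) (app (F $ Suc l) x)) = 0" using Suc by simp
    then show ?thesis using minus by (simp add: app_F_anticommute[of "Suc l" j])
  qed
qed simp

lemma F_product_linear:
  "F_product l (x + y) = F_product l x + F_product l y"
  "F_product l (scale c x) = scale c (F_product l x)"
  "F_product l 0 = 0"
  by (induction l arbitrary: x y) (simp_all add: scale_simps)

text \<open>The lower coefficients of Q contribute F_1, ..., F_l, which the product annihilates; so
  the innermost factor F_(l+1) may be replaced by F_Q for any monic Q of degree l.\<close>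

lemma F_product_monic:
  assumes "degree Q = l" "lead_coeff Q = 1"
  shows "F_product l (poly_act F Q x) = F_product (Suc l) x"
proof -
  have sum: "F_product l (sum h I) = (\<Sum>i\<in>I. F_product l (h i))" for h :: "nat \<Rightarrow> 'v" and I
    by (induction I rule: infinite_finite_induct) (simp_all add: F_product_linear)
  have "F_product l (poly_act F Q x) = (\<Sum>j\<le>l. scale (coeff Q j) (F_product l (app (F $ Suc j) x)))"
    using assms(1) by (simp add: poly_act_def sum F_product_linear)
  also have "\<dots> = (\<Sum>j\<in>{l}. scale (coeff Q j) (F_product l (app (F $ Suc j) x)))"
    by (rule sum.mono_neutral_right) (use F_product_kill in auto)
  finally show ?thesis using assms by simp
qed

text \<open>
  Induction on the degree of a divisor \<open>P\<close> of \<open>\<phi>\<close>: if \<open>x\<close> is annihilated by the multiples of \<open>P\<close> under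
  \<open>F\<close>, and \<open>P = (u - r) Q\<close>, then \<open>y = F\<^sub>Q x\<close> is annihilated by the multiples of \<open>Q\<close>. For \<open>R = \<phi> / P\<close> one has
  \<open>E\<^sub>R y = \<plusminus>\<psi>(r) x\<close>, because \<open>\<psi>(r)\<close> is the residue of \<open>\<psi> / (u - r)\<close>.
\<close>

lemma F_product_highest:
  assumes g: "fps_to_fls g * fls_eval \<phi> fls_X_inv = fls_eval \<psi> fls_X_inv" and "coprime \<phi> \<psi>"
    and "\<phi> = P * R" "lead_coeff P = 1" "degree P = l"
    and "\<And>q. poly_act F (P * q) x = 0" "\<And>q. poly_act E (R * q) x = 0"
    and "\<And>n. app (A $ n) x = scale (\<nu> $ n) x" "\<And>n. app (G $ n) x = scale (g $ n) x" "x \<noteq> 0"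
  shows "F_product l x \<noteq> 0 \<and> (\<forall>n. app (F $ n) (F_product l x) = 0) \<and>
    (\<forall>n. app (G $ n) (F_product l x) = scale (g $ n) (F_product l x)) \<and>
    (\<exists>\<nu>'. (\<forall>n. app (A $ n) (F_product l x) = scale (\<nu>' $ n) (F_product l x)) \<and>
      fps_to_fls \<nu>' * fls_eval P fls_X_inv = fps_to_fls \<nu> * fls_eval P (fls_X_inv - fls_const \<sigma>))"
  using assms(3-)
proof (induction l arbitrary: P R x \<nu>)
  case 0
  then have "P = 1" by (metis degree_eq_zeroE lead_coeff_pCons(2) one_pCons)
  then have "app (F $ n) x = 0" for n
    using 0(4)[of "monom 1 (n - 1)"] by (cases n) (simp_all add: poly_act_monom)
  with 0 \<open>P = 1\<close> show ?case by auto
next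
  case (Suc l)
  obtain r where "poly P r = 0"
    using fundamental_theorem_of_algebra_alt[of P] Suc.prems(2,3)
    by (metis degree_pCons_0 lead_coeff_pCons(2) nat.distinct(1))
  then obtain Q where P: "P = [:- r, 1:] * Q" by (auto simp: poly_eq_0_iff_dvd dvd_def)
  have Q0: "Q \<noteq> 0" using Suc.prems(3) P by auto
  then have Q: "degree Q = l" "lead_coeff Q = 1"
    using Suc.prems(2,3) degree_mult_eq[of "[:- r, 1:]" Q] lead_coeff_mult[of "[:- r, 1:]" Q]
    by (simp_all del: mult_pCons_left add: P)
  define y where "y = poly_act F Q x"
  have phi: "\<phi> = [:- r, 1:] * (R * Q)"
    using Suc.prems(1) unfolding P by (simp only: mult_ac)
  have "poly \<psi> r \<noteq> 0"
  proof
    assume "poly \<psi> r = 0"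
    then have "[:- r, 1:] dvd \<psi>" by (simp add: poly_eq_0_iff_dvd)
    moreover have "[:- r, 1:] dvd \<phi>" unfolding phi by (rule dvd_triv_left)
    ultimately have "is_unit [:- r, 1:]" using \<open>coprime \<phi> \<psi>\<close> by (meson coprime_common_divisor)
    then show False by (simp add: is_unit_poly_iff)
  qed
  have E: "poly_act E (R * p) y = scale (\<sigma> * pairing (fps_to_fls g) (R * Q * p)) x" for p
    unfolding y_def using EF_poly[of x g "R * p" Q] Suc.prems(5,7) by (simp add: mult_ac)
  have "\<exists>\<nu>'. (\<forall>n. app (A $ n) y = scale (\<nu>' $ n) y) \<and>
      fps_to_fls \<nu>' * (fls_X_inv - fls_const r) = fps_to_fls \<nu> * (fls_X_inv - fls_const \<sigma> - fls_const r)"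
  proof -
    \<comment> \<open>S is the expansion of \<nu> / (u - r), whence \<nu>' = \<nu> (u - s_i - r) /
      (u - r).\<close>
    define S where "S = Abs_fps (\<lambda>n. \<Sum>a<n. r ^ a * \<nu> $ (n - Suc a))"
    define \<nu>' where "\<nu>' = \<nu> - fps_const \<sigma> * S"
    have "poly_act F (monom 1 a * Q) x = scale (r ^ a) y" for a
    proof (induction a)
      case 0 then show ?case by (simp add: y_def)
    next
      case (Suc a)
      \<comment> \<open>Multiples of P act by zero on x, and modulo P multiplication of Q by u is
        multiplication by r.\<close>
      have "monom 1 (Suc a) * Q = P * monom 1 a + smult r (monom 1 a * Q)"
        by (simp add: P monom_Suc algebra_simps)
      then show ?case using Suc Suc.prems Suc.IH by (simp add: poly_act_add poly_act_smult \<open>\<And>q. poly_act F (P * q) x = 0\<close>)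
    qed
    then have "app (A $ n) y = scale (\<nu>' $ n) y" for n
      unfolding y_def using A_poly_act[of x \<nu> Q r n] Suc.prems(6) by (simp add: \<nu>'_def S_def)
    moreover have "S = fps_X * (\<nu> + fps_const r * S)"
    proof (rule fps_ext)
      fix n show "S $ n = (fps_X * (\<nu> + fps_const r * S)) $ n"
        by (cases n) (simp_all add: S_def sum.lessThan_Suc_shift sum_distrib_left mult_ac del: sum.lessThan_Suc)
    qed
    then have "fps_to_fls S = fls_X * (fps_to_fls \<nu> + fls_const r * fps_to_fls S)"
      by (metis (no_types) fps_X_to_fls fps_const_to_fls fps_to_fls_plus fls_times_fps_to_fls)
    then have "fls_X_inv * fps_to_fls S = fps_to_fls \<nu> + fls_const r * fps_to_fls S"
      by (metis fls_X_inv_mult_X)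
    then have "fps_to_fls \<nu>' * (fls_X_inv - fls_const r) = fps_to_fls \<nu> * (fls_X_inv - fls_const \<sigma> - fls_const r)"
      by (simp only: \<nu>'_def fps_to_fls_minus fls_times_fps_to_fls fps_const_to_fls) (simp add: algebra_simps)
    ultimately show ?thesis by blast
  qed
  then obtain \<nu>' where \<nu>': "\<And>n. app (A $ n) y = scale (\<nu>' $ n) y"
      "fps_to_fls \<nu>' * (fls_X_inv - fls_const r) = fps_to_fls \<nu> * (fls_X_inv - fls_const \<sigma> - fls_const r)" by blast
  have "F_product l y = F_product (Suc l) x"
    unfolding y_def using F_product_monic[OF Q] .
  moreover have "F_product l y \<noteq> 0 \<and> (\<forall>n. app (F $ n) (F_product l y) = 0) \<and>
    (\<forall>n. app (G $ n) (F_product l y) = scale (g $ n) (F_product l y)) \<and>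
    (\<exists>\<mu>. (\<forall>n. app (A $ n) (F_product l y) = scale (\<mu> $ n) (F_product l y)) \<and>
      fps_to_fls \<mu> * fls_eval Q fls_X_inv = fps_to_fls \<nu>' * fls_eval Q (fls_X_inv - fls_const \<sigma>))"
  proof (rule Suc.IH[where R = "[:- r, 1:] * R"])
    show "\<phi> = Q * ([:- r, 1:] * R)" using phi by (simp only: mult_ac)
    show "poly_act F (Q * q) y = 0" for q
    proof -
      \<comment> \<open>Division by u - r gives Q q = P q' + c Q: the first summand anticommutes
        with F_Q and kills x, the second gives c times the square of F_Q.\<close>
      obtain q' c where q: "q = [:- r, 1:] * q' + [:c:]" by (metis synthetic_div_correct')
      have "Q * [:c:] = smult c Q" by simp
      then have "Q * q = P * q' + smult c Q"
        unfolding q P by (simp only: distrib_left mult_ac)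
      then show ?thesis
        using FF_poly[of "P * q'" Q x] Suc.prems(4)
        by (simp add: poly_act_add poly_act_smult y_def FF_poly_square)
    qed
    show "poly_act E ([:- r, 1:] * R * q) y = 0" for q
    proof -
      \<comment> \<open>The new factor u - r completes R Q to \<phi>, whose multiples pair to zero
        with g.\<close>
      have "[:- r, 1:] * R * q = R * ([:- r, 1:] * q)" "R * Q * ([:- r, 1:] * q) = \<phi> * q"
        using phi by (simp_all only: mult_ac)
      then show ?thesis using E[of "[:- r, 1:] * q"] pairing_root(1)[OF g, of q] by (simp only:) simp
    qed
    show "app (G $ n) y = scale (g $ n) y" for n
      using arg_cong[OF GF_commute[of n], of "\<lambda>f. app f x"] Suc.prems(7) 
      by (simp add: y_def poly_act_def app_sum scale_sum_right scale_simps mult.commute)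
    have "scale (\<sigma> * poly \<psi> r) x \<noteq> 0"
      using \<open>poly \<psi> r \<noteq> 0\<close> Suc.prems(8) by simp
    then show "y \<noteq> 0" using E[of 1] pairing_root(2)[OF g phi] by auto
  qed (use Q \<nu>' in auto)
  moreover have "fps_to_fls \<mu> * fls_eval P fls_X_inv = fps_to_fls \<nu> * fls_eval P (fls_X_inv - fls_const \<sigma>)"
    if "fps_to_fls \<mu> * fls_eval Q fls_X_inv = fps_to_fls \<nu>' * fls_eval Q (fls_X_inv - fls_const \<sigma>)" for \<mu>
  proof -
    have "fls_eval P z = (z - fls_const r) * fls_eval Q z" for z
      unfolding P fls_eval_mult by simp
    then have "fps_to_fls \<mu> * fls_eval P fls_X_inv = (fps_to_fls \<mu> * fls_eval Q fls_X_inv) * (fls_X_inv - fls_const r)"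
      by (simp only: mult_ac)
    also have "\<dots> = (fps_to_fls \<nu>' * (fls_X_inv - fls_const r)) * fls_eval Q (fls_X_inv - fls_const \<sigma>)"
      unfolding that by (simp only: mult_ac)
    also have "\<dots> = fps_to_fls \<nu> * fls_eval P (fls_X_inv - fls_const \<sigma>)"
      unfolding \<nu>'(2) \<open>\<And>z. fls_eval P z = _\<close> by (simp only: mult_ac)
    finally show ?thesis .
  qed
  ultimately show ?case by metis
qed

text \<open>
  On a vector annihilated by \<open>F(u)\<close> the operators \<open>F\<^sub>k B(u)\<close> act by scalars \<open>\<kappa>\<^sub>k(u)\<close> that satisfy the
  recursion \<open>\<kappa>\<^sub>k\<^sub>+\<^sub>1 = (u - s) \<kappa>\<^sub>k - s g\<^sub>k \<nu>\<close>; combining them with the coefficients of \<open>\<phi>\<close> evaluates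
  \<open>\<phi>\<close> and \<open>\<psi> = \<phi> g\<close> at \<open>u - s\<close>.
\<close>

lemma D_eigenvalue:
  assumes g: "fps_to_fls g * fls_eval \<phi> fls_X_inv = fls_eval \<psi> fls_X_inv" and "g $ 0 = 1"
    and F: "\<And>n. app (F $ n) w = 0" and G: "\<And>n. app (G $ n) w = scale (g $ n) w"
    and A: "\<And>n. app (A $ n) w = scale (\<nu> $ n) w" and "w \<noteq> 0"
  shows "\<exists>\<mu>. (\<forall>n. app (D $ n) w = scale (\<mu> $ n) w) \<and>
    fps_to_fls \<mu> * fls_eval \<phi> (fls_X_inv - fls_const \<sigma>) = fps_to_fls \<nu> * fls_eval \<psi> (fls_X_inv - fls_const \<sigma>)"
proof -
  have step: "app (F $ Suc k) (app (B $ Suc n) w) = app (F $ Suc (Suc k)) (app (B $ n) w)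
     + scale \<sigma> (app (F $ Suc k) (app (B $ n) w)) + scale (\<sigma> * g $ Suc k * \<nu> $ n) w" for k n
    using arg_cong[OF BF_step[of n k], of "\<lambda>f. app f w"]
    by (simp add: app_twist F G A scale_simps twist_scale_1 mult_ac)
  \<comment> \<open>\<open>\<kappa> n k\<close> is the scalar of F_(k+1) B_n. The recursion on n
    calls for index k + 1, so it produces functions of k.\<close>
  define \<kappa> where "\<kappa> = (\<lambda>n. rec_nat (\<lambda>k. 0) (\<lambda>n h k. h (Suc k) + \<sigma> * h k + \<sigma> * g $ Suc k * \<nu> $ n) n)"
  have \<kappa>: "\<kappa> 0 k = 0" "\<kappa> (Suc n) k = \<kappa> n (Suc k) + \<sigma> * \<kappa> n k + \<sigma> * g $ Suc k * \<nu> $ n" for k n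
    by (simp_all add: \<kappa>_def)
  have FB: "app (F $ Suc k) (app (B $ n) w) = scale (\<kappa> n k) w" for n k
    by (induction n arbitrary: k) (simp_all add: B_0 \<kappa> step scale_left_distrib del: scale_left_distrib[symmetric])
  \<comment> \<open>In \<open>BF_step\<close> the index shift multiplies by u, which preserves the
    multiples of \<phi>, and the inhomogeneous term is a pairing of such a multiple with g.\<close>
  have poly_zero: "poly_act F (\<phi> * q) (app (B $ n) w) = 0" for q n
  proof (induction n arbitrary: q)
    case 0 then show ?case by (simp add: B_0)
  next
    case (Suc n)
    define p where "p = \<phi> * q"
    have "poly_act F p (app (B $ Suc n) w) = poly_act F (pCons 0 p) (app (B $ n) w)
       + scale \<sigma> (poly_act F p (app (B $ n) w)) + scale (\<sigma> * \<nu> $ n * (\<Sum>j\<le>degree p. coeff p j * g $ Suc j)) w"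
      by (simp only: poly_act_def[of F p] step poly_act_pCons_0 sum.distrib scale_right_distrib sum_distrib_left scale_sum_left scale_sum_right scale_scale mult_ac)
    also have "(\<Sum>j\<le>degree p. coeff p j * g $ Suc j) = pairing (fps_to_fls g) p"
      by (simp add: pairing_def fls_eval_X_inv_mult_nth nat_add_distrib)
    also have "\<dots> = 0" unfolding p_def by (rule pairing_root(1)[OF g])
    also have "pCons 0 p = \<phi> * pCons 0 q" by (simp add: p_def)
    finally show ?case using Suc[of "pCons 0 q"] Suc[of q] by (simp add: p_def)
  qed
  have sum_\<kappa>: "(\<Sum>j\<le>degree \<phi>. coeff \<phi> j * \<kappa> n j) = 0" for n
  proof -
    have "scale (\<Sum>j\<le>degree \<phi>. coeff \<phi> j * \<kappa> n j) w = 0"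
      using poly_zero[of 1 n] by (simp add: poly_act_def FB scale_sum_left)
    then show ?thesis using \<open>w \<noteq> 0\<close> by simp
  qed
  define K where "K k = fps_to_fls (Abs_fps (\<lambda>n. \<kappa> n k))" for k
  define z where "z = fls_X_inv - fls_const \<sigma>"
  \<comment> \<open>Obtained by solving \<open>F1_B\<close> on w for D, where F_1 w = 0.\<close>
  define \<mu> where "\<mu> = \<nu> + fps_const \<sigma> * Abs_fps (\<lambda>n. \<kappa> n 0)"
  define N M where "N = fps_to_fls \<nu>" and "M = fps_to_fls \<mu>"
  have M: "M = N + fls_const \<sigma> * K 0"
    by (simp only: M_def \<mu>_def N_def K_def fps_to_fls_plus fls_times_fps_to_fls fps_const_to_fls)
  have D: "app (D $ n) w = scale (\<mu> $ n) w" for n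
  proof -
    have "scale (\<kappa> n 0) w = scale \<sigma> (app (D $ n) w - scale (\<nu> $ n) w)"
      using arg_cong[OF F1_B[of n], of "\<lambda>f. app f w"] FB[of 0 n] F
      by (simp add: app_twist A twist_scale_1)
    then have "scale \<sigma> (scale (\<kappa> n 0) w) = app (D $ n) w - scale (\<nu> $ n) w" by simp
    then show ?thesis by (simp add: \<mu>_def scale_left_distrib algebra_simps)
  qed
  have K_Suc: "K (Suc k) = z * K k - fls_const (\<sigma> * g $ Suc k) * N" for k
  proof -
    have "Abs_fps (\<lambda>n. \<kappa> n k) = fps_X * (Abs_fps (\<lambda>n. \<kappa> n (Suc k)) + fps_const \<sigma> * Abs_fps (\<lambda>n. \<kappa> n k) + fps_const (\<sigma> * g $ Suc k) * \<nu>)" (is "?L = ?R")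
    proof (rule fps_ext)
      fix n show "?L $ n = ?R $ n" by (cases n) (simp_all add: \<kappa>)
    qed
    from arg_cong[OF this, of fps_to_fls] have "K k = fls_X * (K (Suc k) + fls_const \<sigma> * K k + fls_const (\<sigma> * g $ Suc k) * N)"
      unfolding K_def N_def
      by (simp only: fps_X_to_fls fps_const_to_fls fps_to_fls_plus fls_times_fps_to_fls)
    then have "fls_X_inv * K k = K (Suc k) + fls_const \<sigma> * K k + fls_const (\<sigma> * g $ Suc k) * N"
      by (metis fls_X_inv_mult_X)
    then show ?thesis by (simp add: z_def algebra_simps)
  qed
  have \<sigma>2: "fls_const \<sigma> * fls_const \<sigma> = 1" by simp
  \<comment> \<open>Solution of the linear recursion \<open>K_Suc\<close>; the initial value comes
    from \<open>M\<close> and g_0 = 1.\<close>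
  have K_eq: "K k = fls_const \<sigma> * (z ^ k * M - N * (\<Sum>c\<le>k. fls_const (g $ c) * z ^ (k - c)))" for k
  proof (induction k)
    case 0 then show ?case using \<open>g $ 0 = 1\<close> \<sigma>2 by (simp add: M algebra_simps flip: mult.assoc)
  next
    case (Suc k)
    have "(\<Sum>c\<le>Suc k. fls_const (g $ c) * z ^ (Suc k - c)) = z * (\<Sum>c\<le>k. fls_const (g $ c) * z ^ (k - c)) + fls_const (g $ Suc k)"
      by (simp add: sum_distrib_left Suc_diff_le mult_ac)
    moreover have "fls_const (\<sigma> * g $ Suc k) = fls_const \<sigma> * fls_const (g $ Suc k)"
      by (simp only: fls_const_mult_const)
    ultimately show ?case
      unfolding K_Suc Suc by (simp only:) (simp add: algebra_simps del: fls_const_mult_const)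
  qed
  \<comment> \<open>Since \<phi> g = \<psi>, the coefficient of u^d in \<psi> is the sum of \<phi>_j
    g_(j-d) over j \<ge> d.\<close>
  have psi: "(\<Sum>j\<le>degree \<phi>. fls_const (coeff \<phi> j) * (\<Sum>c\<le>j. fls_const (g $ c) * z ^ (j - c))) = fls_eval \<psi> z"
  proof -
    have coeff: "coeff \<psi> d = (\<Sum>j\<in>{d..degree \<phi>}. coeff \<phi> j * g $ (j - d))" for d
    proof -
      have "coeff \<psi> d = (fls_eval \<phi> fls_X_inv * fps_to_fls g) $$ (- int d)"
        using g by (simp add: mult.commute fls_eval_X_inv_nth)
      also have "\<dots> = (\<Sum>j\<le>degree \<phi>. if d \<le> j then coeff \<phi> j * g $ (j - d) else 0)"
        unfolding fls_eval_X_inv_mult_nth by (rule sum.cong) (auto simp: nat_diff_distrib' algebra_simps)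
      also have "\<dots> = (\<Sum>j\<in>{d..degree \<phi>}. coeff \<phi> j * g $ (j - d))"
        by (rule sum.mono_neutral_cong_right) auto
      finally show ?thesis .
    qed
    have "degree \<psi> \<le> degree \<phi>"
      by (rule degree_le) (simp add: coeff)
    then have "fls_eval \<psi> z = (\<Sum>d\<le>degree \<phi>. fls_const (coeff \<psi> d) * z ^ d)"
      unfolding fls_eval_altdef by (intro sum.mono_neutral_left) (auto simp: coeff_eq_0)
    also have "\<dots> = (\<Sum>d\<le>degree \<phi>. \<Sum>j\<in>{d..degree \<phi>}. fls_const (coeff \<phi> j) * (fls_const (g $ (j - d)) * z ^ d))"
      unfolding coeff by (intro sum.cong refl) (simp add: fls_const_sum sum_distrib_right flip: mult.assoc)
    also have "\<dots> = (\<Sum>j\<le>degree \<phi>. \<Sum>d\<le>j. fls_const (coeff \<phi> j) * (fls_const (g $ (j - d)) * z ^ d))"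
      unfolding sum.Sigma[OF finite_atMost ballI[OF finite_atLeastAtMost]] sum.Sigma[OF finite_atMost ballI[OF finite_atMost]]
      by (rule sum.reindex_bij_witness[of _ "\<lambda>(a, b). (b, a)" "\<lambda>(a, b). (b, a)"]) auto
    also have "\<dots> = (\<Sum>j\<le>degree \<phi>. fls_const (coeff \<phi> j) * (\<Sum>c\<le>j. fls_const (g $ c) * z ^ (j - c)))"
      unfolding sum_distrib_left
    proof (rule sum.cong[OF refl])
      fix j
      show "(\<Sum>d\<le>j. fls_const (coeff \<phi> j) * (fls_const (g $ (j - d)) * z ^ d))
        = (\<Sum>c\<le>j. fls_const (coeff \<phi> j) * (fls_const (g $ c) * z ^ (j - c)))"
        by (rule sum.reindex_bij_witness[of _ "\<lambda>c. j - c" "\<lambda>c. j - c"]) auto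
    qed
    finally show ?thesis by simp
  qed
  have "(\<Sum>j\<le>degree \<phi>. fls_const (coeff \<phi> j) * K j) = 0"
  proof -
    have "(\<Sum>j\<le>degree \<phi>. fls_const (coeff \<phi> j) * K j) = fps_to_fls (\<Sum>j\<le>degree \<phi>. fps_const (coeff \<phi> j) * Abs_fps (\<lambda>n. \<kappa> n j))"
      by (simp add: K_def fps_to_fls_sum fls_times_fps_to_fls)
    also have "(\<Sum>j\<le>degree \<phi>. fps_const (coeff \<phi> j) * Abs_fps (\<lambda>n. \<kappa> n j)) = 0"
      by (rule fps_ext) (simp add: fps_sum_nth sum_\<kappa>)
    finally show ?thesis by simp
  qed
  also have "(\<Sum>j\<le>degree \<phi>. fls_const (coeff \<phi> j) * K j)
    = fls_const \<sigma> * (fls_eval \<phi> z * M - N * fls_eval \<psi> z)"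
    unfolding K_eq psi[symmetric] fls_eval_altdef[of \<phi>]
    by (simp add: sum_distrib_left sum_distrib_right right_diff_distrib sum_subtractf mult_ac)
  finally have "M * fls_eval \<phi> z = N * fls_eval \<psi> z"
    by (simp add: algebra_simps split: if_splits)
  then show ?thesis using D unfolding z_def M_def N_def by blast
qed

text \<open>On v the series G acts by \<delta> / \<alpha> = \<psi> / \<phi>. For every q, the vector
  F_(\<phi> q) v is killed by E, because multiples of \<phi> pair to zero, hence by B = A E, and so
  vanishes by the hypothesis \<open>irreducible\<close>. This starts
  \<open>F_product_highest\<close> with P = \<phi> and R = 1.\<close>

lemma odd_reflection:
  assumes v: "\<And>n. app (A $ n) v = scale (\<alpha> $ n) v" "\<And>n. app (D $ n) v = scale (\<delta> $ n) v"
      "\<And>n. app (B $ n) v = 0" "v \<noteq> 0" and "\<alpha> $ 0 = 1" "\<delta> $ 0 = 1"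
    and rational: "fps_to_fls \<alpha> * fls_eval \<psi> fls_X_inv = fps_to_fls \<delta> * fls_eval \<phi> fls_X_inv"
    and "coprime \<phi> \<psi>" "lead_coeff \<phi> = 1" "degree \<phi> = k"
    and irreducible: "\<And>q. (\<And>n. app (B $ n) (poly_act F q v) = 0) \<Longrightarrow> poly_act F q v = 0"
  shows "F_product k v \<noteq> 0" "\<And>n. app (C $ n) (F_product k v) = 0"
    "\<exists>\<nu> \<mu>. (\<forall>n. app (A $ n) (F_product k v) = scale (\<nu> $ n) (F_product k v)) \<and>
      (\<forall>n. app (D $ n) (F_product k v) = scale (\<mu> $ n) (F_product k v)) \<and>
      fps_to_fls \<nu> * fls_eval \<phi> fls_X_inv = fps_to_fls \<alpha> * fls_eval \<phi> (fls_X_inv - fls_const \<sigma>) \<and>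
      fps_to_fls \<mu> * fls_eval \<phi> (fls_X_inv - fls_const \<sigma>) = fps_to_fls \<nu> * fls_eval \<psi> (fls_X_inv - fls_const \<sigma>)"
proof -
  define g where "g = \<delta> * inverse \<alpha>"
  have "inverse \<alpha> * \<alpha> = 1" using \<open>\<alpha> $ 0 = 1\<close> by (intro inverse_mult_eq_1) simp
  then have g\<alpha>: "g * \<alpha> = \<delta>" by (simp add: g_def mult.assoc)
  have g_0: "g $ 0 = 1" using \<open>\<alpha> $ 0 = 1\<close> \<open>\<delta> $ 0 = 1\<close> by (simp add: g_def)
  have "\<alpha> \<noteq> 0" using \<open>\<alpha> $ 0 = 1\<close> by auto
  then have g: "fps_to_fls g * fls_eval \<phi> fls_X_inv = fls_eval \<psi> fls_X_inv"
    using rational by (simp add: fls_times_fps_to_fls mult_ac flip: g\<alpha>)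
  \<comment> \<open>Since B v = 0, the identity D = G A + F B determines G v degree by degree from
    \<alpha>_0 = 1.\<close>
  have G: "app (G $ n) v = scale (g $ n) v" for n
  proof (induction n rule: less_induct)
    case (less n)
    have "app (D $ n) v = app ((G * A) $ n) v + app ((F * B) $ n) v"
      using arg_cong[OF GA, of "\<lambda>f. app (f $ n) v"] by simp
    also have "app ((F * B) $ n) v = 0" by (simp add: fps_mult_nth app_sum v)
    also have "app ((G * A) $ n) v = (\<Sum>i\<le>n. scale (\<alpha> $ (n - i)) (app (G $ i) v))"
      by (simp add: fps_mult_nth app_sum v scale_simps atLeast0AtMost)
    also have "\<dots> = (\<Sum>i<n. scale (\<alpha> $ (n - i)) (scale (g $ i) v)) + app (G $ n) v"
      using less \<open>\<alpha> $ 0 = 1\<close> by (simp flip: lessThan_Suc_atMost)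
    also have "(\<Sum>i<n. scale (\<alpha> $ (n - i)) (scale (g $ i) v)) = scale (\<delta> $ n - g $ n) v"
    proof -
      have "\<delta> $ n = (\<Sum>i<n. g $ i * \<alpha> $ (n - i)) + g $ n"
        using \<open>\<alpha> $ 0 = 1\<close> unfolding g\<alpha>[symmetric] fps_mult_nth atLeast0AtMost
        by (simp flip: lessThan_Suc_atMost)
      then show ?thesis by (simp add: scale_sum_left mult.commute)
    qed
    finally show ?case using v(2) by (simp add: scale_left_diff_distrib)
  qed
  have Ev: "app (E $ n) v = 0" for n
    by (simp add: E_def fps_mult_nth app_sum v)
  have E_poly: "poly_act E q v = 0" for q by (simp add: poly_act_def Ev)
  have F_zero: "poly_act F (\<phi> * q) v = 0" for q
  proof (rule irreducible)
    fix n
    have "app (E $ a) (poly_act F (\<phi> * q) v) = 0" for a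
    proof (cases a)
      case (Suc a')
      have "pairing (fps_to_fls g) (monom 1 a' * (\<phi> * q)) = 0"
        using pairing_root(1)[OF g, of "monom 1 a' * q"] by (simp only: mult_ac)
      then have "poly_act E (monom 1 a') (poly_act F (\<phi> * q) v) = 0"
        using EF_poly[OF G, of "monom 1 a'" "\<phi> * q"] by (simp add: E_poly)
      then show ?thesis using Suc by (simp add: poly_act_monom)
    qed simp
    then show "app (B $ n) (poly_act F (\<phi> * q) v) = 0"
      using arg_cong[OF AE, of "\<lambda>f. app (f $ n) (poly_act F (\<phi> * q) v)"] by (simp add: fps_mult_nth app_sum)
  qed
  note highest = F_product_highest[OF g \<open>coprime \<phi> \<psi>\<close>, of \<phi> 1 k v \<alpha>]
  have w: "F_product k v \<noteq> 0" "\<And>n. app (F $ n) (F_product k v) = 0"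
    "\<And>n. app (G $ n) (F_product k v) = scale (g $ n) (F_product k v)"
    using highest assms(9,10) F_zero E_poly v G by simp_all
  obtain \<nu> where \<nu>: "\<And>n. app (A $ n) (F_product k v) = scale (\<nu> $ n) (F_product k v)"
     "fps_to_fls \<nu> * fls_eval \<phi> fls_X_inv = fps_to_fls \<alpha> * fls_eval \<phi> (fls_X_inv - fls_const \<sigma>)"
    using highest assms(9,10) F_zero E_poly v G by auto
  show "F_product k v \<noteq> 0" by (rule w)
  show "app (C $ n) (F_product k v) = 0" for n
    using arg_cong[OF FA, of "\<lambda>f. app (f $ n) (F_product k v)"]
    by (simp add: fps_mult_nth app_sum \<nu> scale_simps w)
  show "\<exists>\<nu> \<mu>. (\<forall>n. app (A $ n) (F_product k v) = scale (\<nu> $ n) (F_product k v)) \<and>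
      (\<forall>n. app (D $ n) (F_product k v) = scale (\<mu> $ n) (F_product k v)) \<and>
      fps_to_fls \<nu> * fls_eval \<phi> fls_X_inv = fps_to_fls \<alpha> * fls_eval \<phi> (fls_X_inv - fls_const \<sigma>) \<and>
      fps_to_fls \<mu> * fls_eval \<phi> (fls_X_inv - fls_const \<sigma>) = fps_to_fls \<nu> * fls_eval \<psi> (fls_X_inv - fls_const \<sigma>)"
    using D_eigenvalue[OF g g_0 w(2) w(3) \<nu>(1) w(1)] \<nu> by blast
qed

end

section \<open>Yangian modules\<close>

lemma free_scalar_mult: "free_scalar c * p = p * free_scalar c"
proof -
  have "free_scalar c * (\<Sum>w\<in>Poly_Mapping.keys p. Poly_Mapping.single w (Poly_Mapping.lookup p w))
    = (\<Sum>w\<in>Poly_Mapping.keys p. Poly_Mapping.single w (Poly_Mapping.lookup p w)) * free_scalar c"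
    by (simp add: free_scalar_def sum_distrib_left sum_distrib_right mult_single mult.commute zero_list_def plus_list_def)
  then show ?thesis by (simp add: poly_mapping_sum_monomials)
qed

lemma yangian_class_hom:
  assumes "p \<in> carrier (free_algebra (yangian_letters N))" "q \<in> carrier (free_algebra (yangian_letters N))"
  shows "yangian_class N s p \<in> carrier (yangian N s)"
    and "yangian_class N s (p + q) = yangian_class N s p \<oplus>\<^bsub>yangian N s\<^esub> yangian_class N s q"
    and "yangian_class N s (p * q) = yangian_class N s p \<otimes>\<^bsub>yangian N s\<^esub> yangian_class N s q"
proof -
  have hom: "yangian_class N s \<in> ring_hom (free_algebra (yangian_letters N)) (yangian N s)"
    using ideal.rcos_ring_hom[OF ideal_yangian] by (simp add: yangian_class_def[abs_def] yangian_def)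
  show "yangian_class N s p \<in> carrier (yangian N s)" by (rule ring_hom_closed[OF hom assms(1)])
  show "yangian_class N s (p + q) = yangian_class N s p \<oplus>\<^bsub>yangian N s\<^esub> yangian_class N s q"
    using ring_hom_add[OF hom assms] by (simp add: free_algebra_def)
  show "yangian_class N s (p * q) = yangian_class N s p \<otimes>\<^bsub>yangian N s\<^esub> yangian_class N s q"
    using ring_hom_mult[OF hom assms] by (simp add: free_algebra_def)
qed

lemma yangian_class_one: "yangian_class N s 1 = \<one>\<^bsub>yangian N s\<^esub>"
proof -
  have hom: "yangian_class N s \<in> ring_hom (free_algebra (yangian_letters N)) (yangian N s)"
    using ideal.rcos_ring_hom[OF ideal_yangian] by (simp add: yangian_class_def[abs_def] yangian_def)
  show ?thesis using ring_hom_one[OF hom] by (simp add: free_algebra_def)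
qed

lemma yangian_carrierE:
  assumes "y \<in> carrier (yangian N s)"
  obtains p where "p \<in> carrier (free_algebra (yangian_letters N))" "y = yangian_class N s p"
  using assms unfolding yangian_def yangian_class_def FactRing_def A_RCOSETS_def' by auto

lemma yangian_class_relator:
  assumes "i \<in> {1..N}" "j \<in> {1..N}" "k \<in> {1..N}" "l \<in> {1..N}"
  shows "yangian_class N s (yangian_relator s i j k l p q) = yangian_class N s 0"
proof -
  interpret ideal "yangian_ideal N s" "free_algebra (yangian_letters N)" by (rule ideal_yangian)
  have "yangian_relator s i j k l p q \<in> yangian_ideal N s"
    unfolding yangian_ideal_def
    by (rule subsetD[OF ring.genideal_self[OF free_algebra_ring relators_carrier]]) (use assms in blast)
  then have "yangian_class N s (yangian_relator s i j k l p q) = yangian_ideal N s"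
    unfolding yangian_class_def by (rule a_coset_join2[OF relator_carrier[OF assms] a_subgroup])
  moreover have "yangian_class N s 0 = yangian_ideal N s"
    unfolding yangian_class_def
    using a_coset_join2[OF a_subset[THEN subsetD] a_subgroup] additive_subgroup.zero_closed[OF is_additive_subgroup]
    by (simp add: free_algebra_def)
  ultimately show ?thesis by simp
qed

lemma bit_add_self [simp]: "a + a = (0::bit)"
  by (cases a) simp_all

lemma bit_mult_self [simp]: "a * a = (a::bit)"
  by (cases a) simp_all

lemma koszul_sign_parity: "s a \<in> {1, -1} \<Longrightarrow> koszul_sign (parity s a) = of_int (s a)"
  by (auto simp: koszul_sign_def parity_def)

definition swap_sign :: "(nat \<Rightarrow> int) \<Rightarrow> nat \<Rightarrow> nat \<Rightarrow> nat \<Rightarrow> nat \<Rightarrow> complex" where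
  "swap_sign s i j k l = koszul_sign ((parity s i + parity s j) * (parity s k + parity s l))"

definition relation_sign :: "(nat \<Rightarrow> int) \<Rightarrow> nat \<Rightarrow> nat \<Rightarrow> nat \<Rightarrow> complex" where
  "relation_sign s i j k =
    koszul_sign (parity s i * parity s j + parity s i * parity s k + parity s j * parity s k)"

lemma swap_sign_diag: "swap_sign s a a k l = 1"
  by (simp add: swap_sign_def koszul_sign_def)

lemma swap_sign_nonzero: "swap_sign s i j k l \<noteq> 0"
  by (simp add: swap_sign_def koszul_sign_def)

lemma relation_sign_diag: "s a \<in> {1, -1} \<Longrightarrow> relation_sign s a a k = of_int (s a)"
  by (simp add: relation_sign_def koszul_sign_parity add.assoc del: add_bit_eq_xor mult_bit_eq_and)

section \<open>Generators acting on a module\<close>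

locale yangian_action =
  fixes N :: nat and s :: "nat \<Rightarrow> int" and scale :: "complex \<Rightarrow> 'v::ab_group_add \<Rightarrow> 'v"
    and V :: "bit \<Rightarrow> 'v set" and act :: "yangian_elt \<Rightarrow> 'v \<Rightarrow> 'v"
  assumes yangian_module: "yangian_module N s scale V act"
begin

sublocale vector_space scale
  using yangian_module by (simp add: yangian_module_def)

lemma act_add_right: "y \<in> carrier (yangian N s) \<Longrightarrow> act y (v + w) = act y v + act y w"
  and act_add: "x \<in> carrier (yangian N s) \<Longrightarrow> y \<in> carrier (yangian N s) \<Longrightarrow>
    act (x \<oplus>\<^bsub>yangian N s\<^esub> y) v = act x v + act y v"
  and act_mult: "x \<in> carrier (yangian N s) \<Longrightarrow> y \<in> carrier (yangian N s) \<Longrightarrow>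
    act (x \<otimes>\<^bsub>yangian N s\<^esub> y) v = act x (act y v)"
  and act_scalar: "act (yangian_scalar N s c) v = scale c v"
  and act_part: "y \<in> yangian_part N s a \<Longrightarrow> v \<in> V a' \<Longrightarrow> act y v \<in> V (a + a')"
  and V_subspace: "subspace (V a)"
  using yangian_module unfolding yangian_module_def by blast+

abbreviation free :: "((nat \<times> nat \<times> nat) list \<Rightarrow>\<^sub>0 complex) set" where
  "free \<equiv> carrier (free_algebra (yangian_letters N))"

text \<open>The action pulled back to the free algebra, where elements are concrete and relators act
  by zero.\<close>

definition cact :: "((nat \<times> nat \<times> nat) list \<Rightarrow>\<^sub>0 complex) \<Rightarrow> 'v \<Rightarrow> 'v" where
  "cact p = act (yangian_class N s p)"

lemma cact_add_right: "p \<in> free \<Longrightarrow> cact p (v + w) = cact p v + cact p w"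
  unfolding cact_def by (rule act_add_right) (rule yangian_class_hom)

lemma cact_add: "p \<in> free \<Longrightarrow> q \<in> free \<Longrightarrow> cact (p + q) v = cact p v + cact q v"
  by (simp add: cact_def yangian_class_hom act_add)

lemma cact_mult: "p \<in> free \<Longrightarrow> q \<in> free \<Longrightarrow> cact (p * q) v = cact p (cact q v)"
  by (simp add: cact_def yangian_class_hom act_mult)

lemma cact_scalar: "cact (free_scalar c) v = scale c v"
  using act_scalar by (simp add: cact_def yangian_scalar_def)

lemma cact_zero: "cact 0 v = 0"
  using cact_scalar[of 0] by (simp add: free_scalar_def)

lemma cact_diff: "p \<in> free \<Longrightarrow> q \<in> free \<Longrightarrow> cact (p - q) v = cact p v - cact q v"
  using cact_add[of "p - q" q v] free_carrier_ring(3)[of p "yangian_letters N" q] by simp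

lemma cact_scale: "p \<in> free \<Longrightarrow> cact p (scale c v) = scale c (cact p v)"
  using cact_mult[of p "free_scalar c" v] cact_mult[of "free_scalar c" p v] free_carrier_ring(4)[of c "yangian_letters N"]
  by (simp add: cact_scalar free_scalar_mult)

definition T :: "nat \<Rightarrow> nat \<Rightarrow> nat \<Rightarrow> 'v \<Rightarrow> 'v" where
  "T i j r = act (yangian_t N s i j r)"

lemma T_cact: "T i j r = cact (free_t i j r)"
  by (simp add: T_def cact_def yangian_t_def)

lemma T_0: "T i j 0 v = (if i = j then v else 0)"
  using cact_scalar[of 1 v] by (simp add: T_cact free_t_def cact_zero free_scalar_def)

context
  fixes i j assumes ij: "i \<in> {1..N}" "j \<in> {1..N}"
begin

lemma T_add: "T i j r (v + w) = T i j r v + T i j r w"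
  and T_scale: "T i j r (scale c v) = scale c (T i j r v)"
  by (simp_all add: T_cact cact_add_right cact_scale free_t_carrier[OF ij])

lemma T_zero: "T i j r 0 = 0"
  using T_scale[of r 0 0] by simp

lemma T_sum: "T i j r (sum f I) = (\<Sum>a\<in>I. T i j r (f a))"
  by (induction I rule: infinite_finite_induct) (simp_all add: T_zero T_add)

lemma T_V: "v \<in> V a \<Longrightarrow> T i j r v \<in> V (parity s i + parity s j + a)"
proof -
  assume v: "v \<in> V a"
  have "yangian_t N s i j r \<in> yangian_part N s (parity s i + parity s j)"
    unfolding yangian_t_def yangian_part_def
  proof (rule imageI, safe)
    show "free_t i j r \<in> free" by (rule free_t_carrier[OF ij])
    fix w assume "w \<in> Poly_Mapping.keys (free_t i j r)"
    then have "w = [(i, j, r)] \<or> w = [] \<and> i = j"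
      by (auto simp: free_t_def zero_list_def split: if_splits)
    then show "word_parity s w = parity s i + parity s j"
      by (auto simp: word_parity_def)
  qed
  from act_part[OF this v] show ?thesis by (simp add: T_def)
qed

end

definition supercomm :: "nat \<Rightarrow> nat \<Rightarrow> nat \<Rightarrow> nat \<Rightarrow> nat \<Rightarrow> nat \<Rightarrow> 'v \<Rightarrow> 'v" where
  "supercomm i j p k l q v = T i j p (T k l q v)
    - scale (swap_sign s i j k l) (T k l q (T i j p v))"

lemma T_relation:
  assumes ijkl: "i \<in> {1..N}" "j \<in> {1..N}" "k \<in> {1..N}" "l \<in> {1..N}"
  shows "supercomm i j (Suc p) k l q v = supercomm i j p k l (Suc q) v
    + scale (relation_sign s i j k) (T k j p (T i l q v) - T k j q (T i l p v))"
proof -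
  have "cact (yangian_relator s i j k l p q) v = 0"
    using yangian_class_relator[OF ijkl] cact_zero by (simp add: cact_def)
  then show ?thesis
    unfolding yangian_relator_def free_supercomm_def prod.case
    by (simp only: cact_diff cact_mult cact_scalar free_carrier_ring free_t_carrier assms
        supercomm_def T_cact flip: swap_sign_def relation_sign_def) (simp add: algebra_simps)
qed

lemma supercomm_0: "k \<in> {1..N} \<Longrightarrow> l \<in> {1..N} \<Longrightarrow> supercomm i j 0 k l q v = 0"
  by (simp add: supercomm_def T_0 T_zero swap_sign_diag)

text \<open>The right-hand side of the relation consists of products ending in t_il applied to v;
  without it, p can be lowered to 0.\<close>

lemma supercommute:
  assumes ijkl: "i \<in> {1..N}" "j \<in> {1..N}" "k \<in> {1..N}" "l \<in> {1..N}" and zero: "\<And>r. T i l r v = 0"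
  shows "supercomm i j p k l q v = 0"
  by (induction p arbitrary: q) (use ijkl in \<open>simp_all add: supercomm_0 T_relation zero T_zero\<close>)

text \<open>The relation at p = 0: the t_aa^(1) measure weights as in gl.\<close>

lemma T_diag_comm:
  assumes "a \<in> {1..N}" "k \<in> {1..N}" "l \<in> {1..N}" "s a \<in> {1, -1}"
  shows "T a a 1 (T k l q v) = T k l q (T a a 1 v)
    + scale (of_int (s a)) ((if k = a then T k l q v else 0) - (if a = l then T k l q v else 0))"
  using T_relation[of a a k l 0 q v] assms
  by (simp add: supercomm_0 T_0 relation_sign_diag T_zero)
    (auto simp add: supercomm_def swap_sign_diag algebra_simps T_zero)

text \<open>
  The span of the vectors obtained from \<open>x\<close> by lower triangular and diagonal generators, filtered
  by the total degree of \<open>t\<^sub>i\<^sub>j\<^sup>(\<^sup>r\<^sup>) \<mapsto> r\<close>. Generators supercommute up to terms of smaller degree.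
\<close>

inductive low :: "'v \<Rightarrow> nat \<Rightarrow> 'v \<Rightarrow> bool" for x where
  start: "low x 0 x"
| step: "low x d y \<Longrightarrow> k \<le> j \<Longrightarrow> j \<in> {1..N} \<Longrightarrow> k \<in> {1..N} \<Longrightarrow> r > 0 \<Longrightarrow> low x (d + r) (T j k r y)"
| add: "low x d y \<Longrightarrow> low x d z \<Longrightarrow> low x d (y + z)"
| scale: "low x d y \<Longrightarrow> low x d (scale c y)"
| mono: "low x d y \<Longrightarrow> low x (Suc d) y"

lemma low_zero: "low x d 0"
proof (induction d)
  case 0 then show ?case using low.scale[OF low.start, of x 0] by simp
qed (rule low.mono)

lemma low_mono: "low x d y \<Longrightarrow> d \<le> d' \<Longrightarrow> low x d' y"
  by (rule dec_induct[of d d']) (auto intro: low.mono)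

lemma low_diff: "low x d y \<Longrightarrow> low x d z \<Longrightarrow> low x d (y - z)"
  using low.add[of x d y "scale (-1) z"] low.scale[of x d z "-1"] by simp

text \<open>A generator moved past the lower ones down to x either kills x or is lower triangular or
  diagonal itself, and all corrections have smaller degree. The outer induction on \<open>e\<close>
  bounds the degree, the inner one follows the construction of y.\<close>

lemma low_T:
  assumes x: "\<And>j k r. j \<in> {1..N} \<Longrightarrow> k \<in> {1..N} \<Longrightarrow> j < k \<Longrightarrow> T j k r x = 0"
  shows "low x d y \<Longrightarrow> d + r \<le> e \<Longrightarrow> j \<in> {1..N} \<Longrightarrow> k \<in> {1..N} \<Longrightarrow> low x (d + r) (T j k r y)"
proof (induction e arbitrary: d r j k y)
  case 0
  then show ?case by (auto simp: T_0 intro: low_zero)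
next
  case (Suc e)
  note outer = Suc.IH
  \<comment> \<open>A supercommutator of total degree m + 1 raises the degree by m only: lowering p
    to 0 by \<open>T_relation\<close> adds products of degree m, which the outer induction
    covers.\<close>
  have comm: "p + q = Suc m \<Longrightarrow> d + m \<le> e \<Longrightarrow> low x (d + m) (supercomm j k p j' k' q y)"
    if "low x d y" "j \<in> {1..N}" "k \<in> {1..N}" "j' \<in> {1..N}" "k' \<in> {1..N}" for d m p q j k j' k' y
  proof (induction p arbitrary: q)
    case 0 then show ?case using that by (simp add: supercomm_0 low_zero)
  next
    case (Suc p)
    have TT: "low x (d + m) (T a1 b1 r1 (T a2 b2 r2 y))"
      if "a1 \<in> {1..N}" "b1 \<in> {1..N}" "a2 \<in> {1..N}" "b2 \<in> {1..N}" "r1 + r2 = m" for a1 b1 a2 b2 r1 r2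
    proof -
      have "low x (d + r2) (T a2 b2 r2 y)" by (rule outer) (use \<open>low x d y\<close> that Suc.prems in auto)
      then have "low x (d + r2 + r1) (T a1 b1 r1 (T a2 b2 r2 y))" by (rule outer) (use that Suc.prems in auto)
      moreover have "d + m = d + r2 + r1" using that by simp
      ultimately show ?thesis by (simp only:)
    qed
    have "low x (d + m) (supercomm j k p j' k' (Suc q) y)" using Suc by simp
    moreover have "low x (d + m) (T j' k p (T j k' q y))"
      by (rule TT) (use that Suc.prems in simp_all)
    moreover have "low x (d + m) (T j' k q (T j k' p y))"
      by (rule TT) (use that Suc.prems in simp_all)
    ultimately show ?case
      unfolding T_relation[OF that(2-5)] by (intro low.add low.scale low_diff)
  qed
  show ?case
    using Suc.prems
  proof (induction rule: low.induct)
    case start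
    show ?case
    proof (cases "j < k")
      case True then show ?thesis using x start by (simp add: low_zero)
    next
      case False
      then show ?thesis using low.step[OF low.start, of k j r x] start
        by (cases "r = 0") (auto simp: T_0 intro: low_zero low.start)
    qed
  next
    case (step d y k' j' r')
    have y: "low x (d + r) (T j k r y)" using step by simp
    have "low x (d + r + r') (T j' k' r' (T j k r y))"
      using low.step[OF y step(2-5)] .
    \<comment> \<open>Here r' > 0, so r + r' is a successor, as \<open>comm\<close> demands.\<close>
    moreover have "low x (d + (r + r' - 1)) (supercomm j k r j' k' r' y)"
      using step by (intro comm) auto
    then have "low x (d + r + r') (supercomm j k r j' k' r' y)"
      by (rule low_mono) simp
    ultimately have "low x (d + r + r') (supercomm j k r j' k' r' y + scale (swap_sign s j k j' k') (T j' k' r' (T j k r y)))"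
      by (intro low.add low.scale)
    then show ?case by (simp add: supercomm_def ac_simps)
  next
    case (add d y z) then show ?case by (simp add: T_add low.add)
  next
    case (scale d y c) then show ?case by (simp add: T_scale low.scale)
  next
    case (mono d y)
    then have "low x (d + r) (T j k r y)" by simp
    then show ?case by (simp add: low.mono)
  qed
qed

text \<open>The spanning half of a triangular decomposition: the letters of a word are applied one
  at a time, starting from the right.\<close>

lemma low_act:
  assumes x: "\<And>j k r. j \<in> {1..N} \<Longrightarrow> k \<in> {1..N} \<Longrightarrow> j < k \<Longrightarrow> T j k r x = 0"
    and "y \<in> carrier (yangian N s)"
  shows "\<exists>d. low x d (act y x)"
proof -
  obtain p where p: "p \<in> free" "y = yangian_class N s p" using assms(2) by (rule yangian_carrierE)
  have single: "Poly_Mapping.single w c \<in> free" if "set w \<subseteq> yangian_letters N" for w c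
    using that by (simp add: free_algebra_def)
  have word: "\<exists>d. low x d (cact (Poly_Mapping.single w c) x)" if "set w \<subseteq> yangian_letters N" for w c
    using that
  proof (induction w)
    case Nil
    have "cact (Poly_Mapping.single [] c) x = scale c x"
      using cact_scalar[of c x] by (simp add: free_scalar_def zero_list_def)
    then show ?case using low.scale[OF low.start] by auto
  next
    case (Cons l w)
    obtain j k r where l: "l = (j, k, r)" by (cases l)
    have jkr: "j \<in> {1..N}" "k \<in> {1..N}" "r > 0" using Cons.prems by (auto simp: l yangian_letters_def)
    obtain d where "low x d (cact (Poly_Mapping.single w c) x)" using Cons by auto
    then have "low x (d + r) (T j k r (cact (Poly_Mapping.single w c) x))"
      using jkr by (intro low_T[OF x, where e = "d + r"]) auto
    also have "T j k r (cact (Poly_Mapping.single w c) x) = cact (Poly_Mapping.single (l # w) c) x"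
      using Cons.prems jkr cact_mult[OF free_t_carrier[OF jkr(1,2), of r] single, of w c x]
      by (simp add: T_cact free_t_def mult_single plus_list_def l)
    finally show ?case by blast
  qed
  have sum: "\<exists>d. low x d (cact (\<Sum>w\<in>W. Poly_Mapping.single w (Poly_Mapping.lookup p w)) x) \<and> (\<Sum>w\<in>W. Poly_Mapping.single w (Poly_Mapping.lookup p w)) \<in> free"
    if "finite W" "\<And>w. w \<in> W \<Longrightarrow> set w \<subseteq> yangian_letters N" for W
    using that
  proof (induction W)
    case empty
    then show ?case using low_zero by (auto simp: cact_zero free_algebra_def)
  next
    case (insert w W)
    then obtain d where d: "low x d (cact (\<Sum>w\<in>W. Poly_Mapping.single w (Poly_Mapping.lookup p w)) x)"
      "(\<Sum>w\<in>W. Poly_Mapping.single w (Poly_Mapping.lookup p w)) \<in> free" by auto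
    obtain d' where d': "low x d' (cact (Poly_Mapping.single w (Poly_Mapping.lookup p w)) x)"
      using word insert.prems by blast
    have "low x (max d d') (cact (Poly_Mapping.single w (Poly_Mapping.lookup p w)) x + cact (\<Sum>w\<in>W. Poly_Mapping.single w (Poly_Mapping.lookup p w)) x)"
      using d d' by (intro low.add) (auto intro: low_mono)
    then show ?case
      using insert d single[of w] free_carrier_ring(2)[OF single d(2), of w] by (auto simp: cact_add)
  qed
  have "act y x = cact (\<Sum>w\<in>Poly_Mapping.keys p. Poly_Mapping.single w (Poly_Mapping.lookup p w)) x"
    by (simp add: p cact_def poly_mapping_sum_monomials)
  moreover have "\<And>w. w \<in> Poly_Mapping.keys p \<Longrightarrow> set w \<subseteq> yangian_letters N"
    using p(1) by (simp add: free_algebra_def)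
  ultimately show ?thesis using sum[of "Poly_Mapping.keys p"] by auto
qed

text \<open>A Cartan element that sees only the cut between i and i + 1: t_(i+1,i) lowers it by one,
  and generators that do not cross the cut preserve it.\<close>

definition height :: "nat \<Rightarrow> 'v \<Rightarrow> 'v" where
  "height i v = (\<Sum>a\<in>{1..i}. scale (of_int (s a)) (T a a 1 v))"

lemma height_T:
  assumes "\<And>a. a \<in> {1..N} \<Longrightarrow> s a \<in> {1, -1}" "i \<le> N" "k \<in> {1..N}" "l \<in> {1..N}"
  shows "height i (T k l q v) = T k l q (height i v) + scale (of_bool (k \<le> i) - of_bool (l \<le> i)) (T k l q v)"
proof -
  have "scale (of_int (s a)) (T a a 1 (T k l q v)) = T k l q (scale (of_int (s a)) (T a a 1 v))
    + ((if k = a then T k l q v else 0) - (if a = l then T k l q v else 0))" if "a \<in> {1..i}" for a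
  proof -
    have a: "a \<in> {1..N}" "s a \<in> {1, -1}" using that assms by auto
    then have "of_int (s a) * of_int (s a) = (1::complex)" by auto
    then show ?thesis
      using a assms by (simp only: T_diag_comm T_scale scale_right_distrib scale_scale scale_one)
  qed
  then show ?thesis
    using assms by (simp add: height_def T_sum sum.distrib sum_subtractf scale_left_diff_distrib of_bool_def)
qed

lemma height_linear:
  assumes "i \<le> N"
  shows "height i (v + w) = height i v + height i w" "height i (scale c v) = scale c (height i v)" "height i 0 = 0"
  using assms by (simp_all add: height_def T_add T_scale T_zero scale_right_distrib sum.distrib scale_sum_right mult.commute)

text \<open>Applying (height - \<mu>_M) / (h - \<mu>_M) fixes v, removes the last summand and
  rescales the others.\<close>

lemma height_eigenvectors_independent:
  fixes z :: "nat \<Rightarrow> 'v" and \<mu> :: "nat \<Rightarrow> complex"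
  assumes "i \<le> N" "\<And>n. height i (z n) = scale (\<mu> n) (z n)" "height i v = scale h v" "\<And>n. \<mu> n \<noteq> h"
    and "v = (\<Sum>n<M. z n)"
  shows "v = 0"
  using assms(2,5)
proof (induction M arbitrary: z)
  case (Suc M)
  have sum: "height i (sum f I) = (\<Sum>a\<in>I. height i (f a))" for f and I :: "nat set"
    by (induction I rule: infinite_finite_induct) (simp_all add: height_linear \<open>i \<le> N\<close>)
  have "scale (h - \<mu> M) v = height i v - scale (\<mu> M) v"
    by (simp add: assms(3) scale_left_diff_distrib)
  also have "\<dots> = (\<Sum>n<M. scale (\<mu> n - \<mu> M) (z n))"
    by (simp add: Suc.prems sum scale_right_distrib scale_sum_right scale_left_diff_distrib sum_subtractf height_linear \<open>i \<le> N\<close>)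
  finally have "scale (1 / (h - \<mu> M)) (scale (h - \<mu> M) v) = (\<Sum>n<M. scale ((\<mu> n - \<mu> M) / (h - \<mu> M)) (z n))"
    by (simp only: scale_sum_right scale_scale) simp
  then have "v = (\<Sum>n<M. scale ((\<mu> n - \<mu> M) / (h - \<mu> M)) (z n))"
    using assms(4)[of M] by simp
  then show ?case
    by (rule Suc.IH[rotated]) (simp add: height_linear \<open>i \<le> N\<close> Suc.prems mult.commute)
qed simp

text \<open>Lower triangular and diagonal generators never raise the height; \<open>z n\<close>
  collects the part whose height dropped by n.\<close>

lemma low_weights:
  assumes s: "\<And>a. a \<in> {1..N} \<Longrightarrow> s a \<in> {1, -1}" and i: "i \<le> N" and x: "height i x = scale h x"
  shows "low x d y \<Longrightarrow> \<exists>M z. (\<forall>n::nat. height i (z n) = scale (h - of_nat n) (z n)) \<and> (\<forall>n\<ge>M. z n = 0) \<and> y = (\<Sum>n<M. z n)"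
proof (induction rule: low.induct)
  case start
  have "height i (if n = 0 then x else 0) = scale (h - of_nat n) (if n = 0 then x else 0)" for n
    using x i by (simp add: height_linear)
  then show ?case by (intro exI[of _ "Suc 0"] exI[of _ "\<lambda>n. if n = 0 then x else 0"]) auto
next
  case (step d y k j r)
  then obtain M z where z: "\<And>n. height i (z n) = scale (h - of_nat n) (z n)" "\<And>n. n \<ge> M \<Longrightarrow> z n = 0" "y = (\<Sum>n<M. z n)"
    by blast
  \<comment> \<open>The drop is 1 exactly when t_jk crosses the cut downwards.\<close>
  define m :: nat where "m = of_bool (k \<le> i \<and> i < j)"
  have m: "of_bool (j \<le> i) - of_bool (k \<le> i) = - (of_nat m :: complex)"
    using step by (auto simp: m_def)
  define z' where "z' n = (if n < m then 0 else T j k r (z (n - m)))" for n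
  have "height i (z' n) = scale (h - of_nat n) (z' n)" for n
  proof (cases "n < m")
    case True then show ?thesis using i by (simp add: z'_def height_linear)
  next
    case False
    then have n: "h - of_nat n = h - of_nat (n - m) - of_nat m" by (simp add: of_nat_diff)
    have "height i (z' n) = T j k r (height i (z (n - m))) + scale (- of_nat m) (T j k r (z (n - m)))"
      using False height_T[OF s i step(3,4), of r "z (n - m)"] by (simp add: z'_def m)
    also have "\<dots> = scale (h - of_nat (n - m)) (T j k r (z (n - m))) + scale (- of_nat m) (T j k r (z (n - m)))"
      using step(3,4) by (simp only: z(1) T_scale)
    also have "\<dots> = scale (h - of_nat n) (z' n)"
      using False unfolding n by (simp only: z'_def scale_left_distrib[symmetric]) simp
    finally show ?thesis .
  qed
  moreover have "z' n = 0" if "n \<ge> M + m" for n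
    using that z(2) step by (simp add: z'_def T_zero)
  moreover have "T j k r y = (\<Sum>n<M + m. z' n)"
  proof -
    have "(\<Sum>n<M + m. z' n) = (\<Sum>n\<in>{m..<M + m}. z' n)"
      by (rule sum.mono_neutral_right) (auto simp: z'_def)
    also have "\<dots> = (\<Sum>n<M. T j k r (z n))"
      by (rule sum.reindex_bij_witness[of _ "\<lambda>n. n + m" "\<lambda>n. n - m"]) (auto simp: z'_def)
    finally show ?thesis using step by (simp add: z T_sum)
  qed
  ultimately show ?case by blast
next
  case (add d y w)
  then obtain M z M' z' where z: "\<And>n. height i (z n) = scale (h - of_nat n) (z n)" "\<And>n. n \<ge> M \<Longrightarrow> z n = 0" "y = (\<Sum>n<M. z n)"
    "\<And>n. height i (z' n) = scale (h - of_nat n) (z' n)" "\<And>n. n \<ge> M' \<Longrightarrow> z' n = 0" "w = (\<Sum>n<M'. z' n)"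
    by metis
  have "y = (\<Sum>n<max M M'. z n)" "w = (\<Sum>n<max M M'. z' n)"
    unfolding z(3,6) by (rule sum.mono_neutral_left; auto simp: z(2,5) not_less)+
  then show ?case
    using z i by (intro exI[of _ "max M M'"] exI[of _ "\<lambda>n. z n + z' n"]) (auto simp: height_linear scale_right_distrib sum.distrib)
next
  case (scale d y c)
  then obtain M z where z: "\<And>n. height i (z n) = scale (h - of_nat n) (z n)" "\<And>n. n \<ge> M \<Longrightarrow> z n = 0" "y = (\<Sum>n<M. z n)"
    by blast
  then show ?case
    using i by (intro exI[of _ M] exI[of _ "\<lambda>n. scale c (z n)"]) (auto simp: height_linear scale_sum_right mult.commute)
qed blast

text \<open>Homogeneous components arise by splitting a representative in the free algebra according
  to the parity of its words.\<close>

lemma graded_submodule_generated: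
  assumes "x \<in> V a"
  shows "graded_submodule N s scale V act {act y x | y. y \<in> carrier (yangian N s)}" (is "graded_submodule _ _ _ _ _ ?W")
proof -
  have W: "?W = {cact p x | p. p \<in> free}"
    by (auto simp: cact_def yangian_class_hom elim!: yangian_carrierE)
  have "0 \<in> ?W" unfolding W using cact_zero by (auto intro!: exI[of _ 0] simp: free_algebra_def)
  moreover have "v + w \<in> ?W" if "v \<in> ?W" "w \<in> ?W" for v w
    using that unfolding W by (auto simp flip: cact_add intro: free_carrier_ring)
  moreover have "scale c v \<in> ?W" if "v \<in> ?W" for v c
  proof -
    obtain p where "p \<in> free" "v = cact p x" using \<open>v \<in> ?W\<close> unfolding W by blast
    then have "scale c v = cact (free_scalar c * p) x" "free_scalar c * p \<in> free"
      by (simp_all add: cact_mult cact_scalar free_carrier_ring)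
    then show ?thesis unfolding W by blast
  qed
  ultimately have "subspace ?W" by (intro subspaceI)
  moreover have "act y w \<in> ?W" if "y \<in> carrier (yangian N s)" "w \<in> ?W" for y w
  proof -
    obtain p where "p \<in> free" "w = cact p x" using \<open>w \<in> ?W\<close> unfolding W by blast
    moreover obtain q where "q \<in> free" "y = yangian_class N s q"
      using \<open>y \<in> carrier (yangian N s)\<close> by (rule yangian_carrierE)
    ultimately have "act y w = cact (q * p) x" "q * p \<in> free" by (simp_all add: cact_mult cact_def[of q] free_carrier_ring)
    then show ?thesis unfolding W by blast
  qed
  moreover have "\<exists>w0\<in>?W \<inter> V 0. \<exists>w1\<in>?W \<inter> V 1. w = w0 + w1" if "w \<in> ?W" for w
  proof -
    obtain p where p: "p \<in> free" "w = cact p x" using \<open>w \<in> ?W\<close> unfolding W by blast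
    define part where "part b = (\<Sum>u\<in>{u \<in> Poly_Mapping.keys p. word_parity s u = b}. Poly_Mapping.single u (Poly_Mapping.lookup p u))" for b
    have keys: "Poly_Mapping.keys (part b) \<subseteq> {u \<in> Poly_Mapping.keys p. word_parity s u = b}" for b
      unfolding part_def by (rule order.trans[OF keys_sum]) auto
    have free: "part b \<in> free" for b
      using p(1) keys[of b] by (auto simp: free_algebra_def)
    have "p = part 0 + part 1"
    proof -
      have "Poly_Mapping.keys p = {u \<in> Poly_Mapping.keys p. word_parity s u = 0} \<union> {u \<in> Poly_Mapping.keys p. word_parity s u = 1}"
        by auto
      then have "(\<Sum>u\<in>Poly_Mapping.keys p. Poly_Mapping.single u (Poly_Mapping.lookup p u)) = part 0 + part 1"
        unfolding part_def by (subst sum.union_disjoint[symmetric]) auto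
      then show ?thesis by (simp add: poly_mapping_sum_monomials)
    qed
    then have w: "w = cact (part 0) x + cact (part 1) x"
      using p free cact_add by metis
    have part_V: "cact (part b) x \<in> V (b + a)" for b
      unfolding cact_def using assms free keys by (intro act_part) (auto simp: yangian_part_def)
    have part_W: "cact (part b) x \<in> ?W" for b unfolding W using free by blast
    \<comment> \<open>As a + a = 0 in Z/2, the words of parity a send x to \<open>V 0\<close> and
      the others send it to \<open>V 1\<close>.\<close>
    have "cact (part a) x \<in> V 0" "cact (part (a + 1)) x \<in> V 1" "w = cact (part a) x + cact (part (a + 1)) x"
      using part_V[of a] part_V[of "a + 1"] w by (cases "a = 0"; simp add: add.commute)+
    then show ?thesis using part_W by (intro bexI[of _ "cact (part a) x"] bexI[of _ "cact (part (a + 1)) x"]) simp_all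
  qed
  ultimately show ?thesis by (simp add: graded_submodule_def)
qed

text \<open>The submodule generated by a singular vector of smaller weight misses the highest weight vector.\<close>

lemma singular_vector_zero:
  assumes irr: "irreducible_yangian_module N s scale V act"
    and s: "\<And>a. a \<in> {1..N} \<Longrightarrow> s a \<in> {1, -1}" and i: "i \<le> N"
    and v: "height i v = scale h v" "v \<noteq> 0"
    and x: "height i x = scale (h - 1) x" "x \<in> V a"
    and singular: "\<And>j k r. j \<in> {1..N} \<Longrightarrow> k \<in> {1..N} \<Longrightarrow> j < k \<Longrightarrow> T j k r x = 0"
  shows "x = 0"
proof -
  let ?W = "{act y x | y. y \<in> carrier (yangian N s)}"
  have "v \<notin> ?W"
  proof
    assume "v \<in> ?W"
    then obtain d where "low x d v" using low_act[OF singular] by blast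
    then obtain M z where z: "\<And>n. height i (z n) = scale (h - 1 - of_nat n) (z n)" "v = (\<Sum>n<M. z n)"
      using low_weights[OF s i x(1)] by blast
    have "h - 1 - of_nat n \<noteq> h" for n
    proof
      assume "h - 1 - of_nat n = h"
      then have "of_nat (Suc n) = (0::complex)" by (simp add: algebra_simps)
      then show False by (simp only: of_nat_eq_0_iff)
    qed
    then show False using height_eigenvectors_independent[OF i z(1) v(1) _ z(2)] v(2) by blast
  qed
  moreover have "?W = {0} \<or> ?W = UNIV"
    using irr graded_submodule_generated[OF x(2)] by (simp add: irreducible_yangian_module_def)
  ultimately have "?W = {0}" by blast
  moreover have "x \<in> ?W"
    using cact_scalar[of 1 x] yangian_class_hom(1)[of "free_scalar 1" N "free_scalar 1"] free_carrier_ring(4)[of 1]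
    by (auto simp: cact_def intro!: exI[of _ "yangian_class N s (free_scalar 1)"])
  ultimately show ?thesis by blast
qed

end

section \<open>Gauss generators and the switched module\<close>

context yangian_action
begin

interpretation Y: ring "yangian N s" by (rule ring_yangian)

lemma act_one: "act \<one>\<^bsub>yangian N s\<^esub> v = v"
  using cact_scalar[of 1 v] by (simp add: cact_def free_scalar_def flip: yangian_class_one)

lemma act_zero: "act \<zero>\<^bsub>yangian N s\<^esub> v = 0"
  using act_add[of "\<zero>\<^bsub>yangian N s\<^esub>" "\<zero>\<^bsub>yangian N s\<^esub>" v] by simp

lemma act_zero_right: "y \<in> carrier (yangian N s) \<Longrightarrow> act y 0 = 0"
  using act_add_right[of y 0 0] by simp

lemma act_finsum:
  "finite I \<Longrightarrow> (\<And>a. a \<in> I \<Longrightarrow> g a \<in> carrier (yangian N s)) \<Longrightarrow>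
    act (\<Oplus>\<^bsub>yangian N s\<^esub>a\<in>I. g a) v = (\<Sum>a\<in>I. act (g a) v)"
  by (induction I rule: finite_induct) (auto simp: act_zero Y.finsum_insert Pi_def act_add Y.finsum_closed)

lemma act_series_mult:
  assumes "is_series (yangian N s) a" "is_series (yangian N s) c"
  shows "act (series_mult (yangian N s) a c r) v = (\<Sum>p\<le>r. act (a p) (act (c (r - p)) v))"
  using assms unfolding series_mult_def is_series_def
  by (simp add: act_finsum act_mult)

section \<open>Gauss generators on vectors\<close>

abbreviation "d \<equiv> yangian_d N s"
abbreviation "e \<equiv> yangian_e N s"
abbreviation "f \<equiv> yangian_f N s"

lemma gauss_series:
  "i \<in> {1..N} \<Longrightarrow> is_series (yangian N s) (d i)"
  "i \<in> {1..N} \<Longrightarrow> d i 0 = \<one>\<^bsub>yangian N s\<^esub>"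
  "j \<in> {1..N} \<Longrightarrow> i \<in> {1..<j} \<Longrightarrow> is_series (yangian N s) (e i j)"
  "j \<in> {1..N} \<Longrightarrow> i \<in> {1..<j} \<Longrightarrow> is_series (yangian N s) (f j i)"
  "j \<in> {1..N} \<Longrightarrow> i \<in> {1..<j} \<Longrightarrow> f j i 0 = \<zero>\<^bsub>yangian N s\<^esub>"
  using yangian_gauss_decomposition[of N s] unfolding gauss_decomposition_def by blast+

text \<open>Every correction term f_ik d_k e_kj applies e_kj to v first.\<close>

lemma gauss_correction_zero:
  assumes "i \<in> {1..N}" "j \<in> {1..N}" "l \<le> i" "l \<le> j" and e: "\<And>k r. k \<in> {1..<l} \<Longrightarrow> act (e k j r) v = 0"
  shows "act (\<Oplus>\<^bsub>yangian N s\<^esub>k \<in> {1..<l}. series_mult (yangian N s) (f i k) (series_mult (yangian N s) (d k) (e k j)) r) v = 0"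
    and "(\<Oplus>\<^bsub>yangian N s\<^esub>k \<in> {1..<l}. series_mult (yangian N s) (f i k) (series_mult (yangian N s) (d k) (e k j)) r) \<in> carrier (yangian N s)"
proof -
  have ser: "is_series (yangian N s) (d k)" "is_series (yangian N s) (e k j)" "is_series (yangian N s) (f i k)"
    if "k \<in> {1..<l}" for k
    using that assms by (auto intro!: gauss_series)
  have ser2: "is_series (yangian N s) (series_mult (yangian N s) (d k) (e k j))"
    "is_series (yangian N s) (series_mult (yangian N s) (f i k) (series_mult (yangian N s) (d k) (e k j)))"
    if "k \<in> {1..<l}" for k
    using ser[OF that] by (auto intro!: Y.series_mult_closed)
  have "act (series_mult (yangian N s) (f i k) (series_mult (yangian N s) (d k) (e k j)) r) v = 0"
    if k: "k \<in> {1..<l}" for k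
    using ser[OF k] ser2[OF k] e[OF k]
    by (simp add: act_series_mult act_zero_right is_series_def)
  then show "act (\<Oplus>\<^bsub>yangian N s\<^esub>k \<in> {1..<l}. series_mult (yangian N s) (f i k) (series_mult (yangian N s) (d k) (e k j)) r) v = 0"
    using ser2 by (subst act_finsum) (auto simp: is_series_def)
  show "(\<Oplus>\<^bsub>yangian N s\<^esub>k \<in> {1..<l}. series_mult (yangian N s) (f i k) (series_mult (yangian N s) (d k) (e k j)) r) \<in> carrier (yangian N s)"
    using ser2 by (intro Y.finsum_closed) (auto simp: is_series_def)
qed

lemma T_gauss_diag:
  assumes i: "i \<in> {1..N}" and e: "\<And>k r. k \<in> {1..<i} \<Longrightarrow> act (e k i r) v = 0"
  shows "T i i r v = act (d i r) v"
proof -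
  have "yangian_t N s i i r = d i r \<oplus>\<^bsub>yangian N s\<^esub> (\<Oplus>\<^bsub>yangian N s\<^esub>k \<in> {1..<i}.
      series_mult (yangian N s) (f i k) (series_mult (yangian N s) (d k) (e k i)) r)"
    using yangian_gauss_decomposition[of N s] i unfolding gauss_decomposition_def by blast
  then show ?thesis
    using gauss_correction_zero[OF i i order.refl order.refl e] gauss_series(1)[OF i]
    by (simp add: T_def act_add is_series_def)
qed

lemma T_gauss_upper:
  assumes ij: "j \<in> {1..N}" "i \<in> {1..<j}" and e: "\<And>k r. k \<in> {1..<i} \<Longrightarrow> act (e k j r) v = 0"
  shows "T i j r v = (\<Sum>p\<le>r. act (d i p) (act (e i j (r - p)) v))"
proof -
  have i: "i \<in> {1..N}" "i \<le> j" using ij by auto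
  have "yangian_t N s i j r = series_mult (yangian N s) (d i) (e i j) r \<oplus>\<^bsub>yangian N s\<^esub> (\<Oplus>\<^bsub>yangian N s\<^esub>k \<in> {1..<i}.
      series_mult (yangian N s) (f i k) (series_mult (yangian N s) (d k) (e k j)) r)"
    using yangian_gauss_decomposition[of N s] ij unfolding gauss_decomposition_def by blast
  then show ?thesis
    using gauss_correction_zero[OF i(1) ij(1) order.refl i(2) e] gauss_series(1)[OF i(1)] gauss_series(3)[OF ij]
      Y.series_mult_closed[OF gauss_series(1)[OF i(1)] gauss_series(3)[OF ij]]
    by (simp add: T_def act_add act_series_mult) (simp add: is_series_def act_add act_series_mult)
qed

lemma T_gauss_lower:
  assumes ij: "j \<in> {1..N}" "i \<in> {1..<j}" and e: "\<And>k r. k \<in> {1..<i} \<Longrightarrow> act (e k i r) v = 0"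
  shows "T j i r v = (\<Sum>p\<le>r. act (f j i p) (act (d i (r - p)) v))"
proof -
  have i: "i \<in> {1..N}" "i \<le> j" using ij by auto
  have "yangian_t N s j i r = series_mult (yangian N s) (f j i) (d i) r \<oplus>\<^bsub>yangian N s\<^esub> (\<Oplus>\<^bsub>yangian N s\<^esub>k \<in> {1..<i}.
      series_mult (yangian N s) (f j k) (series_mult (yangian N s) (d k) (e k i)) r)"
    using yangian_gauss_decomposition[of N s] ij unfolding gauss_decomposition_def by blast
  then show ?thesis
    using gauss_correction_zero[OF ij(1) i(1) i(2) order.refl e] gauss_series(1)[OF i(1)] gauss_series(4)[OF ij]
      Y.series_mult_closed[OF gauss_series(4)[OF ij] gauss_series(1)[OF i(1)]]
    by (simp add: T_def act_add act_series_mult) (simp add: is_series_def act_add act_series_mult)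
qed

lemma e_zero_imp_T_zero:
  assumes "\<And>j i r. j \<in> {1..N} \<Longrightarrow> i \<in> {1..<j} \<Longrightarrow> act (e i j r) v = 0"
  shows "j \<in> {1..N} \<Longrightarrow> i \<in> {1..<j} \<Longrightarrow> T i j r v = 0"
    and "j \<in> {1..N} \<Longrightarrow> T j j r v = act (d j r) v"
proof -
  assume ij: "j \<in> {1..N}" "i \<in> {1..<j}"
  have "T i j r v = (\<Sum>p\<le>r. act (d i p) (act (e i j (r - p)) v))"
    by (rule T_gauss_upper[OF ij]) (use ij assms in auto)
  also have "\<dots> = 0"
    using gauss_series(1)[of i] ij by (simp add: assms[OF ij] act_zero_right is_series_def)
  finally show "T i j r v = 0" .
next
  assume j: "j \<in> {1..N}"
  then show "T j j r v = act (d j r) v"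
    by (rule T_gauss_diag) (use j assms in auto)
qed

text \<open>Rows are treated in increasing order and degrees within a row: d_i has constant
  coefficient 1, so the leading term of t_ij is e_ij. The bound m is i in \<open>f_eq_F\<close> and
  N + 1 in the final theorem.\<close>

lemma T_zero_imp_e_zero:
  assumes T: "\<And>i j r. i \<in> {1..<m} \<Longrightarrow> i < j \<Longrightarrow> j \<le> N \<Longrightarrow> T i j r v = 0"
  shows "i \<in> {1..<m} \<Longrightarrow> i < j \<Longrightarrow> j \<le> N \<Longrightarrow> act (e i j r) v = 0"
proof (induction i arbitrary: j r rule: less_induct)
  case (less i)
  have ij: "j \<in> {1..N}" "i \<in> {1..<j}" "i \<in> {1..N}" using less.prems by auto
  have sum: "(\<Sum>p\<le>r. act (d i p) (act (e i j (r - p)) v)) = 0" for r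
    using T_gauss_upper[OF ij(1,2), of v r] less T by auto
  show ?case
  proof (induction r rule: less_induct)
    case (less r)
    have "(\<Sum>p\<le>r. act (d i p) (act (e i j (r - p)) v)) = (\<Sum>p\<in>{0}. act (d i p) (act (e i j (r - p)) v))"
      using gauss_series(1)[OF ij(3)]
      by (intro sum.mono_neutral_right) (auto simp: less act_zero_right is_series_def)
    then show ?case using sum[of r] gauss_series(2)[OF ij(3)] by (simp add: act_one)
  qed
qed

text \<open>The class of p acts as the relabelled p did before; relabelling is a ring homomorphism
  and carries word parity for \<open>switch i s\<close> to that for \<open>s\<close>.\<close>

lemma switch_yangian_action:
  assumes i: "i \<in> {1..<N}"
  shows "yangian_module N (switch i s) scale V (switch_action i act)"
proof -
  define \<sigma> where "\<sigma> = transpose i (i + 1)"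
  have \<sigma>: "a \<in> {1..N} \<Longrightarrow> \<sigma> a \<in> {1..N}" for a using i by (auto simp: transpose_def \<sigma>_def)
  have free: "free_relabel \<sigma> p \<in> free" if "p \<in> free" for p
    by (rule relabel_carrier[OF \<sigma> that])
  have sw: "switch_action i act (yangian_class N (switch i s) p) = cact (free_relabel \<sigma> p)" for p
    by (simp add: switch_action_def switch_iso_class[OF i] cact_def \<sigma>_def)
  show ?thesis
    unfolding yangian_module_def
  proof (intro conjI allI ballI)
    show "vector_space scale" by (rule vector_space_axioms)
    show "subspace (V a)" for a by (rule V_subspace)
    show "\<exists>!(v0, v1). v0 \<in> V 0 \<and> v1 \<in> V 1 \<and> v = v0 + v1" for v
      using yangian_module unfolding yangian_module_def by blast
    show "switch_action i act y (v + w) = switch_action i act y v + switch_action i act y w"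
      if "y \<in> carrier (yangian N (switch i s))" for y v w
      using that by (elim yangian_carrierE) (simp add: sw cact_add_right free)
    show "switch_action i act (x \<oplus>\<^bsub>yangian N (switch i s)\<^esub> y) v = switch_action i act x v + switch_action i act y v"
      "switch_action i act (x \<otimes>\<^bsub>yangian N (switch i s)\<^esub> y) v = switch_action i act x (switch_action i act y v)"
      if xy: "x \<in> carrier (yangian N (switch i s))" "y \<in> carrier (yangian N (switch i s))" for x y v
    proof -
      obtain p q where p: "p \<in> free" "x = yangian_class N (switch i s) p" and q: "q \<in> free" "y = yangian_class N (switch i s) q"
        using xy by (meson yangian_carrierE)
      show "switch_action i act (x \<oplus>\<^bsub>yangian N (switch i s)\<^esub> y) v = switch_action i act x v + switch_action i act y v"
        using yangian_class_hom(2)[OF p(1) q(1), of "switch i s", symmetric] free p q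
        by (simp add: sw relabel_add cact_add)
      show "switch_action i act (x \<otimes>\<^bsub>yangian N (switch i s)\<^esub> y) v = switch_action i act x (switch_action i act y v)"
        using yangian_class_hom(3)[OF p(1) q(1), of "switch i s", symmetric] free p q
        by (simp add: sw relabel_mult cact_mult)
    qed
    show "switch_action i act (yangian_scalar N (switch i s) c) v = scale c v" for c v
      by (simp add: yangian_scalar_def sw relabel_scalar cact_scalar)
    show "switch_action i act y v \<in> V (a + a')" if y: "y \<in> yangian_part N (switch i s) a" and v: "v \<in> V a'" for a a' y v
    proof -
      obtain p where p: "p \<in> free" "y = yangian_class N (switch i s) p"
        "\<And>w. w \<in> Poly_Mapping.keys p \<Longrightarrow> word_parity (switch i s) w = a"
        using y by (auto simp: yangian_part_def)
      have parity: "word_parity s (relabel_word \<sigma> w) = word_parity (switch i s) w" for w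
        by (induction w) (auto simp: word_parity_def parity_def switch_def \<sigma>_def)
      have "Poly_Mapping.keys (free_relabel \<sigma> p) \<subseteq> (\<Union>w\<in>Poly_Mapping.keys p. {relabel_word \<sigma> w})"
        unfolding free_relabel_def by (rule order.trans[OF keys_sum]) (auto split: if_splits)
      then have "\<forall>w\<in>Poly_Mapping.keys (free_relabel \<sigma> p). word_parity s w = a"
        using p(3) parity by fastforce
      then have "yangian_class N s (free_relabel \<sigma> p) \<in> yangian_part N s a"
        using free[OF p(1)] by (auto simp: yangian_part_def)
      from act_part[OF this v] show ?thesis by (simp add: p(2) sw cact_def)
    qed
  qed
qed

end

section \<open>The odd reflection\<close>

text \<open>
  \<open>K\<close> consists of the vectors on which the diagonal and upper triangular series other than the
  \<open>t\<^sub>a\<^sub>b\<close> with \<open>a, b \<in> {i, i + 1}\<close> act as they do on the highest weight vector, where \<open>c\<close> lists the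
  eigenvalues.
\<close>

locale adjacent_yangian_action = yangian_action N s scale V act
  for N s and scale :: "complex \<Rightarrow> 'v::ab_group_add \<Rightarrow> 'v" and V act +
  fixes i :: nat
  assumes i: "i \<in> {1..<N}" and signs: "\<And>a. a \<in> {1..N} \<Longrightarrow> s a \<in> {1, -1}" and opposite: "s i \<noteq> s (i + 1)"
begin

lemma i_range: "i \<in> {1..N}" "i + 1 \<in> {1..N}"
  using i by auto

section \<open>The block of the indices i and i + 1\<close>

definition T_series :: "nat \<Rightarrow> nat \<Rightarrow> 'v endo fps" where
  "T_series a c = Abs_fps (\<lambda>r. Endo (T a c r))"

lemma app_T_series:
  "a \<in> {1..N} \<Longrightarrow> c \<in> {1..N} \<Longrightarrow> app (T_series a c $ r) x = T a c r x"
  by (simp add: T_series_def Endo_inverse T_add)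

lemma signs_cases: "(s i = 1 \<and> s (i + 1) = -1) \<or> (s i = -1 \<and> s (i + 1) = 1)"
  using signs[OF i_range(1)] signs[OF i_range(2)] opposite by auto

lemma sign_values:
  "swap_sign s i (i + 1) i i = 1" "swap_sign s i (i + 1) (i + 1) i = -1" "swap_sign s (i + 1) i (i + 1) i = -1"
  "relation_sign s i i k = of_int (s i)" "relation_sign s i (i + 1) i = of_int (s i)"
  "relation_sign s i (i + 1) (i + 1) = - of_int (s i)"
  using signs_cases by (auto simp: swap_sign_def relation_sign_def parity_def koszul_sign_def)

lemma twist_eq: "twist (s i = 1) x = scale (of_int (s i)) x"
  using signs_cases by (auto simp: twist_def)

sublocale odd_gl2_module "s i = 1" "T_series i i" "T_series i (i + 1)" "T_series (i + 1) i" "T_series (i + 1) (i + 1)" scale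
proof
  note app = app_T_series[OF i_range(1) i_range(1)] app_T_series[OF i_range(1) i_range(2)]
    app_T_series[OF i_range(2) i_range(1)] app_T_series[OF i_range(2) i_range(2)]
  show "T_series i i $ 0 = 1" "T_series i (i + 1) $ 0 = 0" "T_series (i + 1) i $ 0 = 0" "T_series (i + 1) (i + 1) $ 0 = 1"
    by (rule endo_eqI, simp only: app app_simps T_0, simp)+
  fix p q :: nat
  show "T_series i i $ Suc p * T_series i i $ q - T_series i i $ q * T_series i i $ Suc p -
    (T_series i i $ p * T_series i i $ Suc q - T_series i i $ Suc q * T_series i i $ p)
    = twist (s i = 1) (T_series i i $ p * T_series i i $ q - T_series i i $ q * T_series i i $ p)"
    using T_relation[OF i_range(1) i_range(1) i_range(1) i_range(1), of p q]
    by (intro endo_eqI) (simp only: app app_simps app_twist twist_eq supercomm_def swap_sign_diag sign_values, simp add: algebra_simps)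
  show "T_series i i $ Suc p * T_series (i + 1) i $ q - T_series (i + 1) i $ q * T_series i i $ Suc p -
    (T_series i i $ p * T_series (i + 1) i $ Suc q - T_series (i + 1) i $ Suc q * T_series i i $ p)
    = twist (s i = 1) (T_series (i + 1) i $ p * T_series i i $ q - T_series (i + 1) i $ q * T_series i i $ p)"
    using T_relation[OF i_range(1) i_range(1) i_range(2) i_range(1), of p q]
    by (intro endo_eqI) (simp only: app app_simps app_twist twist_eq supercomm_def swap_sign_diag sign_values, simp add: algebra_simps)
  show "T_series i i $ Suc p * T_series i (i + 1) $ q - T_series i (i + 1) $ q * T_series i i $ Suc p -
    (T_series i i $ p * T_series i (i + 1) $ Suc q - T_series i (i + 1) $ Suc q * T_series i i $ p)
    = twist (s i = 1) (T_series i i $ p * T_series i (i + 1) $ q - T_series i i $ q * T_series i (i + 1) $ p)"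
    using T_relation[OF i_range(1) i_range(1) i_range(1) i_range(2), of p q]
    by (intro endo_eqI) (simp only: app app_simps app_twist twist_eq supercomm_def swap_sign_diag sign_values, simp add: algebra_simps)
  show "T_series i (i + 1) $ Suc p * T_series i i $ q - T_series i i $ q * T_series i (i + 1) $ Suc p -
    (T_series i (i + 1) $ p * T_series i i $ Suc q - T_series i i $ Suc q * T_series i (i + 1) $ p)
    = twist (s i = 1) (T_series i (i + 1) $ p * T_series i i $ q - T_series i (i + 1) $ q * T_series i i $ p)"
    using T_relation[OF i_range(1) i_range(2) i_range(1) i_range(1), of p q]
    by (intro endo_eqI) (simp only: app app_simps app_twist twist_eq supercomm_def sign_values, simp add: algebra_simps)
  show "T_series i i $ Suc p * T_series (i + 1) (i + 1) $ q - T_series (i + 1) (i + 1) $ q * T_series i i $ Suc p -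
    (T_series i i $ p * T_series (i + 1) (i + 1) $ Suc q - T_series (i + 1) (i + 1) $ Suc q * T_series i i $ p)
    = twist (s i = 1) (T_series (i + 1) i $ p * T_series i (i + 1) $ q - T_series (i + 1) i $ q * T_series i (i + 1) $ p)"
    using T_relation[OF i_range(1) i_range(1) i_range(2) i_range(2), of p q]
    by (intro endo_eqI) (simp only: app app_simps app_twist twist_eq supercomm_def swap_sign_diag sign_values, simp add: algebra_simps)
  show "T_series i (i + 1) $ Suc p * T_series (i + 1) i $ q + T_series (i + 1) i $ q * T_series i (i + 1) $ Suc p -
    (T_series i (i + 1) $ p * T_series (i + 1) i $ Suc q + T_series (i + 1) i $ Suc q * T_series i (i + 1) $ p)
    = - twist (s i = 1) (T_series (i + 1) (i + 1) $ p * T_series i i $ q - T_series (i + 1) (i + 1) $ q * T_series i i $ p)"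
    using T_relation[OF i_range(1) i_range(2) i_range(2) i_range(1), of p q]
    by (intro endo_eqI) (simp only: app app_simps app_twist twist_eq supercomm_def sign_values, simp add: algebra_simps)
  show torsion_free: "x = 0" if "x + x = 0" for x :: "'v endo"
  proof (rule endo_eqI)
    fix v
    have "app x v + app x v = 0" using arg_cong[OF that, of "\<lambda>x. app x v"] by simp
    then have "scale 2 (app x v) = 0" using scale_left_distrib[of 1 1 "app x v"] by (simp del: scale_eq_0_iff)
    then show "app x v = app 0 v" by simp
  qed
  show "T_series (i + 1) i $ 1 * T_series (i + 1) i $ 1 = 0"
  proof (rule torsion_free, rule endo_eqI)
    fix v
    \<comment> \<open>At p = 0 the right-hand side contains t_(i+1,i)^(0) = 0; for an odd generator
      the supercommutator with itself is twice the square.\<close>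
    have "supercomm (i + 1) i 1 (i + 1) i 1 v = 0"
      using T_relation[OF i_range(2,1,2,1), of 0 1 v] i_range by (simp add: supercomm_0 T_0 T_zero)
    then show "app (T_series (i + 1) i $ 1 * T_series (i + 1) i $ 1 + T_series (i + 1) i $ 1 * T_series (i + 1) i $ 1) v = app 0 v"
      by (simp only: app app_simps supercomm_def sign_values) simp
  qed
  show "T_series i i $ p \<in> endo_module.linear_endos scale" "T_series i (i + 1) $ p \<in> endo_module.linear_endos scale"
    "T_series (i + 1) i $ p \<in> endo_module.linear_endos scale" "T_series (i + 1) (i + 1) $ p \<in> endo_module.linear_endos scale"
    by (simp_all only: endo_module.linear_endos_def[OF endo_module.intro[OF vector_space_axioms]] mem_Collect_eq app T_scale i_range) auto
qed

section \<open>Stability of K, parity and height\<close>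

definition K :: "(nat \<Rightarrow> nat \<Rightarrow> complex) \<Rightarrow> 'v set" where
  "K c = {x. (\<forall>j k r. j \<in> {1..N} \<and> k \<in> {1..N} \<and> j < k \<and> (j, k) \<noteq> (i, i + 1) \<longrightarrow> T j k r x = 0) \<and>
    (\<forall>j\<in>{1..N} - {i, i + 1}. \<forall>r. T j j r x = scale (c j r) x)}"

lemma K_linear: "x \<in> K c \<Longrightarrow> y \<in> K c \<Longrightarrow> x + y \<in> K c" "x \<in> K c \<Longrightarrow> scale a x \<in> K c" "0 \<in> K c"
  by (auto simp: K_def T_add T_scale T_zero scale_right_distrib mult.commute)

text \<open>The relation of t_jk with t_aa' ends in t_ja' or, in the opposite order, in t_ak. For j
  < i the former and for k > i + 1 the latter is strictly upper and outside the block, so it kills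
  x. Every generator in the definition of \<open>K\<close> satisfies one of these
  conditions.\<close>

lemma K_T:
  assumes x: "x \<in> K c" and ab: "a \<in> {i, i + 1}" "a' \<in> {i, i + 1}"
  shows "T a a' q x \<in> K c"
proof -
  have kill: "T j k r x = 0" if "j \<in> {1..N}" "k \<in> {1..N}" "j < k" "(j, k) \<noteq> (i, i + 1)" for j k r
    using x that unfolding K_def by blast
  have diag: "T j j r x = scale (c j r) x" if "j \<in> {1..N} - {i, i + 1}" for j r
    using x that unfolding K_def by blast
  have a: "a \<in> {1..N}" "a' \<in> {1..N}" using ab i_range by auto
  have left: "T j k p (T a a' q x) = scale (swap_sign s j k a a') (T a a' q (T j k p x))"
    if "j \<in> {1..N}" "k \<in> {1..N}" "j < i" for j k p
    using supercommute[OF that(1,2) a, of x p q] kill[of j a'] that ab a by (auto simp: supercomm_def)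
  have right: "scale (swap_sign s a a' j k) (T j k p (T a a' q x)) = T a a' q (T j k p x)"
    if "j \<in> {1..N}" "k \<in> {1..N}" "k > i + 1" for j k p
    using supercommute[OF a that(1,2), of x q p] kill[of a k] that ab a by (auto simp: supercomm_def)
  have "T j k r (T a a' q x) = 0" if jk: "j \<in> {1..N}" "k \<in> {1..N}" "j < k" "(j, k) \<noteq> (i, i + 1)" for j k r
  proof (cases "j < i")
    case True
    then show ?thesis using left[of j k r] jk kill[OF jk] by (simp add: T_zero[OF a])
  next
    case False
    then have "k > i + 1" using jk by auto
    then have "scale (swap_sign s a a' j k) (T j k r (T a a' q x)) = 0"
      using right[of j k r] jk kill[OF jk] by (simp add: T_zero[OF a])
    then show ?thesis by (simp add: swap_sign_nonzero)
  qed
  moreover have "T j j r (T a a' q x) = scale (c j r) (T a a' q x)" if j: "j \<in> {1..N} - {i, i + 1}" for j r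
  proof -
    have "swap_sign s a a' j j = 1" by (simp add: swap_sign_def koszul_sign_def)
    then have "T j j r (T a a' q x) = T a a' q (T j j r x)"
      using left[of j j r] right[of j j r] j by (cases "j < i") (auto simp: swap_sign_diag)
    then show ?thesis using diag[OF j] by (simp add: T_scale[OF a])
  qed
  ultimately show ?thesis unfolding K_def by blast
qed

lemma subring_K: "subring_set {g. \<forall>x\<in>K c. app g x \<in> K c}"
proof -
  have "- x \<in> K c" if "x \<in> K c" for x using K_linear(2)[OF that, of "-1"] by simp
  then show ?thesis by (simp add: subring_set_def K_linear)
qed

lemma subring_V: "subring_set {g. \<forall>a. \<forall>x\<in>V a. app g x \<in> V a}"
  using V_subspace by (simp add: subring_set_def subspace_0 subspace_add subspace_neg)

lemma subring_height: "subring_set {g. \<forall>x. height i (app g x) = app g (height i x)}"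
proof -
  have "i \<le> N" using i by simp
  moreover have "height i (- x) = - height i x" for x
    using height_linear(2)[of i "-1" x] \<open>i \<le> N\<close> by simp
  ultimately show ?thesis by (simp add: subring_set_def height_linear)
qed

lemma F_K: "x \<in> K c \<Longrightarrow> app (F $ n) x \<in> K c"
proof -
  have T: "T_series a a' $ r \<in> {g. \<forall>x\<in>K c. app g x \<in> K c}" if "a \<in> {i, i + 1}" "a' \<in> {i, i + 1}" for a a' r
    using that i_range by (auto simp: app_T_series intro!: K_T)
  have "A' $ r \<in> {g. \<forall>x\<in>K c. app g x \<in> K c}" for r
    unfolding A'_def using subring_set_unit_inverse[OF subring_K T] by blast
  then have "F $ n \<in> {g. \<forall>x\<in>K c. app g x \<in> K c}"
    unfolding F_def using subring_set_mult[OF subring_K T] by blast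
  then show "x \<in> K c \<Longrightarrow> app (F $ n) x \<in> K c" by blast
qed

lemma F_V: "x \<in> V a \<Longrightarrow> app (F $ n) x \<in> V (1 + a)"
proof -
  assume x: "x \<in> V a"
  have "T i i r y \<in> V a" if "y \<in> V a" for r y a
    using T_V[OF i_range(1) i_range(1) that] by (simp only: bit_add_self add_0)
  then have "T_series i i $ r \<in> {g. \<forall>a. \<forall>x\<in>V a. app g x \<in> V a}" for r
    by (auto simp: app_T_series[OF i_range(1) i_range(1)])
  then have A': "app (A' $ r) x \<in> V a" for r
    unfolding A'_def using subring_set_unit_inverse[OF subring_V] x by blast
  have "parity s (i + 1) + parity s i = 1" using signs_cases by (auto simp: parity_def)
  then have "T (i + 1) i r y \<in> V (1 + a)" if "y \<in> V a" for y r
    using T_V[OF i_range(2,1) that] by metis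
  then have F: "app (F $ n) x = (\<Sum>j=0..n. T (i + 1) i j (app (A' $ (n - j)) x))" and V: "\<And>j. T (i + 1) i j (app (A' $ (n - j)) x) \<in> V (1 + a)"
    using A' i_range unfolding F_def by (simp_all add: fps_mult_nth app_sum app_T_series)
  show ?thesis unfolding F by (intro subspace_sum[OF V_subspace] V)
qed

text \<open>In F = C A' the factor A' preserves the height and C lowers it by one.\<close>

lemma F_height: "height i (app (F $ n) x) = app (F $ n) (height i x) - app (F $ n) x"
proof -
  have N: "i \<le> N" using i by simp
  have sum: "height i (sum g I) = (\<Sum>a\<in>I. height i (g a))" for g :: "nat \<Rightarrow> 'v" and I
    by (induction I rule: infinite_finite_induct) (simp_all add: height_linear N)
  have "T_series i i $ r \<in> {g. \<forall>x. height i (app g x) = app g (height i x)}" for r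
    using height_T[OF signs N i_range(1) i_range(1)] by (auto simp: app_T_series[OF i_range(1) i_range(1)])
  then have A': "height i (app (A' $ r) x) = app (A' $ r) (height i x)" for r
    unfolding A'_def using subring_set_unit_inverse[OF subring_height] by blast
  have "height i (T (i + 1) i r y) = T (i + 1) i r (height i y) - T (i + 1) i r y" for r y
    using height_T[OF signs N i_range(2) i_range(1)] by simp
  then have "height i (app (T_series (i + 1) i $ r) y) = app (T_series (i + 1) i $ r) (height i y) - app (T_series (i + 1) i $ r) y" for r y
    by (simp only: app_T_series i_range)
  then show ?thesis
    unfolding F_def fps_mult_nth by (simp only: app_sum app_simps sum A' sum_subtractf)
qed

text \<open>On \<open>K c\<close> the Gauss formulas for t_ii and t_(i+1,i) have no corrections, so
  f_i and F solve the same triangular system f A = C; the induction ranges over all x because T_ii x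
  enters.\<close>

lemma f_eq_F: "x \<in> K c \<Longrightarrow> act (f (i + 1) i r) x = app (F $ r) x"
proof (induction r arbitrary: x rule: less_induct)
  case (less r)
  have kill: "T j k r x = 0" if "j \<in> {1..N}" "k \<in> {1..N}" "j < k" "(j, k) \<noteq> (i, i + 1)" for j k r
    using less.prems that unfolding K_def by blast
  have e: "act (e k j q) x = 0" if "k \<in> {1..<i}" "k < j" "j \<le> N" for k j q
    by (rule T_zero_imp_e_zero[of i]) (use kill that i in auto)
  have di: "act (d i q) x = T i i q x" for q
    by (rule T_gauss_diag[OF i_range(1), symmetric]) (use e i in auto)
  have f0: "act (f (i + 1) i 0) y = 0" for y
    using gauss_series(5)[of "i + 1" i] i_range i act_zero by auto
  have T_K: "T i i q x \<in> K c" for q using less.prems by (rule K_T) auto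
  have "T (i + 1) i r x = (\<Sum>p\<le>r. act (f (i + 1) i p) (T i i (r - p) x))"
    unfolding di[symmetric] by (rule T_gauss_lower) (use e i in auto)
  also have "\<dots> = (\<Sum>p<r. app (F $ p) (T i i (r - p) x)) + act (f (i + 1) i r) x"
    using less.IH T_K by (simp add: T_0 flip: lessThan_Suc_atMost)
  finally have f: "T (i + 1) i r x = (\<Sum>p<r. app (F $ p) (T i i (r - p) x)) + act (f (i + 1) i r) x" .
  have "app (T_series (i + 1) i $ r) x = app ((F * T_series i i) $ r) x"
    by (simp only: FA)
  also have "\<dots> = (\<Sum>p<r. app (F $ p) (T i i (r - p) x)) + app (F $ r) x"
    unfolding fps_mult_nth atLeast0AtMost
    by (simp add: app_sum app_T_series i_range[simplified] T_0 flip: lessThan_Suc_atMost)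
  finally show ?case using f by (simp only: app_T_series i_range add_left_cancel)
qed

lemma foldr_f_eq_F:
  "x \<in> K c \<Longrightarrow> foldr (\<lambda>r. act (f (i + 1) i r)) rs x = foldr (\<lambda>r. app (F $ r)) rs x \<and> foldr (\<lambda>r. app (F $ r)) rs x \<in> K c"
proof (induction rs)
  case (Cons r rs)
  then have "foldr (\<lambda>r. act (f (i + 1) i r)) rs x = foldr (\<lambda>r. app (F $ r)) rs x"
    and "foldr (\<lambda>r. app (F $ r)) rs x \<in> K c" by blast+
  then show ?case by (simp only: foldr.simps o_apply f_eq_F F_K simp_thms)
qed simp

lemma foldr_F_V: "x \<in> V a \<Longrightarrow> \<exists>a'. foldr (\<lambda>r. app (F $ r)) rs x \<in> V a'"
proof (induction rs)
  case (Cons r rs)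
  then obtain a' where "foldr (\<lambda>r. app (F $ r)) rs x \<in> V a'" by blast
  from F_V[OF this] show ?case by (simp only: foldr.simps o_apply) blast
qed auto

end

section \<open>The highest weight after the switch\<close>

lemma fls_eval_shift: "fls_eval (pcompose p [:- c, 1:]) z = fls_eval p (z - fls_const c)"
  by (simp add: fls_eval_pcompose)

theorem theorem4p6:
  fixes m n i k :: nat
    and s :: "nat \<Rightarrow> int"
    and scale :: "complex \<Rightarrow> 'v::ab_group_add \<Rightarrow> 'v"
    and V :: "bit \<Rightarrow> 'v set"
    and act :: "yangian_elt \<Rightarrow> 'v \<Rightarrow> 'v"
    and \<zeta> :: "nat \<Rightarrow> complex fls"
    and v :: 'v
    and \<phi> \<psi> :: "complex poly"
  assumes "parity_sequence m n s"
    and "i \<in> {1..<m + n}"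
    and "s i \<noteq> s (i + 1)"
    and "irreducible_highest_module (m + n) s scale V act \<zeta> v"
    and "\<zeta> i / \<zeta> (i + 1) = poly_at_infinity \<phi> / poly_at_infinity \<psi>"
    and "coprime \<phi> \<psi>"
    and "lead_coeff \<phi> = 1" and "degree \<phi> = k"
    and "lead_coeff \<psi> = 1" and "degree \<psi> = k"
  shows "highest_ell_weight_vector (m + n) (switch i s) scale V (switch_action i act)
    (\<zeta>(i := \<zeta> (i + 1)
            * (poly_at_infinity (pcompose \<psi> [:- of_int (s i), 1:]) / poly_at_infinity \<psi>),
       i + 1 := \<zeta> i
            * (poly_at_infinity (pcompose \<phi> [:- of_int (s i), 1:]) / poly_at_infinity \<phi>)))
    (foldr (\<lambda>r. act (yangian_f (m + n) s (i + 1) i r)) [1..<k + 1] v)"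
proof -
  define N where "N = m + n"
  have highest: "irreducible_yangian_module N s scale V act" "highest_ell_weight_vector N s scale V act \<zeta> v"
    using assms(4) by (simp_all add: irreducible_highest_module_def N_def)
  interpret adjacent_yangian_action N s scale V act i
  proof
    show "yangian_module N s scale V act"
      using highest(1) by (simp add: irreducible_yangian_module_def)
    show "s a \<in> {1, -1}" if "a \<in> {1..N}" for a
      using assms(1) that by (auto simp: parity_sequence_def N_def)
  qed (use assms(2,3) in \<open>simp_all add: N_def\<close>)
  interpret S: yangian_action N "switch i s" scale V "switch_action i act"
    by (rule yangian_action.intro) (rule switch_yangian_action[OF i])
  have v: "v \<noteq> 0" "\<And>j i r. j \<in> {1..N} \<Longrightarrow> i \<in> {1..<j} \<Longrightarrow> act (e i j r) v = 0"
    "\<And>j r. j \<in> {1..N} \<Longrightarrow> act (d j r) v = scale (\<zeta> j $$ int r) v" "ell_weight N \<zeta>"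
    using highest(2) unfolding highest_ell_weight_vector_def by blast+
  obtain a where a: "v \<in> V a" using highest(2) unfolding highest_ell_weight_vector_def by blast
  have Tv: "T j l r v = 0" if "j \<in> {1..N}" "l \<in> {1..N}" "j < l" for j l r
    using e_zero_imp_T_zero(1)[OF v(2), of l j r] that by auto
  have Tv_diag: "T j j r v = scale (\<zeta> j $$ int r) v" if "j \<in> {1..N}" for j r
    using e_zero_imp_T_zero(2)[OF v(2), of j r] v(3) that by auto
  define c where "c j r = \<zeta> j $$ int r" for j r
  have vK: "v \<in> K c" using Tv Tv_diag by (auto simp: K_def c_def)
  obtain \<alpha> where \<alpha>: "\<zeta> i = fps_to_fls \<alpha>" "\<alpha> $ 0 = 1" using v(4) i_range unfolding ell_weight_def by blast
  obtain \<delta> where \<delta>: "\<zeta> (i + 1) = fps_to_fls \<delta>" "\<delta> $ 0 = 1" using v(4) i_range unfolding ell_weight_def by blast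
  have phi_psi: "\<phi> \<noteq> 0" "\<psi> \<noteq> 0" using assms(7,9) by auto
  then have nonzero: "fls_eval \<phi> fls_X_inv \<noteq> 0" "fls_eval \<psi> fls_X_inv \<noteq> 0"
    by (simp_all add: fls_eval_X_inv_eq_0_iff)
  have "\<delta> \<noteq> 0" using \<delta>(2) by auto
  then have rational: "fps_to_fls \<alpha> * fls_eval \<psi> fls_X_inv = fps_to_fls \<delta> * fls_eval \<phi> fls_X_inv"
    using assms(5) nonzero unfolding \<alpha> \<delta> poly_at_infinity_eq by (simp add: frac_eq_eq mult_ac)
  have iN: "i \<le> N" using i by simp
  define h where "h = (\<Sum>a\<in>{1..i}. of_int (s a) * c a 1)"
  have height_v: "height i v = scale h v"
    using iN by (simp add: height_def h_def Tv_diag c_def scale_sum_left)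
  \<comment> \<open>F_q v lies in \<open>K c\<close> and has height h - 1; if B kills it as well, it
    is singular and \<open>singular_vector_zero\<close> applies.\<close>
  have irreducible: "poly_act F q v = 0"
    if B: "\<And>r. app (T_series i (i + 1) $ r) (poly_act F q v) = 0" for q
  proof (rule singular_vector_zero[OF highest(1) signs iN height_v v(1)])
    have K: "scale a' (app (F $ r) v) \<in> K c" for a' r using F_K[OF vK] K_linear by blast
    have "subspace (K c)" by (intro subspaceI K_linear)
    then have x_K: "poly_act F q v \<in> K c"
      unfolding poly_act_def by (rule subspace_sum) (rule K)
    show "poly_act F q v \<in> V (1 + a)"
      unfolding poly_act_def
      by (intro subspace_sum[OF V_subspace] subspace_scale[OF V_subspace] F_V a)
    have sum: "height i (sum g I) = (\<Sum>a\<in>I. height i (g a))" for g :: "nat \<Rightarrow> 'v" and I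
      by (induction I rule: infinite_finite_induct) (simp_all add: height_linear iN)
    have "height i (app (F $ r) v) = scale (h - 1) (app (F $ r) v)" for r
      by (simp only: F_height height_v scale_simps scale_left_diff_distrib scale_one)
    then show "height i (poly_act F q v) = scale (h - 1) (poly_act F q v)"
      unfolding poly_act_def by (simp add: sum height_linear iN scale_sum_right mult.commute)
    show "T j l r (poly_act F q v) = 0" if "j \<in> {1..N}" "l \<in> {1..N}" "j < l" for j l r
    proof (cases "(j, l) = (i, i + 1)")
      case True
      then show ?thesis using B[of r] i_range by (simp only: app_T_series prod.inject)
    next
      case False
      then show ?thesis using x_K that unfolding K_def by blast
    qed
  qed
  define w where "w = F_product k v"
  have w_eq: "foldr (\<lambda>r. act (yangian_f (m + n) s (i + 1) i r)) [1..<k + 1] v = w"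
    using foldr_f_eq_F[OF vK] by (simp only: w_def F_product_def flip: N_def)
  have wK: "w \<in> K c" using foldr_f_eq_F[OF vK] by (simp only: w_def F_product_def)
  obtain a' where wV: "w \<in> V a'" using foldr_F_V[OF a] unfolding w_def F_product_def by blast
  have z: "\<sigma> = of_int (s i)" using signs_cases by auto
  have A_v: "app (T_series i i $ r) v = scale (\<alpha> $ r) v" for r
    using Tv_diag[OF i_range(1), of r] by (simp only: app_T_series i_range \<alpha> fps_to_fls_nth nat_int of_nat_less_0_iff if_False)
  have D_v: "app (T_series (i + 1) (i + 1) $ r) v = scale (\<delta> $ r) v" for r
    using Tv_diag[OF i_range(2), of r] by (simp only: app_T_series i_range \<delta> fps_to_fls_nth nat_int of_nat_less_0_iff if_False)
  have B_v: "app (T_series i (i + 1) $ r) v = 0" for r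
    using Tv[OF i_range(1) i_range(2), of r] by (simp only: app_T_series i_range)
  note reflection = odd_reflection[OF A_v D_v B_v v(1) \<alpha>(2) \<delta>(2) rational assms(6,7,8) irreducible, folded w_def]
  have w0: "w \<noteq> 0" and C_w: "\<And>r. T (i + 1) i r w = 0"
    using reflection(1,2) by (simp_all only: app_T_series i_range not_False_eq_True)
  obtain \<nu> \<mu> where A_w: "\<And>r. T i i r w = scale (\<nu> $ r) w" and D_w: "\<And>r. T (i + 1) (i + 1) r w = scale (\<mu> $ r) w"
    and \<nu>: "fps_to_fls \<nu> * fls_eval \<phi> fls_X_inv = fps_to_fls \<alpha> * fls_eval \<phi> (fls_X_inv - fls_const (of_int (s i)))"
    and \<mu>: "fps_to_fls \<mu> * fls_eval \<phi> (fls_X_inv - fls_const (of_int (s i))) = fps_to_fls \<nu> * fls_eval \<psi> (fls_X_inv - fls_const (of_int (s i)))"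
    using reflection(3) unfolding z by (auto simp only: app_T_series i_range)
  \<comment> \<open>t_aa^(0) = 1 fixes the constant coefficients; hence \<nu> \<noteq> 0, which
    makes \<open>\<phi>z\<close> nonzero.\<close>
  have "scale (\<nu> $ 0) w = scale 1 w" "scale (\<mu> $ 0) w = scale 1 w"
    using A_w[of 0] D_w[of 0] by (simp_all add: T_0)
  then have \<nu>0: "\<nu> $ 0 = 1" "\<mu> $ 0 = 1" using w0 by (simp_all only: scale_cancel_right) simp_all
  define \<phi>z \<psi>z where "\<phi>z = fls_eval \<phi> (fls_X_inv - fls_const (of_int (s i)))"
    and "\<psi>z = fls_eval \<psi> (fls_X_inv - fls_const (of_int (s i)))"
  have "fps_to_fls \<nu> \<noteq> 0" using \<nu>0(1) by auto
  then have \<phi>z: "\<phi>z \<noteq> 0" using \<nu> nonzero unfolding \<phi>z_def by auto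
  have \<nu>_eq: "fps_to_fls \<nu> = \<zeta> i * (\<phi>z / fls_eval \<phi> fls_X_inv)"
    using \<nu> nonzero by (simp add: \<alpha> \<phi>z_def field_simps)
  \<comment> \<open>Eliminates \<nu> and \<alpha> by means of \<open>\<nu>\<close> and
    \<open>rational\<close>, then cancels \<open>\<phi>z\<close> and \<phi>.\<close>
  have "fps_to_fls \<mu> * \<phi>z = fps_to_fls \<nu> * \<psi>z"
    unfolding \<phi>z_def \<psi>z_def by (rule \<mu>)
  then have "fps_to_fls \<mu> * \<phi>z * (fls_eval \<phi> fls_X_inv * fls_eval \<psi> fls_X_inv)
    = (fps_to_fls \<nu> * fls_eval \<phi> fls_X_inv) * fls_eval \<psi> fls_X_inv * \<psi>z"
    by (simp only: mult_ac)
  also have "\<dots> = (fps_to_fls \<alpha> * fls_eval \<psi> fls_X_inv) * \<phi>z * \<psi>z"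
    unfolding \<nu> \<phi>z_def by (simp only: mult_ac)
  also have "\<dots> = (fps_to_fls \<delta> * \<psi>z) * (\<phi>z * fls_eval \<phi> fls_X_inv)"
    unfolding rational by (simp only: mult_ac)
  finally have "(fps_to_fls \<mu> * fls_eval \<psi> fls_X_inv) * (\<phi>z * fls_eval \<phi> fls_X_inv) = (fps_to_fls \<delta> * \<psi>z) * (\<phi>z * fls_eval \<phi> fls_X_inv)"
    by (simp only: mult_ac)
  moreover have "\<phi>z * fls_eval \<phi> fls_X_inv \<noteq> 0"
    using \<phi>z nonzero(1) by (rule no_zero_divisors)
  ultimately have "fps_to_fls \<mu> * fls_eval \<psi> fls_X_inv = fps_to_fls \<delta> * \<psi>z"
    by (simp only: mult_cancel_right simp_thms)
  then have \<mu>_eq: "fps_to_fls \<mu> = \<zeta> (i + 1) * (\<psi>z / fls_eval \<psi> fls_X_inv)"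
    by (simp only: \<delta>(1) times_divide_eq_right nonzero_eq_divide_eq[OF nonzero(2)])
  \<comment> \<open>The switch exchanges t_ii and t_(i+1,i+1), so the eigenvalue \<mu> of D moves to
    position i.\<close>
  define \<zeta>' where "\<zeta>' = \<zeta>(i := fps_to_fls \<mu>, i + 1 := fps_to_fls \<nu>)"
  have \<zeta>'_eq: "\<zeta>(i := \<zeta> (i + 1) * (poly_at_infinity (pcompose \<psi> [:- of_int (s i), 1:]) / poly_at_infinity \<psi>),
       i + 1 := \<zeta> i * (poly_at_infinity (pcompose \<phi> [:- of_int (s i), 1:]) / poly_at_infinity \<phi>)) = \<zeta>'"
    unfolding \<zeta>'_def poly_at_infinity_eq fls_eval_shift \<nu>_eq \<mu>_eq \<phi>z_def \<psi>z_def ..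
  let ?\<sigma> = "transpose i (i + 1)"
  have ST: "S.T j l r = T (?\<sigma> j) (?\<sigma> l) r" for j l r
    unfolding S.T_def T_def switch_action_def switch_iso_t[OF i] ..
  \<comment> \<open>The switched t_(i,i+1) is C, which kills w; every other strictly upper pair
    stays strictly upper under the transposition.\<close>
  have ST_zero: "S.T j l r w = 0" if jl: "j \<in> {1..N}" "l \<in> {1..N}" "j < l" for j l r
  proof (cases "(j, l) = (i, i + 1)")
    case True
    then have \<sigma>: "?\<sigma> j = i + 1" "?\<sigma> l = i" by simp_all
    show ?thesis unfolding ST \<sigma> by (rule C_w)
  next
    case False
    then have "?\<sigma> j < ?\<sigma> l" "(?\<sigma> j, ?\<sigma> l) \<noteq> (i, i + 1)" "?\<sigma> j \<in> {1..N}" "?\<sigma> l \<in> {1..N}"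
      using jl i by (auto simp: transpose_def)
    then show ?thesis using wK unfolding ST K_def by blast
  qed
  have Se: "switch_action i act (S.e j l r) w = 0" if "l \<in> {1..N}" "j \<in> {1..<l}" for j l r
    by (rule S.T_zero_imp_e_zero[of "N + 1"]) (use ST_zero that in auto)
  have "switch_action i act (S.d j r) w = scale (\<zeta>' j $$ int r) w" if j: "j \<in> {1..N}" for j r
  proof -
    have "switch_action i act (S.d j r) w = T (?\<sigma> j) (?\<sigma> j) r w"
      unfolding ST[symmetric] by (rule S.e_zero_imp_T_zero(2)[OF Se j, symmetric])
    also have "\<dots> = scale (\<zeta>' j $$ int r) w"
    proof -
      consider "j = i" | "j = i + 1" | "j \<noteq> i" "j \<noteq> i + 1" by blast
      then show ?thesis
      proof cases
        case 1 then show ?thesis using D_w[of r] by (simp add: \<zeta>'_def)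
      next
        case 2 then show ?thesis using A_w[of r] by (simp add: \<zeta>'_def)
      next
        case 3
        then have "T j j r w = scale (\<zeta> j $$ int r) w" using wK j unfolding K_def c_def by blast
        then show ?thesis using 3 by (simp add: \<zeta>'_def)
      qed
    qed
    finally show ?thesis .
  qed
  moreover have "ell_weight N \<zeta>'"
    using v(4) \<nu>0 unfolding ell_weight_def \<zeta>'_def by auto
  ultimately have "highest_ell_weight_vector N (switch i s) scale V (switch_action i act) \<zeta>' w"
    unfolding highest_ell_weight_vector_def using w0 wV Se by blast
  then show ?thesis unfolding w_eq \<zeta>'_eq N_def .
qed

end
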